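(* Let $(G,\mathbb{P})$ be a finitely generated relatively hyperbolic group. Then for each peripheral subgroup $P\in\mathbb{P}$ the inclusion $i_P:P\hookrightarrow G$ induces a Morse preserving map $\partial_M i_P:\partial_M P\to\partial_M G$. Therefore, $\partial_M i_P:\partial_M P\to\partial_M G$ is a topological embedding.
   Context: All metric spaces are proper geodesic metric spaces. $\Gamma(G,S)$ denotes the Cayley graph of $G$ with respect to $S$, with edges of length 1. **Relative hyperbolicity.** Let $G$ be a finitely generated group, $S$ a finite generating set and $\mathbb{P}$ a finite collection of subgroups of $G$. The coned-off Cayley graph $\hat\Gamma(G,S,\mathbb{P})$ is obtained from $\Gamma(G,S)$ by adding, for each left coset $gP$ with $P\in\mathbb{P}$, a vertex $v_{gP}$, and for each $x\in gP$ an edge of length $1/2$ from $x$ to $v_{gP}$. $(G,\mathbb{P})$ is relatively hyperbolic if $\hat\Gamma(G,S,\mathbb{P})$ is $\delta$-hyperbolic for some $\delta$ and fine (for each $n>0$, each edge is contained in only finitely many circuits, i.e. embedded cycles, of length $n$). The members of $\mathbb{P}$ are the peripheral subgroups; it is known that they are finitely generated and that the inclusions $i_P:P\hookrightarrow G$ are quasi-isometric embeddings. **Morse geodesics.** A $(K,L)$-quasi-geodesic is a map $\gamma$ from an interval of $\mathbb{R}$ with $\frac1K|s-t|-L\le d(\gamma(s),\gamma(t))\le K|s-t|+L$; a geodesic is a $(1,0)$-quasi-geodesic. For a function $N:[1,\infty)\times[0,\infty)\to[0,\infty)$ (a Morse gauge), a quasi-geodesic $\gamma$ is $N$-Morse if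 for all $K\ge1$, $L>0$ every $(K,L)$-quasi-geodesic with endpoints on $\gamma$ lies in the $N(K,L)$-neighborhood of $\gamma$; it is Morse if it is $N$-Morse for some $N$. Let $\mathcal{M}$ be the set of all Morse gauges, ordered pointwise. **Morse boundary.** For a space $X$ and basepoint $p$, $\partial_M X_p$ is the set of equivalence classes $[\alpha]$ of Morse geodesic rays $\alpha:[0,\infty)\to X$ with $\alpha(0)=p$, where $\alpha,\alpha'$ are equivalent if there is $K$ with $d(\alpha(t),\alpha'(t))<K$ for all $t>0$. $\partial_M^N X_p$ is the subset of classes containing an $N$-Morse geodesic ray from $p$. In $\partial_M^N X_p$, $x_n\to x$ means: there exist $N$-Morse geodesic rays $\alpha_n$ with $\alpha_n(0)=p$, $[\alpha_n]=x_n$, such that every subsequence of $(\alpha_n)$ contains a subsequence converging uniformly on compact sets to a geodesic ray $\alpha$ with $[\alpha]=x$. A subset $F$ is closed if $\{x_n\}\subset F$ and $x_n\to x$ imply $x\in F$. $\partial_M X_p$ carries the direct limit topology $\varinjlim_{\mathcal{M}}\partial_M^N X_p$ over all Morse gauges. It is independent of the basepoint and a quasi-isometry invariant; the Morse boundary $\partial_M G$ of a finitely generated group is the Morse boundary of its Cayley graph. **Morse preserving maps.** A map $f:\partial_M X_p\to\partial_M Y_{p'}$ is Morse preserving if for each $N\in\mathcal{M}$ there is $N'\in\mathcal{M}$ such that $f$ maps $\partial_M^N X_p$ injectively into $\partial_M^{N'}Y_{p'}$. A quasi-isometric embedding $\phi:H\to G$ of finitely generated groups, extended to $\Phi:\Gamma(H,T)\to\Gamma(G,S)$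 for some (any) finite generating sets $T,S$, induces a Morse preserving map if the induced map $\partial_M\phi=\partial_M\Phi$, sending $[\alpha]$ to the class of a Morse geodesic ray at the basepoint at finite Hausdorff distance from $\Phi\circ\alpha$, is defined on all of $\partial_M H$ and is Morse preserving. *)

theory Defs
  imports "HOL-Analysis.Analysis" "HOL-Algebra.Coset" "HOL-Algebra.Generated_Groups"
begin

section \<open>Metric graphs\<close>

text \<open>Graphs are simple: an edge is the two-element set of its endpoints.\<close>

record 'v mgraph =
  verts :: "'v set"
  edges :: "'v set set"
  elength :: "'v set \<Rightarrow> real"

definition wf_mgraph :: "'v mgraph \<Rightarrow> bool" where
  "wf_mgraph \<Gamma> \<longleftrightarrow> (\<forall>e\<in>edges \<Gamma>. e \<subseteq> verts \<Gamma> \<and> card e = 2)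
    \<and> (\<exists>\<epsilon>>0. \<forall>e\<in>edges \<Gamma>. \<epsilon> \<le> elength \<Gamma> e)"

text \<open>A point of the geometric realization is given by its barycentric coordinates, so that
  a point of the closed edge \<open>{u, v}\<close> is a convex combination of \<open>u\<close> and \<open>v\<close>. This makes the gluing
  of edges along common endpoints automatic.\<close>

definition vertex :: "'v \<Rightarrow> 'v \<Rightarrow> real" where
  "vertex v = indicat_real {v}"

definition cell :: "'v set \<Rightarrow> ('v \<Rightarrow> real) set" where
  "cell e = {x. (\<forall>v. 0 \<le> x v) \<and> (\<forall>v. v \<notin> e \<longrightarrow> x v = 0) \<and> (\<Sum>v\<in>e. x v) = 1}"

definition points :: "'v mgraph \<Rightarrow> ('v \<Rightarrow> real) set" where
  "points \<Gamma> = vertex ` verts \<Gamma> \<union> (\<Union>e\<in>edges \<Gamma>. cell e)"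

text \<open>\<open>polygonal \<Gamma> x y r\<close>: there is a chain of points from \<open>x\<close> to \<open>y\<close> of total length \<open>r\<close>,
  consecutive points lying on a common edge. On an edge \<open>{u, v}\<close> one has
  \<open>\<bar>x u - y u\<bar> = \<bar>x v - y v\<bar>\<close>, which explains the factor 1/2. The metric of the
  realization is the resulting length metric.\<close>

inductive polygonal :: "'v mgraph \<Rightarrow> ('v \<Rightarrow> real) \<Rightarrow> ('v \<Rightarrow> real) \<Rightarrow> real \<Rightarrow> bool"
  for \<Gamma> where
  refl: "x \<in> points \<Gamma> \<Longrightarrow> polygonal \<Gamma> x x 0"
| step: "polygonal \<Gamma> x y r \<Longrightarrow> e \<in> edges \<Gamma> \<Longrightarrow> y \<in> cell e \<Longrightarrow> z \<in> cell e \<Longrightarrow>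
    polygonal \<Gamma> x z (r + elength \<Gamma> e * (\<Sum>v\<in>e. \<bar>y v - z v\<bar>) / 2)"

definition gdist :: "'v mgraph \<Rightarrow> ('v \<Rightarrow> real) \<Rightarrow> ('v \<Rightarrow> real) \<Rightarrow> real" where
  "gdist \<Gamma> x y = (if x \<in> points \<Gamma> \<and> y \<in> points \<Gamma> then Inf {r. polygonal \<Gamma> x y r} else 0)"

definition realization :: "'v mgraph \<Rightarrow> ('v \<Rightarrow> real) metric" where
  "realization \<Gamma> = metric (points \<Gamma>, gdist \<Gamma>)"

text \<open>A circuit (embedded cycle) is recorded as its set of edges.\<close>

definition circuits :: "'v mgraph \<Rightarrow> 'v set set set" where
  "circuits \<Gamma> = {C. C \<subseteq> edges \<Gamma> \<and> (\<exists>vs. 3 \<le> length vs \<and> distinct vs \<and>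
     C = {{vs ! i, vs ! (Suc i mod length vs)} |i. i < length vs})}"

definition fine_graph :: "'v mgraph \<Rightarrow> bool" where
  "fine_graph \<Gamma> \<longleftrightarrow> (\<forall>n>0. \<forall>e\<in>edges \<Gamma>. finite {C \<in> circuits \<Gamma>. e \<in> C \<and> (\<Sum>c\<in>C. elength \<Gamma> c) = n})"

section \<open>Geodesics and hyperbolicity\<close>

definition quasi_geodesic :: "'a metric \<Rightarrow> real \<Rightarrow> real \<Rightarrow> real set \<Rightarrow> (real \<Rightarrow> 'a) \<Rightarrow> bool" where
  "quasi_geodesic X K L I \<gamma> \<longleftrightarrow> is_interval I \<and> \<gamma> ` I \<subseteq> mspace X \<and>
    (\<forall>s\<in>I. \<forall>t\<in>I. 1 / K * \<bar>s - t\<bar> - L \<le> mdist X (\<gamma> s) (\<gamma> t) \<and>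
                mdist X (\<gamma> s) (\<gamma> t) \<le> K * \<bar>s - t\<bar> + L)"

abbreviation geodesic :: "'a metric \<Rightarrow> real set \<Rightarrow> (real \<Rightarrow> 'a) \<Rightarrow> bool" where
  "geodesic X \<equiv> quasi_geodesic X 1 0"

definition geodesic_segment :: "'a metric \<Rightarrow> 'a \<Rightarrow> 'a \<Rightarrow> 'a set \<Rightarrow> bool" where
  "geodesic_segment X x y A \<longleftrightarrow>
    (\<exists>l\<ge>0. \<exists>\<gamma>. geodesic X {0..l} \<gamma> \<and> \<gamma> 0 = x \<and> \<gamma> l = y \<and> A = \<gamma> ` {0..l})"

text \<open>Hyperbolicity in the sense of slim geodesic triangles.\<close>

definition hyperbolic :: "'a metric \<Rightarrow> real \<Rightarrow> bool" where
  "hyperbolic X \<delta> \<longleftrightarrow> (\<forall>x y z A B C.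
     geodesic_segment X x y A \<and> geodesic_segment X y z B \<and> geodesic_segment X z x C \<longrightarrow>
     (\<forall>a\<in>A. \<exists>b\<in>B \<union> C. mdist X a b \<le> \<delta>))"

section \<open>Cayley graphs and relative hyperbolicity\<close>

definition finite_generating_set :: "('a, 'b) monoid_scheme \<Rightarrow> 'a set \<Rightarrow> bool" where
  "finite_generating_set G S \<longleftrightarrow> finite S \<and> S \<subseteq> carrier G \<and> generate G S = carrier G"

definition finitely_generated_group :: "('a, 'b) monoid_scheme \<Rightarrow> bool" where
  "finitely_generated_group G \<longleftrightarrow> group G \<and> (\<exists>S. finite_generating_set G S)"

definition cayley_graph :: "('a, 'b) monoid_scheme \<Rightarrow> 'a set \<Rightarrow> 'a mgraph" where
  "cayley_graph G S = \<lparr> verts = carrier G,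
     edges = {{g, g \<otimes>\<^bsub>G\<^esub> s} |g s. g \<in> carrier G \<and> s \<in> S \<and> s \<noteq> \<one>\<^bsub>G\<^esub>},
     elength = (\<lambda>e. 1) \<rparr>"

abbreviation cayley_space :: "('a, 'b) monoid_scheme \<Rightarrow> 'a set \<Rightarrow> ('a \<Rightarrow> real) metric" where
  "cayley_space G S \<equiv> realization (cayley_graph G S)"

text \<open>The vertex \<open>Inr (g <# P)\<close> is the cone vertex of the left coset; the coset, as a set,
  determines \<open>P\<close>.\<close>

definition coned_off_graph ::
    "('a, 'b) monoid_scheme \<Rightarrow> 'a set \<Rightarrow> 'a set set \<Rightarrow> ('a + 'a set) mgraph" where
  "coned_off_graph G S \<P> = \<lparr>
     verts = Inl ` carrier G \<union> {Inr (g <#\<^bsub>G\<^esub> P) |g P. g \<in> carrier G \<and> P \<in> \<P>},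
     edges = (image Inl) ` edges (cayley_graph G S) \<union>
       {{Inl x, Inr (g <#\<^bsub>G\<^esub> P)} |x g P. g \<in> carrier G \<and> P \<in> \<P> \<and> x \<in> g <#\<^bsub>G\<^esub> P},
     elength = (\<lambda>e. if e \<subseteq> range Inl then 1 else 1 / 2) \<rparr>"

definition relatively_hyperbolic :: "('a, 'b) monoid_scheme \<Rightarrow> 'a set set \<Rightarrow> bool" where
  "relatively_hyperbolic G \<P> \<longleftrightarrow> group G \<and> finite \<P> \<and> (\<forall>P\<in>\<P>. subgroup P G) \<and>
     (\<exists>S. finite_generating_set G S \<and>
        (\<exists>\<delta>. hyperbolic (realization (coned_off_graph G S \<P>)) \<delta>) \<and>
        fine_graph (coned_off_graph G S \<P>))"

section \<open>The Morse boundary\<close>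

text \<open>Gauges are functions on \<open>[1,\<infinity>) \<times> [0,\<infinity>)\<close>; values outside this domain are never used.\<close>

definition morse_gauges :: "(real \<Rightarrow> real \<Rightarrow> real) set" where
  "morse_gauges = {N. \<forall>K\<ge>1. \<forall>L\<ge>0. 0 \<le> N K L}"

definition morse_with :: "'a metric \<Rightarrow> (real \<Rightarrow> real \<Rightarrow> real) \<Rightarrow> real set \<Rightarrow> (real \<Rightarrow> 'a) \<Rightarrow> bool" where
  "morse_with X N I \<gamma> \<longleftrightarrow> (\<forall>K\<ge>1. \<forall>L>0. \<forall>a b \<sigma>.
     a \<le> b \<and> quasi_geodesic X K L {a..b} \<sigma> \<and> \<sigma> a \<in> \<gamma> ` I \<and> \<sigma> b \<in> \<gamma> ` I \<longrightarrow>
     (\<forall>t\<in>{a..b}. \<exists>s\<in>I. mdist X (\<sigma> t) (\<gamma> s) \<le> N K L))"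

definition morse_rays :: "'a metric \<Rightarrow> 'a \<Rightarrow> (real \<Rightarrow> 'a) set" where
  "morse_rays X p = {\<alpha>. geodesic X {0..} \<alpha> \<and> \<alpha> 0 = p \<and> (\<exists>N\<in>morse_gauges. morse_with X N {0..} \<alpha>)}"

definition asymptotic :: "'a metric \<Rightarrow> 'a \<Rightarrow> ((real \<Rightarrow> 'a) \<times> (real \<Rightarrow> 'a)) set" where
  "asymptotic X p = {(\<alpha>, \<beta>). \<alpha> \<in> morse_rays X p \<and> \<beta> \<in> morse_rays X p \<and>
     (\<exists>K. \<forall>t>0. mdist X (\<alpha> t) (\<beta> t) < K)}"

definition morse_boundary :: "'a metric \<Rightarrow> 'a \<Rightarrow> (real \<Rightarrow> 'a) set set" where
  "morse_boundary X p = morse_rays X p // asymptotic X p"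

definition morse_stratum ::
    "'a metric \<Rightarrow> 'a \<Rightarrow> (real \<Rightarrow> real \<Rightarrow> real) \<Rightarrow> (real \<Rightarrow> 'a) set set" where
  "morse_stratum X p N = {x \<in> morse_boundary X p. \<exists>\<alpha>\<in>x. morse_with X N {0..} \<alpha>}"

definition converges_uniformly_on_compacts ::
    "'a metric \<Rightarrow> (nat \<Rightarrow> real \<Rightarrow> 'a) \<Rightarrow> (real \<Rightarrow> 'a) \<Rightarrow> bool" where
  "converges_uniformly_on_compacts X \<alpha> \<beta> \<longleftrightarrow> (\<forall>C. compact C \<and> C \<subseteq> {0..} \<longrightarrow>
     (\<forall>\<epsilon>>0. \<forall>\<^sub>F n in sequentially. \<forall>t\<in>C. mdist X (\<alpha> n t) (\<beta> t) < \<epsilon>))"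

text \<open>Elements of the boundary are classes, so \<open>[\<alpha>] = x\<close> is expressed as \<open>\<alpha> \<in> x\<close>; in particular
  such an \<open>\<alpha>\<close> is a geodesic ray issuing from \<open>p\<close>.\<close>

definition stratum_converges ::
    "'a metric \<Rightarrow> (real \<Rightarrow> real \<Rightarrow> real) \<Rightarrow> (nat \<Rightarrow> (real \<Rightarrow> 'a) set) \<Rightarrow> (real \<Rightarrow> 'a) set \<Rightarrow> bool" where
  "stratum_converges X N x y \<longleftrightarrow> (\<exists>\<alpha>. (\<forall>n. \<alpha> n \<in> x n \<and> morse_with X N {0..} (\<alpha> n)) \<and>
     (\<forall>r :: nat \<Rightarrow> nat. strict_mono r \<longrightarrow> (\<exists>r' :: nat \<Rightarrow> nat. strict_mono r' \<and>
        (\<exists>\<beta>\<in>y. converges_uniformly_on_compacts X (\<alpha> \<circ> r \<circ> r') \<beta>))))"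

definition stratum_closed ::
    "'a metric \<Rightarrow> 'a \<Rightarrow> (real \<Rightarrow> real \<Rightarrow> real) \<Rightarrow> (real \<Rightarrow> 'a) set set \<Rightarrow> bool" where
  "stratum_closed X p N F \<longleftrightarrow> F \<subseteq> morse_stratum X p N \<and>
     (\<forall>x. \<forall>y\<in>morse_stratum X p N. range x \<subseteq> F \<and> stratum_converges X N x y \<longrightarrow> y \<in> F)"

definition stratum_topology ::
    "'a metric \<Rightarrow> 'a \<Rightarrow> (real \<Rightarrow> real \<Rightarrow> real) \<Rightarrow> (real \<Rightarrow> 'a) set topology" where
  "stratum_topology X p N = topology (\<lambda>U. U \<subseteq> morse_stratum X p N \<and>
     stratum_closed X p N (morse_stratum X p N - U))"

text \<open>The strata exhaust the boundary and increase with the gauge, so their direct limit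
  is the boundary with the final topology for the inclusions.\<close>

definition morse_boundary_topology :: "'a metric \<Rightarrow> 'a \<Rightarrow> (real \<Rightarrow> 'a) set topology" where
  "morse_boundary_topology X p = topology (\<lambda>U. U \<subseteq> morse_boundary X p \<and>
     (\<forall>N\<in>morse_gauges. openin (stratum_topology X p N) (U \<inter> morse_stratum X p N)))"

section \<open>Induced maps\<close>

definition morse_preserving ::
    "'a metric \<Rightarrow> 'a \<Rightarrow> 'b metric \<Rightarrow> 'b \<Rightarrow> ((real \<Rightarrow> 'a) set \<Rightarrow> (real \<Rightarrow> 'b) set) \<Rightarrow> bool" where
  "morse_preserving X p Y q f \<longleftrightarrow> f \<in> morse_boundary X p \<rightarrow> morse_boundary Y q \<and>
     (\<forall>N\<in>morse_gauges. \<exists>N'\<in>morse_gauges.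
        inj_on f (morse_stratum X p N) \<and> f ` morse_stratum X p N \<subseteq> morse_stratum Y q N')"

definition finite_hausdorff_distance :: "'a metric \<Rightarrow> 'a set \<Rightarrow> 'a set \<Rightarrow> bool" where
  "finite_hausdorff_distance X A B \<longleftrightarrow>
     (\<exists>D. (\<forall>a\<in>A. \<exists>b\<in>B. mdist X a b \<le> D) \<and> (\<forall>b\<in>B. \<exists>a\<in>A. mdist X a b \<le> D))"

definition boundary_image ::
    "'a metric \<Rightarrow> 'a \<Rightarrow> 'b metric \<Rightarrow> 'b \<Rightarrow> ('a \<Rightarrow> 'b) \<Rightarrow> (real \<Rightarrow> 'a) set \<Rightarrow> (real \<Rightarrow> 'b) set \<Rightarrow> bool" where
  "boundary_image X p Y q \<Phi> x y \<longleftrightarrow> x \<in> morse_boundary X p \<and> y \<in> morse_boundary Y q \<and>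
     (\<forall>\<alpha>\<in>x. \<exists>\<beta>\<in>y. finite_hausdorff_distance Y ((\<Phi> \<circ> \<alpha>) ` {0..}) (\<beta> ` {0..}))"

definition boundary_map_defined ::
    "'a metric \<Rightarrow> 'a \<Rightarrow> 'b metric \<Rightarrow> 'b \<Rightarrow> ('a \<Rightarrow> 'b) \<Rightarrow> bool" where
  "boundary_map_defined X p Y q \<Phi> \<longleftrightarrow> (\<forall>x\<in>morse_boundary X p. \<exists>!y. boundary_image X p Y q \<Phi> x y)"

definition boundary_map ::
    "'a metric \<Rightarrow> 'a \<Rightarrow> 'b metric \<Rightarrow> 'b \<Rightarrow> ('a \<Rightarrow> 'b) \<Rightarrow> (real \<Rightarrow> 'a) set \<Rightarrow> (real \<Rightarrow> 'b) set" where
  "boundary_map X p Y q \<Phi> x = (THE y. boundary_image X p Y q \<Phi> x y)"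

definition group_qi_embedding ::
    "('a, 'c) monoid_scheme \<Rightarrow> ('b, 'd) monoid_scheme \<Rightarrow> ('a \<Rightarrow> 'b) \<Rightarrow> bool" where
  "group_qi_embedding H G \<phi> \<longleftrightarrow> \<phi> ` carrier H \<subseteq> carrier G \<and>
     (\<forall>T S. finite_generating_set H T \<and> finite_generating_set G S \<longrightarrow>
        (\<exists>K\<ge>1. \<exists>L\<ge>0. \<forall>g\<in>carrier H. \<forall>h\<in>carrier H.
           1 / K * mdist (cayley_space H T) (vertex g) (vertex h) - L
             \<le> mdist (cayley_space G S) (vertex (\<phi> g)) (vertex (\<phi> h)) \<and>
           mdist (cayley_space G S) (vertex (\<phi> g)) (vertex (\<phi> h))
             \<le> K * mdist (cayley_space H T) (vertex g) (vertex h) + L))"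

text \<open>Extensions of \<open>\<phi>\<close> to the Cayley graphs send each edge, at constant speed, to a geodesic
  joining the images of its endpoints.\<close>

definition cayley_extension ::
    "('a, 'c) monoid_scheme \<Rightarrow> 'a set \<Rightarrow> ('b, 'd) monoid_scheme \<Rightarrow> 'b set \<Rightarrow> ('a \<Rightarrow> 'b) \<Rightarrow>
     (('a \<Rightarrow> real) \<Rightarrow> ('b \<Rightarrow> real)) \<Rightarrow> bool" where
  "cayley_extension H T G S \<phi> \<Phi> \<longleftrightarrow>
     \<Phi> ` mspace (cayley_space H T) \<subseteq> mspace (cayley_space G S) \<and>
     (\<forall>h\<in>carrier H. \<Phi> (vertex h) = vertex (\<phi> h)) \<and>
     (\<forall>u v. {u, v} \<in> edges (cayley_graph H T) \<longrightarrow> (\<forall>x\<in>cell {u, v}. \<forall>y\<in>cell {u, v}.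
        mdist (cayley_space G S) (\<Phi> x) (\<Phi> y)
          = \<bar>x u - y u\<bar> * mdist (cayley_space G S) (vertex (\<phi> u)) (vertex (\<phi> v))))"

abbreviation group_boundary_topology ::
    "('a, 'b) monoid_scheme \<Rightarrow> 'a set \<Rightarrow> (real \<Rightarrow> 'a \<Rightarrow> real) set topology" where
  "group_boundary_topology G S \<equiv> morse_boundary_topology (cayley_space G S) (vertex \<one>\<^bsub>G\<^esub>)"

abbreviation group_boundary_map ::
    "('a, 'c) monoid_scheme \<Rightarrow> 'a set \<Rightarrow> ('b, 'd) monoid_scheme \<Rightarrow> 'b set \<Rightarrow>
     (('a \<Rightarrow> real) \<Rightarrow> ('b \<Rightarrow> real)) \<Rightarrow> (real \<Rightarrow> 'a \<Rightarrow> real) set \<Rightarrow> (real \<Rightarrow> 'b \<Rightarrow> real) set" where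
  "group_boundary_map H T G S \<equiv>
     boundary_map (cayley_space H T) (vertex \<one>\<^bsub>H\<^esub>) (cayley_space G S) (vertex \<one>\<^bsub>G\<^esub>)"

definition induces_morse_preserving_map ::
    "('a, 'c) monoid_scheme \<Rightarrow> ('b, 'd) monoid_scheme \<Rightarrow> ('a \<Rightarrow> 'b) \<Rightarrow> bool" where
  "induces_morse_preserving_map H G \<phi> \<longleftrightarrow>
     finitely_generated_group H \<and> finitely_generated_group G \<and> group_qi_embedding H G \<phi> \<and>
     (\<forall>T S \<Phi>. finite_generating_set H T \<and> finite_generating_set G S \<and>
        cayley_extension H T G S \<phi> \<Phi> \<longrightarrow>
        boundary_map_defined (cayley_space H T) (vertex \<one>\<^bsub>H\<^esub>) (cayley_space G S) (vertex \<one>\<^bsub>G\<^esub>) \<Phi> \<and>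
        morse_preserving (cayley_space H T) (vertex \<one>\<^bsub>H\<^esub>) (cayley_space G S) (vertex \<one>\<^bsub>G\<^esub>)
          (group_boundary_map H T G S \<Phi>))"

section \<open>Well-formedness of the constructions\<close>

lemma vertex_in_cell: "v \<in> e \<Longrightarrow> finite e \<Longrightarrow> vertex v \<in> cell e"
proof -
  assume v: "v \<in> e" "finite e"
  have eq: "vertex v = (\<lambda>w. if w = v then 1 else 0)"
    by (simp add: vertex_def indicator_def fun_eq_iff)
  show "vertex v \<in> cell e"
    unfolding eq cell_def using v by auto
qed

lemma polygonal_points:
  assumes "polygonal \<Gamma> x y r" shows "x \<in> points \<Gamma> \<and> y \<in> points \<Gamma>"
  using assms by induction (auto simp: points_def)

lemma polygonal_trans:
  assumes "polygonal \<Gamma> y z s" "polygonal \<Gamma> x y r" shows "polygonal \<Gamma> x z (r + s)"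
  using assms
proof (induction)
  case (step y z s e w)
  then show ?case using polygonal.step[of \<Gamma> x z "r + s" e w] by (simp add: add.assoc)
qed auto

lemma polygonal_step1:
  assumes "e \<in> edges \<Gamma>" "x \<in> cell e" "y \<in> cell e"
  shows "polygonal \<Gamma> x y (elength \<Gamma> e * (\<Sum>v\<in>e. \<bar>x v - y v\<bar>) / 2)"
proof -
  have "x \<in> points \<Gamma>" using assms by (auto simp: points_def)
  from polygonal.step[OF polygonal.refl[OF this] assms] show ?thesis by simp
qed

lemma polygonal_sym:
  assumes "polygonal \<Gamma> x y r" shows "polygonal \<Gamma> y x r"
  using assms
proof (induction)
  case (step x y r e z)
  have "polygonal \<Gamma> z y (elength \<Gamma> e * (\<Sum>v\<in>e. \<bar>z v - y v\<bar>) / 2)"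
    using polygonal_step1[of e \<Gamma> z y] step by simp
  from polygonal_trans[OF step.IH this] show ?case
    by (simp add: abs_minus_commute add.commute)
qed (rule polygonal.refl)

lemma cell_diff:
  assumes "card e = 2" "x \<in> cell e" "y \<in> cell e" "v \<in> e"
  shows "(\<Sum>w\<in>e. \<bar>x w - y w\<bar>) / 2 = \<bar>x v - y v\<bar>"
proof -
  obtain u where u: "e = {v, u}" "u \<noteq> v" using assms(1,4)
    by (auto simp: card_2_iff)
  with assms have "x v + x u = 1" "y v + y u = 1" by (auto simp: cell_def)
  hence "\<bar>x u - y u\<bar> = \<bar>x v - y v\<bar>" by linarith
  with u show ?thesis by auto
qed

lemma polygonal_lower:
  assumes "polygonal \<Gamma> x y r" "\<forall>e\<in>edges \<Gamma>. card e = 2" "0 < \<epsilon>" "\<forall>e\<in>edges \<Gamma>. \<epsilon> \<le> elength \<Gamma> e"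
  shows "\<epsilon> * \<bar>x v - y v\<bar> \<le> r"
  using assms(1)
proof (induction)
  case (step x y r e z)
  have len: "\<epsilon> \<le> elength \<Gamma> e" using step assms by auto
  have "\<epsilon> * \<bar>y v - z v\<bar> \<le> elength \<Gamma> e * (\<Sum>v\<in>e. \<bar>y v - z v\<bar>) / 2"
  proof (cases "v \<in> e")
    case True
    with cell_diff[of e y z v] step assms
    have eq: "(\<Sum>w\<in>e. \<bar>y w - z w\<bar>) / 2 = \<bar>y v - z v\<bar>" by blast
    have "\<epsilon> * \<bar>y v - z v\<bar> \<le> elength \<Gamma> e * \<bar>y v - z v\<bar>"
      using len by (intro mult_right_mono) auto
    with eq show ?thesis by (metis times_divide_eq_right)
  next
    case False
    then have "y v = z v" using step by (auto simp: cell_def)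
    moreover have "0 \<le> elength \<Gamma> e * (\<Sum>v\<in>e. \<bar>y v - z v\<bar>)"
      using len assms(3) by (intro mult_nonneg_nonneg sum_nonneg) auto
    ultimately show ?thesis by simp
  qed
  moreover have "\<epsilon> * \<bar>x v - z v\<bar> \<le> \<epsilon> * \<bar>x v - y v\<bar> + \<epsilon> * \<bar>y v - z v\<bar>"
    using assms(3) by (simp flip: distrib_left)
  ultimately show ?case using step.IH by linarith
qed simp

lemma Metric_space_gdist:
  assumes wf: "wf_mgraph \<Gamma>"
    and conn: "\<And>u v. u \<in> verts \<Gamma> \<Longrightarrow> v \<in> verts \<Gamma> \<Longrightarrow> \<exists>r. polygonal \<Gamma> (vertex u) (vertex v) r"
  shows "Metric_space (points \<Gamma>) (gdist \<Gamma>)"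
proof -
  obtain \<epsilon> where e: "\<epsilon> > 0" "\<forall>e\<in>edges \<Gamma>. \<epsilon> \<le> elength \<Gamma> e" and c: "\<forall>e\<in>edges \<Gamma>. card e = 2"
    and sub: "\<forall>e\<in>edges \<Gamma>. e \<subseteq> verts \<Gamma>"
    using wf by (auto simp: wf_mgraph_def)
  note lower = polygonal_lower[OF _ c e]
  have nn: "0 \<le> r" if "polygonal \<Gamma> x y r" for x y r
    using lower[OF that, of undefined] e(1) by (smt (verit) mult_nonneg_nonneg)
  have bdd: "bdd_below {r. polygonal \<Gamma> x y r}" for x y
    using nn by (auto simp: bdd_below_def)
  have ex1: "\<exists>v\<in>verts \<Gamma>. \<exists>r. polygonal \<Gamma> x (vertex v) r" if x: "x \<in> points \<Gamma>" for x
  proof (cases "x \<in> vertex ` verts \<Gamma>")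
    case True
    then show ?thesis using polygonal.refl[OF x] by auto
  next
    case False
    then obtain f where f: "f \<in> edges \<Gamma>" "x \<in> cell f" using x unfolding points_def by blast
    then obtain v where v: "v \<in> f" "finite f" using c
      by (metis card.empty card.infinite ex_in_conv zero_neq_numeral)
    then show ?thesis using polygonal_step1[OF f vertex_in_cell[OF v]] f sub by blast
  qed
  have ne: "{r. polygonal \<Gamma> x y r} \<noteq> {}" if "x \<in> points \<Gamma>" "y \<in> points \<Gamma>" for x y
  proof -
    from ex1[OF that(1)] obtain u r where u: "u \<in> verts \<Gamma>" "polygonal \<Gamma> x (vertex u) r" by blast
    from ex1[OF that(2)] obtain v s where v: "v \<in> verts \<Gamma>" "polygonal \<Gamma> y (vertex v) s" by blast
    from conn[OF u(1) v(1)] obtain t where "polygonal \<Gamma> (vertex u) (vertex v) t" by blast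
    from polygonal_trans[OF polygonal_trans[OF polygonal_sym[OF v(2)] this] u(2)] show ?thesis by blast
  qed
  have d: "gdist \<Gamma> x y = Inf {r. polygonal \<Gamma> x y r}" if "x \<in> points \<Gamma>" "y \<in> points \<Gamma>" for x y
    using that by (simp add: gdist_def)
  have dnn: "0 \<le> gdist \<Gamma> x y" for x y
    using ne[of x y] nn by (auto simp: gdist_def intro!: cInf_greatest)
  show ?thesis
  proof
    fix x y
    show "0 \<le> gdist \<Gamma> x y" by (rule dnn)
    have "{r. polygonal \<Gamma> x y r} = {r. polygonal \<Gamma> y x r}" using polygonal_sym by blast
    then show "gdist \<Gamma> x y = gdist \<Gamma> y x" by (simp add: gdist_def)
  next
    fix x y assume xy: "x \<in> points \<Gamma>" "y \<in> points \<Gamma>"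
    show "gdist \<Gamma> x y = 0 \<longleftrightarrow> x = y"
    proof
      assume 0: "gdist \<Gamma> x y = 0"
      show "x = y"
      proof
        fix v
        have "\<epsilon> * \<bar>x v - y v\<bar> \<le> gdist \<Gamma> x y"
          unfolding d[OF xy] using ne[OF xy] lower by (intro cInf_greatest) auto
        then show "x v = y v" using 0 e(1) by (simp add: mult_le_0_iff)
      qed
    next
      assume "x = y"
      then have "polygonal \<Gamma> x y 0" using xy polygonal.refl by auto
      then have "gdist \<Gamma> x y \<le> 0" unfolding d[OF xy] by (intro cInf_lower bdd) auto
      with dnn[of x y] show "gdist \<Gamma> x y = 0" by simp
    qed
  next
    fix x y z assume xyz: "x \<in> points \<Gamma>" "y \<in> points \<Gamma>" "z \<in> points \<Gamma>"
    have "gdist \<Gamma> x z - s \<le> gdist \<Gamma> x y" if s: "polygonal \<Gamma> y z s" for s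
    proof -
      have "gdist \<Gamma> x z - s \<le> r" if "polygonal \<Gamma> x y r" for r
      proof -
        have "gdist \<Gamma> x z \<le> r + s"
          unfolding d[OF xyz(1,3)] using polygonal_trans[OF s that] by (intro cInf_lower bdd) auto
        then show ?thesis by simp
      qed
      then show ?thesis
        unfolding d[OF xyz(1,2)] using ne[OF xyz(1,2)] by (intro cInf_greatest) auto
    qed
    then have "gdist \<Gamma> x z - gdist \<Gamma> x y \<le> gdist \<Gamma> y z"
      unfolding d[OF xyz(2,3)] using ne[OF xyz(2,3)]
      by (intro cInf_greatest) (auto simp: algebra_simps)
    then show "gdist \<Gamma> x z \<le> gdist \<Gamma> x y + gdist \<Gamma> y z" by simp
  qed
qed

lemma wf_cayley_graph:
  assumes "group G" "S \<subseteq> carrier G" shows "wf_mgraph (cayley_graph G S)"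
proof -
  interpret group G by fact
  have ne: "g \<noteq> g \<otimes>\<^bsub>G\<^esub> s" if "g \<in> carrier G" "s \<in> S" "s \<noteq> \<one>\<^bsub>G\<^esub>" for g s
    using that assms(2) l_cancel_one'[of g s] by blast
  have "e \<subseteq> carrier G \<and> card e = 2" if "e \<in> edges (cayley_graph G S)" for e
  proof -
    from that obtain g s where "e = {g, g \<otimes>\<^bsub>G\<^esub> s}" "g \<in> carrier G" "s \<in> S" "s \<noteq> \<one>\<^bsub>G\<^esub>"
      by (auto simp: cayley_graph_def)
    then show ?thesis using assms(2) ne[of g s] by (auto simp: subset_iff)
  qed
  moreover have "elength (cayley_graph G S) e = 1" "verts (cayley_graph G S) = carrier G" for e
    by (simp_all add: cayley_graph_def)
  ultimately show ?thesis
    unfolding wf_mgraph_def by (intro conjI exI[of _ 1]) auto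
qed

lemma polygonal_edge:
  assumes "{u, v} \<in> edges \<Gamma>"
  shows "\<exists>r. polygonal \<Gamma> (vertex u) (vertex v) r"
  using polygonal_step1[OF assms, of "vertex u" "vertex v"] vertex_in_cell[of _ "{u, v}"] by auto

lemma vertex_polygonal_refl: "v \<in> verts \<Gamma> \<Longrightarrow> \<exists>r. polygonal \<Gamma> (vertex v) (vertex v) r"
  using polygonal.refl[of "vertex v" \<Gamma>] by (auto simp: points_def)

lemma generate_connected:
  assumes "group G" "finite_generating_set G S" "u \<in> carrier G" "v \<in> carrier G"
    and f: "\<And>g. g \<in> carrier G \<Longrightarrow> f g \<in> verts \<Gamma>"
    and ed: "\<And>g s. g \<in> carrier G \<Longrightarrow> s \<in> S \<Longrightarrow> s \<noteq> \<one>\<^bsub>G\<^esub> \<Longrightarrow> {f g, f (g \<otimes>\<^bsub>G\<^esub> s)} \<in> edges \<Gamma>"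
  shows "\<exists>r. polygonal \<Gamma> (vertex (f u)) (vertex (f v)) r"
proof -
  interpret group G by fact
  have S: "S \<subseteq> carrier G" using assms(2) by (simp add: finite_generating_set_def)
  define R where "R g h \<longleftrightarrow> (\<exists>r. polygonal \<Gamma> (vertex (f g)) (vertex (f h)) r)" for g h
  have R1: "R g g" if "g \<in> carrier G" for g
    unfolding R_def using f[OF that] by (rule vertex_polygonal_refl)
  have R2: "R g h \<Longrightarrow> R h g" for g h unfolding R_def using polygonal_sym by blast
  have R3: "R g h \<Longrightarrow> R h k \<Longrightarrow> R g k" for g h k unfolding R_def using polygonal_trans by blast
  have gen: "R g (g \<otimes>\<^bsub>G\<^esub> s)" if "s \<in> S" "g \<in> carrier G" for g s
  proof (cases "s = \<one>\<^bsub>G\<^esub>")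
    case True
    then show ?thesis using R1 that by simp
  next
    case False
    then show ?thesis unfolding R_def by (intro polygonal_edge ed that)
  qed
  have "R g (g \<otimes>\<^bsub>G\<^esub> h)" if "h \<in> generate G S" "g \<in> carrier G" for g h
    using that
  proof (induction arbitrary: g)
    case one
    then show ?case using R1 by simp
  next
    case (incl h)
    then show ?case by (intro gen)
  next
    case (inv h)
    then have h: "h \<in> carrier G" using S by auto
    then have "R (g \<otimes>\<^bsub>G\<^esub> inv\<^bsub>G\<^esub> h) (g \<otimes>\<^bsub>G\<^esub> inv\<^bsub>G\<^esub> h \<otimes>\<^bsub>G\<^esub> h)"
      using inv by (intro gen) auto
    then show ?case using R2 h inv by (simp add: m_assoc)
  next
    case (eng h k)
    have hk: "h \<in> carrier G" "k \<in> carrier G"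
      using eng(1,2) generate_in_carrier[OF S] by auto
    then have "R (g \<otimes>\<^bsub>G\<^esub> h) (g \<otimes>\<^bsub>G\<^esub> h \<otimes>\<^bsub>G\<^esub> k)" using eng by simp
    with R3[OF eng.IH(1)[OF eng.prems]] show ?case using hk eng.prems by (simp add: m_assoc)
  qed
  from this[of "inv\<^bsub>G\<^esub> u \<otimes>\<^bsub>G\<^esub> v" u] show ?thesis
    using assms(2-4) unfolding R_def by (simp add: finite_generating_set_def flip: m_assoc)
qed

lemma Metric_space_cayley_graph:
  assumes "group G" "finite_generating_set G S"
  shows "Metric_space (points (cayley_graph G S)) (gdist (cayley_graph G S))"
proof (intro Metric_space_gdist wf_cayley_graph assms)
  show "S \<subseteq> carrier G" using assms(2) by (simp add: finite_generating_set_def)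
  fix u v assume "u \<in> verts (cayley_graph G S)" "v \<in> verts (cayley_graph G S)"
  then show "\<exists>r. polygonal (cayley_graph G S) (vertex u) (vertex v) r"
    using generate_connected[OF assms, of u v "\<lambda>g. g" "cayley_graph G S"]
    by (auto simp: cayley_graph_def)
qed

lemma wf_coned_off_graph:
  assumes "group G" "S \<subseteq> carrier G" "\<forall>P\<in>\<P>. subgroup P G"
  shows "wf_mgraph (coned_off_graph G S \<P>)"
proof -
  interpret group G by fact
  have cay: "e \<subseteq> carrier G \<and> card e = 2" if "e \<in> edges (cayley_graph G S)" for e
    using wf_cayley_graph[OF assms(1,2)] that by (auto simp: wf_mgraph_def cayley_graph_def)
  have "e \<subseteq> verts (coned_off_graph G S \<P>) \<and> card e = 2" if e: "e \<in> edges (coned_off_graph G S \<P>)" for e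
  proof -
    consider e' where "e' \<in> edges (cayley_graph G S)" "e = Inl ` e'"
      | x g P where "g \<in> carrier G" "P \<in> \<P>" "x \<in> g <#\<^bsub>G\<^esub> P" "e = {Inl x, Inr (g <#\<^bsub>G\<^esub> P)}"
      using e by (auto simp: coned_off_graph_def)
    then show ?thesis
    proof cases
      case 1
      then show ?thesis using cay[of e'] by (auto simp: coned_off_graph_def card_image)
    next
      case 2
      then have "x \<in> carrier G"
        using assms(3) l_coset_subset_G[of P g] subgroup.subset by blast
      with 2 show ?thesis by (auto simp: coned_off_graph_def)
    qed
  qed
  moreover have "\<forall>e\<in>edges (coned_off_graph G S \<P>). 1 / 2 \<le> elength (coned_off_graph G S \<P>) e"
    by (simp add: coned_off_graph_def)
  ultimately show ?thesis unfolding wf_mgraph_def by (intro conjI exI[of _ "1 / 2"]) auto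
qed

lemma Metric_space_coned_off_graph:
  assumes "group G" "finite_generating_set G S" "\<forall>P\<in>\<P>. subgroup P G"
  shows "Metric_space (points (coned_off_graph G S \<P>)) (gdist (coned_off_graph G S \<P>))"
proof -
  interpret group G by fact
  let ?C = "coned_off_graph G S \<P>"
  have S: "S \<subseteq> carrier G" using assms(2) by (simp add: finite_generating_set_def)
  have base: "\<exists>r. polygonal ?C (vertex (Inl u)) (vertex (Inl v)) r"
    if "u \<in> carrier G" "v \<in> carrier G" for u v
  proof (rule generate_connected[OF assms(1,2) that])
    fix g s assume "g \<in> carrier G" "s \<in> S" "s \<noteq> \<one>\<^bsub>G\<^esub>"
    then have "{g, g \<otimes>\<^bsub>G\<^esub> s} \<in> edges (cayley_graph G S)" by (auto simp: cayley_graph_def)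
    then have "Inl ` {g, g \<otimes>\<^bsub>G\<^esub> s} \<in> edges ?C"
      unfolding coned_off_graph_def mgraph.simps by blast
    then show "{Inl g, Inl (g \<otimes>\<^bsub>G\<^esub> s)} \<in> edges ?C" by simp
  qed (simp add: coned_off_graph_def)
  have near: "\<exists>g\<in>carrier G. \<exists>r. polygonal ?C (vertex (Inl g)) (vertex v) r" if v: "v \<in> verts ?C" for v
  proof -
    consider g where "g \<in> carrier G" "v = Inl g"
      | g P where "g \<in> carrier G" "P \<in> \<P>" "v = Inr (g <#\<^bsub>G\<^esub> P)"
      using v by (auto simp: coned_off_graph_def)
    then show ?thesis
    proof cases
      case 1
      then show ?thesis using base by blast
    next
      case 2
      then have "\<one>\<^bsub>G\<^esub> \<in> P" using assms(3) subgroup.one_closed by blast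
      then have "g \<in> g <#\<^bsub>G\<^esub> P"
        unfolding l_coset_def using 2(1) by (intro UN_I[of "\<one>\<^bsub>G\<^esub>"]) auto
      then have "{Inl g, v} \<in> edges ?C" unfolding coned_off_graph_def mgraph.simps 2(3) using 2 by blast
      from polygonal_edge[OF this] 2(1) show ?thesis by (intro bexI[of _ g])
    qed
  qed
  show ?thesis
  proof (intro Metric_space_gdist wf_coned_off_graph assms S)
    fix u v assume "u \<in> verts ?C" "v \<in> verts ?C"
    then obtain g h r s where "g \<in> carrier G" "polygonal ?C (vertex (Inl g)) (vertex u) r"
      "h \<in> carrier G" "polygonal ?C (vertex (Inl h)) (vertex v) s"
      using near by meson
    then show "\<exists>r. polygonal ?C (vertex u) (vertex v) r"
      using base polygonal_sym polygonal_trans by meson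
  qed
qed

lemma realization_simps:
  assumes "Metric_space (points \<Gamma>) (gdist \<Gamma>)"
  shows "mspace (realization \<Gamma>) = points \<Gamma>" "mdist (realization \<Gamma>) = gdist \<Gamma>"
  using assms by (simp_all add: realization_def Metric_space.mspace_metric Metric_space.mdist_metric)

lemma converges_subseq:
  assumes "stratum_converges X N x y" "strict_mono (r :: nat \<Rightarrow> nat)"
  shows "stratum_converges X N (x \<circ> r) y"
proof -
  obtain \<alpha> where a: "\<forall>n. \<alpha> n \<in> x n \<and> morse_with X N {0..} (\<alpha> n)"
    and b: "\<And>r. strict_mono (r :: nat \<Rightarrow> nat) \<Longrightarrow> \<exists>r'. strict_mono (r' :: nat \<Rightarrow> nat) \<and>
        (\<exists>\<beta>\<in>y. converges_uniformly_on_compacts X (\<alpha> \<circ> r \<circ> r') \<beta>)"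
    using assms(1) unfolding stratum_converges_def by blast
  have "\<exists>r'. strict_mono (r' :: nat \<Rightarrow> nat) \<and>
      (\<exists>\<beta>\<in>y. converges_uniformly_on_compacts X ((\<alpha> \<circ> r) \<circ> q \<circ> r') \<beta>)"
    if "strict_mono (q :: nat \<Rightarrow> nat)" for q
    using b[OF strict_mono_o[OF assms(2) that]] by (simp add: o_assoc)
  with a show ?thesis
    unfolding stratum_converges_def by (intro exI[of _ "\<alpha> \<circ> r"]) auto
qed

lemma stratum_closed_Un:
  assumes "stratum_closed X p N A" "stratum_closed X p N B"
  shows "stratum_closed X p N (A \<union> B)"
  unfolding stratum_closed_def
proof (intro conjI allI ballI impI)
  show "A \<union> B \<subseteq> morse_stratum X p N" using assms by (auto simp: stratum_closed_def)
  fix x y assume y: "y \<in> morse_stratum X p N" and x: "range x \<subseteq> A \<union> B \<and> stratum_converges X N x y"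
  have *: "y \<in> F" if F: "stratum_closed X p N F" and inf: "infinite {n. x n \<in> F}" for F
  proof -
    from infinite_enumerate[OF inf] obtain r :: "nat \<Rightarrow> nat"
      where r: "strict_mono r" "\<forall>n. x (r n) \<in> F" by auto
    have "range (x \<circ> r) \<subseteq> F" using r by auto
    then show ?thesis using F y converges_subseq[of X N x y r] x r(1)
      unfolding stratum_closed_def by blast
  qed
  have "{n. x n \<in> A} \<union> {n. x n \<in> B} = UNIV" using x by auto
  then have "infinite {n. x n \<in> A} \<or> infinite {n. x n \<in> B}"
    by (metis finite_Un infinite_UNIV_nat)
  then show "y \<in> A \<union> B" using * assms by blast
qed

lemma openin_stratum_topology:
  "openin (stratum_topology X p N) U \<longleftrightarrow>
     U \<subseteq> morse_stratum X p N \<and> stratum_closed X p N (morse_stratum X p N - U)"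
proof -
  let ?M = "morse_stratum X p N"
  have "istopology (\<lambda>U. U \<subseteq> ?M \<and> stratum_closed X p N (?M - U))"
    unfolding istopology_def
  proof (intro conjI allI impI)
    fix U V assume "U \<subseteq> ?M \<and> stratum_closed X p N (?M - U)" "V \<subseteq> ?M \<and> stratum_closed X p N (?M - V)"
    then show "stratum_closed X p N (?M - U \<inter> V)"
      using stratum_closed_Un[of X p N "?M - U" "?M - V"] by (simp add: Diff_Int)
  next
    fix \<K> assume K: "\<forall>K\<in>\<K>. K \<subseteq> ?M \<and> stratum_closed X p N (?M - K)"
    show "stratum_closed X p N (?M - \<Union>\<K>)"
      unfolding stratum_closed_def
    proof (intro conjI allI ballI impI)
      fix x y assume y: "y \<in> ?M" and x: "range x \<subseteq> ?M - \<Union>\<K> \<and> stratum_converges X N x y"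
      have "y \<in> ?M - K" if k: "K \<in> \<K>" for K
      proof -
        have "stratum_closed X p N (?M - K)" using K k by blast
        moreover have "range x \<subseteq> ?M - K" using x k by blast
        ultimately show ?thesis using x y unfolding stratum_closed_def by blast
      qed
      then show "y \<in> ?M - \<Union>\<K>" using y by blast
    qed auto
  qed auto
  then show ?thesis unfolding stratum_topology_def by (simp add: topology_inverse')
qed

lemma openin_morse_boundary_topology:
  "openin (morse_boundary_topology X p) U \<longleftrightarrow> U \<subseteq> morse_boundary X p \<and>
     (\<forall>N\<in>morse_gauges. openin (stratum_topology X p N) (U \<inter> morse_stratum X p N))"
proof -
  have "istopology (\<lambda>U. U \<subseteq> morse_boundary X p \<and>
     (\<forall>N\<in>morse_gauges. openin (stratum_topology X p N) (U \<inter> morse_stratum X p N)))"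
    unfolding istopology_def
  proof (intro conjI allI impI ballI)
    fix U V N assume "U \<subseteq> morse_boundary X p \<and>
        (\<forall>N\<in>morse_gauges. openin (stratum_topology X p N) (U \<inter> morse_stratum X p N))"
      "V \<subseteq> morse_boundary X p \<and>
        (\<forall>N\<in>morse_gauges. openin (stratum_topology X p N) (V \<inter> morse_stratum X p N))"
      "N \<in> morse_gauges"
    then have "openin (stratum_topology X p N) ((U \<inter> morse_stratum X p N) \<inter> (V \<inter> morse_stratum X p N))"
      by - (rule openin_Int, blast+)
    then show "openin (stratum_topology X p N) (U \<inter> V \<inter> morse_stratum X p N)"
      by (simp add: Int_ac)
  next
    fix \<K> N assume "\<forall>K\<in>\<K>. K \<subseteq> morse_boundary X p \<and>
        (\<forall>N\<in>morse_gauges. openin (stratum_topology X p N) (K \<inter> morse_stratum X p N))"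
      "N \<in> morse_gauges"
    then have "openin (stratum_topology X p N) (\<Union>K\<in>\<K>. K \<inter> morse_stratum X p N)"
      by - (rule openin_Union, blast)
    then show "openin (stratum_topology X p N) (\<Union>\<K> \<inter> morse_stratum X p N)"
      by (simp only: Int_Union2)
  qed auto
  then show ?thesis unfolding morse_boundary_topology_def by (simp add: topology_inverse')
qed

lemma topspace_morse_boundary_topology [simp]:
  "topspace (morse_boundary_topology X p) = morse_boundary X p"
proof
  show "topspace (morse_boundary_topology X p) \<subseteq> morse_boundary X p"
    using openin_morse_boundary_topology[of X p "topspace (morse_boundary_topology X p)"] by simp
  have "morse_boundary X p \<inter> morse_stratum X p N = morse_stratum X p N" for N
    by (auto simp: morse_stratum_def)
  then have "openin (morse_boundary_topology X p) (morse_boundary X p)"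
    by (simp add: openin_morse_boundary_topology openin_stratum_topology stratum_closed_def)
  then show "morse_boundary X p \<subseteq> topspace (morse_boundary_topology X p)"
    by (rule openin_subset)
qed

end

theory Submission
  imports Defs "HOL-Library.Diagonal_Subsequence"
begin

text \<open>In the coned-off graph \<open>\<Gamma>\<close>, let \<open>v\<close> be the cone vertex of \<open>P\<close>, and let \<open>\<pi> x \<in> P\<close> be the point at which a
  geodesic of \<open>\<Gamma>\<close> from \<open>x\<close> to \<open>v\<close> enters \<open>P\<close>. By fineness, only finitely many circuits of a given length run through
  \<open>v\<close>, up to translation by \<open>P\<close>. Together with slim triangles this shows that \<open>\<pi>\<close> is coarsely Lipschitz and that, away
  from \<open>P\<close>, it strongly contracts: there is a constant \<open>c\<close> such that for every \<open>M\<close> a step of length \<open>M\<close> that starts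
  sufficiently far from \<open>P\<close> moves \<open>\<pi>\<close> by at most \<open>c\<close>. Hence \<open>P\<close> is finitely generated and undistorted, and every
  quasi-geodesic of \<open>G\<close> with endpoints near \<open>P\<close> stays near \<open>P\<close>, with uniform constants.

  Therefore a quasi-geodesic of \<open>G\<close> with endpoints near a Morse ray of \<open>P\<close> is close to a quasi-geodesic of \<open>P\<close>, so that
  the ray is also Morse in \<open>G\<close>, and conversely. The gauges correspond to each other in both directions. By the
  Arzela-Ascoli theorem, convergence in the strata does too, so the boundary map is continuous, injective and closed.\<close>

section \<open>Walks in metric graphs\<close>

text \<open>The coned-off graph forgets distances inside \<open>P\<close>, so slim triangles alone
  cannot bound how far \<open>\<pi>\<close> moves in \<open>P\<close>. The bound comes from
  fineness: two entry points joined by a short walk that avoids the cone vertex close up to a short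
  circuit through it. Contraction is recorded by finite sets of group elements, not by word lengths:
  \<open>P\<close> is not yet known to be finitely generated, and finite sets do not depend on
  generators.

  An embedding requires control of the inverse boundary map too, and this inverse is defined on a
  part of the boundary of \<open>G\<close> only. Therefore the axioms of \<open>coarse_pair\<close>
  are symmetric, boundary points are compared by the relation \<open>related\<close>, and one
  transfer result, applied in both directions, yields continuity and closedness.

  The second obstacle is uniformity. Rays at finite Hausdorff distance come with a constant that
  depends on the two rays, while a gauge must serve a whole stratum. A quasi-geodesic ray at any
  finite distance from a Morse ray with the same origin is within a distance governed by the gauge
  and the quasi-geodesic constants, and this removes the dependence.\<close>

definition graph_walk :: "'v mgraph \<Rightarrow> 'v list \<Rightarrow> bool" where
  "graph_walk \<Gamma> ws \<longleftrightarrow> ws \<noteq> [] \<and> set ws \<subseteq> verts \<Gamma> \<and> successively (\<lambda>u v. {u, v} \<in> edges \<Gamma>) ws"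

fun walk_length :: "'v mgraph \<Rightarrow> 'v list \<Rightarrow> real" where
  "walk_length \<Gamma> [] = 0"
| "walk_length \<Gamma> [x] = 0"
| "walk_length \<Gamma> (x # y # ws) = elength \<Gamma> {x, y} + walk_length \<Gamma> (y # ws)"

lemma walk_length_append:
  "xs \<noteq> [] \<Longrightarrow> ys \<noteq> [] \<Longrightarrow>
    walk_length \<Gamma> (xs @ ys) = walk_length \<Gamma> xs + elength \<Gamma> {last xs, hd ys} + walk_length \<Gamma> ys"
proof (induction xs)
  case (Cons x xs)
  then show ?case by (cases xs; cases ys) auto
qed auto

lemma walk_length_join:
  "walk_length \<Gamma> (xs @ x # ys) = walk_length \<Gamma> (xs @ [x]) + walk_length \<Gamma> (x # ys)"
  by (cases "xs = []"; cases ys) (auto simp: walk_length_append)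

lemma walk_length_rev: "walk_length \<Gamma> (rev ws) = walk_length \<Gamma> ws"
proof (induction \<Gamma> ws rule: walk_length.induct)
  case (3 \<Gamma> x y ws)
  then show ?case using walk_length_join[of \<Gamma> "rev ws" y "[x]"]
    by (simp add: insert_commute)
qed auto

lemma graph_walk_append:
  "xs \<noteq> [] \<Longrightarrow> ys \<noteq> [] \<Longrightarrow> graph_walk \<Gamma> (xs @ ys) \<longleftrightarrow>
    graph_walk \<Gamma> xs \<and> graph_walk \<Gamma> ys \<and> {last xs, hd ys} \<in> edges \<Gamma>"
  by (auto simp: graph_walk_def successively_append_iff)

lemma graph_walk_join:
  "graph_walk \<Gamma> (xs @ x # ys) \<longleftrightarrow> graph_walk \<Gamma> (xs @ [x]) \<and> graph_walk \<Gamma> (x # ys)"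
  by (cases "xs = []"; cases ys) (auto simp: graph_walk_append, auto simp: graph_walk_def)

lemma graph_walk_rev: "graph_walk \<Gamma> (rev ws) \<longleftrightarrow> graph_walk \<Gamma> ws"
  by (simp add: graph_walk_def insert_commute)

text \<open>The set \<open>V\<close> serves to exclude a vertex: below it is the complement of the
  cone vertex. After removal of loops, such a walk between two neighbours of that vertex closes up
  to a circuit through it.\<close>

definition joined :: "'v mgraph \<Rightarrow> 'v set \<Rightarrow> real \<Rightarrow> 'v \<Rightarrow> 'v \<Rightarrow> bool" where
  "joined \<Gamma> V n u w \<longleftrightarrow>
    (\<exists>ws. graph_walk \<Gamma> ws \<and> hd ws = u \<and> last ws = w \<and> set ws \<subseteq> V \<and> walk_length \<Gamma> ws \<le> n)"

lemma joined_mono: "joined \<Gamma> V n u w \<Longrightarrow> V \<subseteq> V' \<Longrightarrow> n \<le> n' \<Longrightarrow> joined \<Gamma> V' n' u w"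
  unfolding joined_def by (metis order_trans subset_trans)

lemma joined_sym: "joined \<Gamma> V n u w \<Longrightarrow> joined \<Gamma> V n w u"
  unfolding joined_def
  by (metis graph_walk_rev hd_rev last_rev set_rev walk_length_rev)

lemma joined_trans:
  assumes "joined \<Gamma> V n u w" "joined \<Gamma> V m w z" shows "joined \<Gamma> V (n + m) u z"
proof -
  obtain xs where xs: "graph_walk \<Gamma> xs" "hd xs = u" "last xs = w" "set xs \<subseteq> V" "walk_length \<Gamma> xs \<le> n"
    using assms(1) by (auto simp: joined_def)
  obtain ys where ys: "graph_walk \<Gamma> ys" "hd ys = w" "last ys = z" "set ys \<subseteq> V" "walk_length \<Gamma> ys \<le> m"
    using assms(2) by (auto simp: joined_def)
  have ne: "xs \<noteq> []" "ys \<noteq> []" using xs(1) ys(1) by (auto simp: graph_walk_def)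
  obtain xs' where x: "xs = xs' @ [w]" using ne xs(3) by (metis append_butlast_last_id)
  obtain ys' where y: "ys = w # ys'" using ne ys(2) by (metis list.collapse)
  have "graph_walk \<Gamma> (xs' @ w # ys')" using xs(1) ys(1) unfolding x y graph_walk_join[of _ xs' w ys'] by simp
  moreover have "walk_length \<Gamma> (xs' @ w # ys') \<le> n + m"
    using xs(5) ys(5) unfolding x y walk_length_join[of _ xs' w ys'] by simp
  moreover have "hd (xs' @ w # ys') = u" using xs(2) x by (cases xs') auto
  moreover have "last (xs' @ w # ys') = z" using ys(3) y by simp
  moreover have "set (xs' @ w # ys') \<subseteq> V" using xs(4) ys(4) x y by auto
  ultimately show ?thesis unfolding joined_def by blast
qed

text \<open>Common frame for the Cayley graph and the coned-off graph. Walks have half-integral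
  length, so the infimum in \<open>gdist\<close> is attained between vertices, and only finitely
  many lengths lie below a given bound.\<close>

locale half_graph =
  fixes \<Gamma> :: "'v mgraph"
  assumes wf: "wf_mgraph \<Gamma>"
    and half: "e \<in> edges \<Gamma> \<Longrightarrow> elength \<Gamma> e = 1/2 \<or> elength \<Gamma> e = 1"
    and conn: "u \<in> verts \<Gamma> \<Longrightarrow> v \<in> verts \<Gamma> \<Longrightarrow> \<exists>r. polygonal \<Gamma> (vertex u) (vertex v) r"
begin

abbreviation X where "X \<equiv> realization \<Gamma>"

abbreviation dv :: "'v \<Rightarrow> 'v \<Rightarrow> real" where "dv u v \<equiv> gdist \<Gamma> (vertex u) (vertex v)"

sublocale M: Metric_space "points \<Gamma>" "gdist \<Gamma>"
  by (rule Metric_space_gdist[OF wf conn])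

lemma mspace_X [simp]: "mspace X = points \<Gamma>" and mdist_X [simp]: "mdist X = gdist \<Gamma>"
  using realization_simps[OF M.Metric_space_axioms] by auto

lemma edge_card: "e \<in> edges \<Gamma> \<Longrightarrow> card e = 2" and edge_verts: "e \<in> edges \<Gamma> \<Longrightarrow> e \<subseteq> verts \<Gamma>"
  using wf by (auto simp: wf_mgraph_def)

lemma edge_neq: "{u, v} \<in> edges \<Gamma> \<Longrightarrow> u \<noteq> v"
  using edge_card[of "{u, v}"] by auto

lemma elength_bounds: "e \<in> edges \<Gamma> \<Longrightarrow> 1/2 \<le> elength \<Gamma> e \<and> elength \<Gamma> e \<le> 1"
  using half by fastforce

lemma elength_nonneg: "e \<in> edges \<Gamma> \<Longrightarrow> 0 \<le> elength \<Gamma> e"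
  using elength_bounds by fastforce

lemma vertex_points [simp]: "v \<in> verts \<Gamma> \<Longrightarrow> vertex v \<in> points \<Gamma>"
  by (simp add: points_def)

lemma cell_points: "e \<in> edges \<Gamma> \<Longrightarrow> x \<in> cell e \<Longrightarrow> x \<in> points \<Gamma>"
  by (auto simp: points_def)

lemma polygonal_nonneg: "polygonal \<Gamma> x y r \<Longrightarrow> 0 \<le> r"
proof -
  assume a: "polygonal \<Gamma> x y r"
  have "1/2 * \<bar>x undefined - y undefined\<bar> \<le> r"
    by (rule polygonal_lower[OF a]) (use edge_card elength_bounds in auto)
  then show "0 \<le> r" by (smt (verit) zero_le_mult_iff divide_nonneg_nonneg)
qed

lemma gdist_le: "polygonal \<Gamma> x y r \<Longrightarrow> gdist \<Gamma> x y \<le> r"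
  using polygonal_points[of \<Gamma> x y r] polygonal_nonneg
  by (auto simp: gdist_def bdd_below_def intro!: cInf_lower exI[of _ 0])

lemma gdist_same_cell:
  assumes "e \<in> edges \<Gamma>" "x \<in> cell e" "y \<in> cell e" "v \<in> e"
  shows "gdist \<Gamma> x y \<le> elength \<Gamma> e * \<bar>x v - y v\<bar>"
proof -
  have "(\<Sum>v\<in>e. \<bar>x v - y v\<bar>) = 2 * \<bar>x v - y v\<bar>"
    using cell_diff[of e x y v] edge_card assms by auto
  with gdist_le[OF polygonal_step1[OF assms(1-3)]] show ?thesis by simp
qed

lemma gdist_edge: "{u, v} \<in> edges \<Gamma> \<Longrightarrow> dv u v \<le> elength \<Gamma> {u, v}"
  using gdist_same_cell[of "{u, v}" "vertex u" "vertex v" u] edge_neq[of u v]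
  by (simp add: vertex_in_cell) (simp add: vertex_def)

lemma vertex_apply: "vertex u w = (if w = u then 1 else 0)"
  by (simp add: vertex_def indicator_def)

lemma cell_vertexI: "x \<in> cell e \<Longrightarrow> finite e \<Longrightarrow> c \<in> e \<Longrightarrow> x c = 1 \<Longrightarrow> x = vertex c"
proof
  fix w assume x: "x \<in> cell e" "finite e" "c \<in> e" "x c = 1"
  have s: "(\<Sum>v\<in>e - {c}. x v) = 0" using x by (simp add: cell_def sum_diff1)
  have "x v = 0" if "v \<in> e - {c}" for v
    using s that x sum_nonneg_eq_0_iff[of "e - {c}" x] by (auto simp: cell_def)
  then show "x w = vertex c w" using x by (cases "w \<in> e") (auto simp: vertex_apply cell_def)
qed

section \<open>Distances between vertices are lengths of walks\<close>

lemma walk_length_nonneg: "graph_walk \<Gamma> ws \<Longrightarrow> 0 \<le> walk_length \<Gamma> ws"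
proof (induction \<Gamma>\<equiv>\<Gamma> ws rule: walk_length.induct)
  case (3 x y ws)
  then have "{x, y} \<in> edges \<Gamma>" "graph_walk \<Gamma> (y # ws)" by (auto simp: graph_walk_def)
  then show ?case using 3 elength_bounds[of "{x, y}"] by simp
qed auto

lemma walk_length_half: "graph_walk \<Gamma> ws \<Longrightarrow> \<exists>k::nat. walk_length \<Gamma> ws = k / 2"
proof (induction \<Gamma>\<equiv>\<Gamma> ws rule: walk_length.induct)
  case (3 x y ws)
  then have e: "{x, y} \<in> edges \<Gamma>" "graph_walk \<Gamma> (y # ws)" by (auto simp: graph_walk_def)
  then obtain k :: nat where "walk_length \<Gamma> (y # ws) = k / 2" using 3 by auto
  then show ?case using half[OF e(1)]
    by (auto intro: exI[of _ "k + 1"] exI[of _ "k + 2"] simp: field_simps)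
qed (auto intro: exI[of _ 0])

lemma gdist_le_walk_length: "graph_walk \<Gamma> ws \<Longrightarrow> dv (hd ws) (last ws) \<le> walk_length \<Gamma> ws"
proof (induction \<Gamma>\<equiv>\<Gamma> ws rule: walk_length.induct)
  case 1 then show ?case by (simp add: graph_walk_def)
next
  case (2 x) then show ?case by (simp add: graph_walk_def)
next
  case (3 x y ws)
  then have e: "{x, y} \<in> edges \<Gamma>" "graph_walk \<Gamma> (y # ws)" by (auto simp: graph_walk_def)
  have v: "x \<in> verts \<Gamma>" "y \<in> verts \<Gamma>" "last (y # ws) \<in> verts \<Gamma>"
    using 3(2) by (auto simp: graph_walk_def split: if_splits)
  have "dv (hd (y # ws)) (last (y # ws)) \<le> walk_length \<Gamma> (y # ws)" using 3(1) e(2) by simp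
  then show ?case using M.triangle[of "vertex x" "vertex y" "vertex (last (y # ws))"] gdist_edge[OF e(1)] v
    by auto
qed

text \<open>A chain can leave an edge only through one of its endpoints, so it may be replaced by a
  walk that is not longer. The invariant allows for a chain that stops inside an edge: the walk then
  ends at a vertex of this edge, and \<open>1 - y (last ws)\<close> is the fraction of the edge
  covered beyond it.\<close>

lemma polygonal_imp_walk:
  assumes "polygonal \<Gamma> x y r" "x = vertex u" "u \<in> verts \<Gamma>"
  shows "\<exists>ws. graph_walk \<Gamma> ws \<and> hd ws = u \<and>
    (y = vertex (last ws) \<and> walk_length \<Gamma> ws \<le> r \<or>
     (\<exists>b. {last ws, b} \<in> edges \<Gamma> \<and> y \<in> cell {last ws, b} \<and>
       walk_length \<Gamma> ws + elength \<Gamma> {last ws, b} * (1 - y (last ws)) \<le> r))"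
  using assms
proof (induction rule: polygonal.induct)
  case (refl x)
  then show ?case by (intro exI[of _ "[u]"]) (auto simp: graph_walk_def)
next
  case (step x y r e z)
  note e = step.hyps(2) and y = step.hyps(3) and z = step.hyps(4)
  let ?c = "\<lambda>v. elength \<Gamma> e * \<bar>y v - z v\<bar>"
  have cost: "elength \<Gamma> e * (\<Sum>v\<in>e. \<bar>y v - z v\<bar>) / 2 = ?c v" if "v \<in> e" for v
    using cell_diff[OF edge_card[OF e] y z that] by simp
  have fe: "finite e" using edge_card[OF e] card.infinite by force
  have from_vertex: ?case if w: "graph_walk \<Gamma> ws" "hd ws = u" "y = vertex (last ws)" "walk_length \<Gamma> ws \<le> r" for ws
  proof -
    have "y (last ws) = 1" using w by (simp add: vertex_apply)
    then have l: "last ws \<in> e" using y by (auto simp: cell_def)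
    then obtain b where b: "e = {last ws, b}" using edge_card[OF e] by (auto simp: card_2_iff)
    have "z (last ws) \<le> 1"
      using z fe l sum_nonneg_leq_bound[of e z 1 "last ws"] by (auto simp: cell_def)
    then have c: "?c (last ws) = elength \<Gamma> e * (1 - z (last ws))" using w by (simp add: vertex_apply)
    then have "walk_length \<Gamma> ws + elength \<Gamma> {last ws, b} * (1 - z (last ws))
        \<le> r + elength \<Gamma> e * (\<Sum>v\<in>e. \<bar>y v - z v\<bar>) / 2"
      unfolding cost[OF l] c using w(4) unfolding b by simp
    then show ?thesis using w b z e by blast
  qed
  from step obtain ws where ws: "graph_walk \<Gamma> ws" "hd ws = u"
    and alt: "y = vertex (last ws) \<and> walk_length \<Gamma> ws \<le> r \<or>
     (\<exists>b. {last ws, b} \<in> edges \<Gamma> \<and> y \<in> cell {last ws, b} \<and>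
       walk_length \<Gamma> ws + elength \<Gamma> {last ws, b} * (1 - y (last ws)) \<le> r)" by blast
  from alt show ?case
  proof (elim disjE exE conjE)
    assume "y = vertex (last ws)" "walk_length \<Gamma> ws \<le> r"
    then show ?thesis using from_vertex ws by blast
  next
    fix b assume b: "{last ws, b} \<in> edges \<Gamma>" "y \<in> cell {last ws, b}"
      "walk_length \<Gamma> ws + elength \<Gamma> {last ws, b} * (1 - y (last ws)) \<le> r"
    let ?a = "last ws"
    have ab: "?a \<noteq> b" using edge_neq b by blast
    have yab: "y ?a + y b = 1" "0 \<le> y ?a" "0 \<le> y b" using b(2) ab by (auto simp: cell_def)
    show ?thesis
    proof (cases "e = {?a, b}")
      case True
      have "elength \<Gamma> e * (1 - z ?a) \<le> elength \<Gamma> e * (1 - y ?a) + ?c ?a"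
        using elength_bounds[OF e] by (simp flip: distrib_left)
      then show ?thesis using True b e z ws cost[of ?a] by (intro exI[of _ ws]) auto
    next
      case False
      \<comment> \<open>If \<open>y\<close> were interior to the old edge, both endpoints of that
        edge would belong to \<open>e\<close>, and the two edges would coincide.\<close>
      have "\<exists>c\<in>{?a, b}. y c = 1"
      proof (rule ccontr)
        assume n: "\<not> ?thesis"
        then have "?a \<in> e" "b \<in> e" using y yab by (auto simp: cell_def)
        then have "{?a, b} \<subseteq> e" by simp
        then show False using False edge_card[OF e] ab fe
          by (metis card_2_iff card_subset_eq)
      qed
      then consider "y ?a = 1" | "y b = 1" by auto
      then show ?thesis
      proof cases
        case 1
        then have "y = vertex ?a" using cell_vertexI[OF b(2)] by simp
        then show ?thesis using 1 b(3) ws by (intro from_vertex[of ws]) auto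
      next
        case 2
        then have yb: "y = vertex b" using cell_vertexI[OF b(2)] by simp
        have ne: "ws \<noteq> []" using ws by (simp add: graph_walk_def)
        have "graph_walk \<Gamma> (ws @ [b])" using ws b edge_verts[OF b(1)] ne
          by (simp add: graph_walk_append) (simp add: graph_walk_def)
        then show ?thesis using 2 yab b(3) ws ne yb
          by (intro from_vertex[of "ws @ [b]"]) (auto simp: walk_length_append)
      qed
    qed
  qed
qed

lemma gdist_less_polygonal:
  assumes "x \<in> points \<Gamma>" "y \<in> points \<Gamma>" "gdist \<Gamma> x y < r"
    and ex: "polygonal \<Gamma> x y s"
  shows "\<exists>r'<r. polygonal \<Gamma> x y r'"
  using assms cInf_lessD[of "{r. polygonal \<Gamma> x y r}" r] by (auto simp: gdist_def)

lemma exists_polygonal_vertex: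
  assumes "x \<in> points \<Gamma>" shows "\<exists>v\<in>verts \<Gamma>. \<exists>r. polygonal \<Gamma> (vertex v) x r \<and> r \<le> 1"
proof (cases "x \<in> vertex ` verts \<Gamma>")
  case True
  then show ?thesis using polygonal.refl[OF assms] by force
next
  case False
  then obtain f where f: "f \<in> edges \<Gamma>" "x \<in> cell f" using assms unfolding points_def by blast
  then obtain u w where uw: "f = {u, w}" using edge_card by (meson card_2_iff)
  have u: "vertex u \<in> cell f" using uw by (simp add: vertex_in_cell)
  have "x u \<le> 1" "0 \<le> x u"
    using f(2) sum_nonneg_leq_bound[of f x 1 u] uw by (auto simp: cell_def)
  then have "elength \<Gamma> f * \<bar>vertex u u - x u\<bar> \<le> 1 * 1"
    using elength_bounds[OF f(1)] by (intro mult_mono) (auto simp: vertex_apply)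
  moreover have "(\<Sum>v\<in>f. \<bar>vertex u v - x v\<bar>) / 2 = \<bar>vertex u u - x u\<bar>"
    using cell_diff[OF edge_card[OF f(1)] u f(2), of u] uw by simp
  ultimately show ?thesis using polygonal_step1[OF f(1) u f(2)] edge_verts[OF f(1)] uw
    by (intro bexI[of _ u] exI conjI) auto
qed

lemma near_vertex:
  assumes "x \<in> points \<Gamma>" shows "\<exists>v\<in>verts \<Gamma>. gdist \<Gamma> x (vertex v) \<le> 1"
  using exists_polygonal_vertex[OF assms] gdist_le M.commute by (metis order_trans)

text \<open>Half-integral lengths have a least element, so a shortest walk exists. A chain shorter
  than it would yield a walk shorter than it.\<close>

lemma gdist_walk:
  assumes "u \<in> verts \<Gamma>" "w \<in> verts \<Gamma>"
  shows "\<exists>ws. graph_walk \<Gamma> ws \<and> hd ws = u \<and> last ws = w \<and> walk_length \<Gamma> ws = dv u w"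
proof -
  have *: "\<exists>ws. graph_walk \<Gamma> ws \<and> hd ws = u \<and> last ws = w \<and> walk_length \<Gamma> ws \<le> r"
    if r: "polygonal \<Gamma> (vertex u) (vertex w) r" for r
  proof -
    obtain ws where ws: "graph_walk \<Gamma> ws" "hd ws = u"
      and alt: "vertex w = vertex (last ws) \<and> walk_length \<Gamma> ws \<le> r \<or>
       (\<exists>b. {last ws, b} \<in> edges \<Gamma> \<and> vertex w \<in> cell {last ws, b} \<and>
         walk_length \<Gamma> ws + elength \<Gamma> {last ws, b} * (1 - vertex w (last ws)) \<le> r)"
      using polygonal_imp_walk[OF r _ assms(1)] by blast
    have inj: "vertex w = vertex c \<Longrightarrow> w = c" for c
      by (metis vertex_apply zero_neq_one)
    from alt show ?thesis
    proof (elim disjE exE conjE)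
      assume "vertex w = vertex (last ws)" "walk_length \<Gamma> ws \<le> r"
      then show ?thesis using inj ws by blast
    next
      fix b assume b: "{last ws, b} \<in> edges \<Gamma>" "vertex w \<in> cell {last ws, b}"
        "walk_length \<Gamma> ws + elength \<Gamma> {last ws, b} * (1 - vertex w (last ws)) \<le> r"
      then have "w \<in> {last ws, b}" by (auto simp: cell_def vertex_apply)
      moreover have ne: "ws \<noteq> []" using ws by (simp add: graph_walk_def)
      moreover have "graph_walk \<Gamma> (ws @ [b])" using ws b edge_verts[OF b(1)] ne
        by (simp add: graph_walk_append) (simp add: graph_walk_def)
      ultimately show ?thesis using ws b edge_neq[OF b(1)]
        by (cases "w = last ws"; intro exI[of _ "if w = last ws then ws else ws @ [b]"])
          (auto simp: vertex_apply walk_length_append)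
    qed
  qed
  define A where "A = {k::nat. \<exists>ws. graph_walk \<Gamma> ws \<and> hd ws = u \<and> last ws = w \<and> walk_length \<Gamma> ws = k / 2}"
  obtain s where s: "polygonal \<Gamma> (vertex u) (vertex w) s" using conn assms by blast
  have "A \<noteq> {}" using *[OF s] walk_length_half unfolding A_def by blast
  then have L: "Least (\<lambda>k. k \<in> A) \<in> A" by (auto intro: LeastI)
  then obtain ws where ws: "graph_walk \<Gamma> ws" "hd ws = u" "last ws = w" "walk_length \<Gamma> ws = (LEAST k. k \<in> A) / 2"
    unfolding A_def by blast
  have "walk_length \<Gamma> ws \<le> dv u w"
  proof (rule ccontr)
    assume "\<not> ?thesis"
    then obtain r where r: "r < walk_length \<Gamma> ws" "polygonal \<Gamma> (vertex u) (vertex w) r"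
      using gdist_less_polygonal[OF _ _ _ s] assms by force
    obtain zs where zs: "graph_walk \<Gamma> zs" "hd zs = u" "last zs = w" "walk_length \<Gamma> zs \<le> r" using *[OF r(2)] by blast
    then obtain k :: nat where k: "walk_length \<Gamma> zs = k / 2" using walk_length_half by blast
    then have "k \<in> A" using zs A_def by blast
    then have "(LEAST k. k \<in> A) \<le> k" by (rule Least_le)
    then show False using k zs r ws by simp
  qed
  then show ?thesis using ws gdist_le_walk_length[OF ws(1)] by (intro exI[of _ ws]) auto
qed


section \<open>Shortest walks as geodesics, and slim triangles of walks\<close>

definition edge_point :: "'v \<Rightarrow> 'v \<Rightarrow> real \<Rightarrow> 'v \<Rightarrow> real" where
  "edge_point a b s = (\<lambda>w. if w = a then 1 - s else if w = b then s else 0)"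

lemma edge_point_cell: "a \<noteq> b \<Longrightarrow> 0 \<le> s \<Longrightarrow> s \<le> 1 \<Longrightarrow> edge_point a b s \<in> cell {a, b}"
  by (auto simp: edge_point_def cell_def)

lemma edge_point_ends: "edge_point a b 0 = vertex a" "a \<noteq> b \<Longrightarrow> edge_point a b 1 = vertex b"
  by (auto simp: edge_point_def vertex_apply fun_eq_iff)

lemma edge_point_dist:
  assumes "{a, b} \<in> edges \<Gamma>" "0 \<le> s" "s \<le> 1" "0 \<le> t" "t \<le> 1"
  shows "gdist \<Gamma> (edge_point a b s) (edge_point a b t) \<le> elength \<Gamma> {a, b} * \<bar>s - t\<bar>"
  using gdist_same_cell[OF assms(1) edge_point_cell edge_point_cell, of s t a] edge_neq[OF assms(1)] assms
  by (simp add: edge_point_def abs_minus_commute)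

text \<open>The concatenation does not increase distances, and its two ends have the full distance
  \<open>l + elength \<Gamma> {a, b}\<close>. The triangle inequality then leaves no room for a
  shortcut between intermediate points.\<close>

lemma geodesic_extend:
  assumes g: "geodesic X {0..l} \<gamma>" "\<gamma> l = vertex a" "0 \<le> l"
    and ab: "{a, b} \<in> edges \<Gamma>" and d: "gdist \<Gamma> (\<gamma> 0) (vertex b) = l + elength \<Gamma> {a, b}"
  defines "m \<equiv> elength \<Gamma> {a, b}"
  defines "\<gamma>' \<equiv> \<lambda>t. if t \<le> l then \<gamma> t else edge_point a b ((t - l) / m)"
  shows "geodesic X {0..l + m} \<gamma>'" "\<gamma>' (l + m) = vertex b" "\<And>t. t \<in> {l..l + m} \<Longrightarrow> gdist \<Gamma> (\<gamma>' t) (vertex a) \<le> 1"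
proof -
  have m: "0 < m" "m \<le> 1" using elength_bounds[OF ab] by (auto simp: m_def)
  have neq: "a \<noteq> b" using edge_neq[OF ab] .
  have e2: "\<gamma>' t = edge_point a b ((t - l) / m)" if "l \<le> t" for t
    using that g(2) by (auto simp: \<gamma>'_def edge_point_ends)
  have u01: "0 \<le> (t - l) / m" "(t - l) / m \<le> 1" if "t \<in> {l..l + m}" for t
    using that m by (auto simp: field_simps)
  have pt2: "\<gamma>' t \<in> points \<Gamma>" if "t \<in> {l..l + m}" for t
    using that e2[of t] u01[OF that] edge_point_cell[OF neq] cell_points[OF ab] by auto
  have pt1: "\<gamma>' t \<in> points \<Gamma>" if "t \<in> {0..l}" for t
    using that g(1) by (auto simp: \<gamma>'_def quasi_geodesic_def)
  have pt: "\<gamma>' t \<in> points \<Gamma>" if "t \<in> {0..l + m}" for t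
    using pt1[of t] pt2[of t] that by (cases "t \<le> l") auto
  show fin: "\<gamma>' (l + m) = vertex b" using e2[of "l + m"] m neq by (simp add: edge_point_ends)
  have d1: "gdist \<Gamma> (\<gamma>' s) (\<gamma>' t) = \<bar>s - t\<bar>" if "s \<in> {0..l}" "t \<in> {0..l}" for s t
    using that g(1) by (auto simp: \<gamma>'_def quasi_geodesic_def intro: antisym)
  have d2: "gdist \<Gamma> (\<gamma>' s) (\<gamma>' t) \<le> \<bar>s - t\<bar>" if "s \<in> {l..l + m}" "t \<in> {l..l + m}" for s t
  proof -
    have "\<bar>(s - l) / m - (t - l) / m\<bar> = \<bar>s - t\<bar> / m"
      using m by (simp flip: diff_divide_distrib)
    then show ?thesis
      using edge_point_dist[OF ab u01[OF that(1)] u01[OF that(2)]] e2 that m by (simp add: m_def)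
  qed
  show "gdist \<Gamma> (\<gamma>' t) (vertex a) \<le> 1" if "t \<in> {l..l + m}" for t
    using d2[OF that, of l] that m g(2,3) by (auto simp: \<gamma>'_def split: if_splits)
  have ends: "gdist \<Gamma> (\<gamma>' 0) (\<gamma>' (l + m)) = l + m"
    using d fin g(3) by (simp add: \<gamma>'_def m_def)
  have up: "gdist \<Gamma> (\<gamma>' s) (\<gamma>' t) \<le> t - s" if "0 \<le> s" "s \<le> t" "t \<le> l + m" for s t
  proof -
    consider "t \<le> l" | "l \<le> s" | "s \<le> l" "l \<le> t" by linarith
    then show ?thesis
    proof cases
      case 1 then show ?thesis using d1[of s t] that by auto
    next
      case 2 then show ?thesis using d2[of s t] that by auto
    next
      case 3
      then show ?thesis using d1[of s l] d2[of l t] M.triangle[OF pt pt pt, of s l t] that m g(3) by auto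
    qed
  qed
  have "gdist \<Gamma> (\<gamma>' s) (\<gamma>' t) = t - s" if st: "0 \<le> s" "s \<le> t" "t \<le> l + m" for s t
  proof -
    have "l + m \<le> gdist \<Gamma> (\<gamma>' 0) (\<gamma>' s) + gdist \<Gamma> (\<gamma>' s) (\<gamma>' (l + m))"
      using M.triangle[OF pt pt pt, of 0 s "l + m"] st m g(3) ends by auto
    moreover have "gdist \<Gamma> (\<gamma>' s) (\<gamma>' (l + m)) \<le> gdist \<Gamma> (\<gamma>' s) (\<gamma>' t) + gdist \<Gamma> (\<gamma>' t) (\<gamma>' (l + m))"
      using M.triangle[OF pt pt pt, of s t "l + m"] st m g(3) by auto
    ultimately show ?thesis using up[of 0 s] up[of t "l + m"] up[OF st] st by linarith
  qed
  then have "gdist \<Gamma> (\<gamma>' s) (\<gamma>' t) = \<bar>s - t\<bar>" if "s \<in> {0..l + m}" "t \<in> {0..l + m}" for s t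
    using that M.commute[of "\<gamma>' s" "\<gamma>' t"] by (cases "s \<le> t") auto
  then show "geodesic X {0..l + m} \<gamma>'"
    unfolding quasi_geodesic_def using pt by (auto simp: is_interval_cc)
qed

lemma walk_geodesic:
  assumes "graph_walk \<Gamma> ws" "walk_length \<Gamma> ws = dv (hd ws) (last ws)"
  shows "\<exists>\<gamma>. geodesic X {0..walk_length \<Gamma> ws} \<gamma> \<and> \<gamma> 0 = vertex (hd ws) \<and>
    \<gamma> (walk_length \<Gamma> ws) = vertex (last ws) \<and>
    (\<forall>t\<in>{0..walk_length \<Gamma> ws}. \<exists>a\<in>set ws. gdist \<Gamma> (\<gamma> t) (vertex a) \<le> 1) \<and>
    (\<forall>a\<in>set ws. \<exists>t\<in>{0..walk_length \<Gamma> ws}. \<gamma> t = vertex a)"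
  using assms
proof (induction ws rule: rev_induct)
  case Nil
  then show ?case by (simp add: graph_walk_def)
next
  case (snoc b ws)
  show ?case
  proof (cases "ws = []")
    case True
    then have "b \<in> verts \<Gamma>" using snoc by (simp add: graph_walk_def)
    then show ?thesis using True
      by (intro exI[of _ "\<lambda>_. vertex b"])
        (auto simp: quasi_geodesic_def is_interval_cc simp del: atLeastAtMost_singleton simp flip: atLeastAtMost_singleton)
  next
    case False
    let ?a = "last ws" and ?l = "walk_length \<Gamma> ws"
    have w: "graph_walk \<Gamma> ws" "{?a, b} \<in> edges \<Gamma>" using snoc False by (auto simp: graph_walk_append)
    have wl: "walk_length \<Gamma> (ws @ [b]) = ?l + elength \<Gamma> {?a, b}" using False by (simp add: walk_length_append)
    have v: "hd ws \<in> verts \<Gamma>" "?a \<in> verts \<Gamma>" "b \<in> verts \<Gamma>"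
      using w False edge_verts[OF w(2)] by (auto simp: graph_walk_def)
    \<comment> \<open>The prefix of a shortest walk is shortest: a shortcut to \<open>?a\<close>
      would shorten the whole walk.\<close>
    have "dv (hd ws) b = ?l + elength \<Gamma> {?a, b}" using snoc.prems(2) wl False by simp
    moreover have "dv (hd ws) b \<le> dv (hd ws) ?a + elength \<Gamma> {?a, b}"
      using M.triangle[of "vertex (hd ws)" "vertex ?a" "vertex b"] gdist_edge[OF w(2)] v by simp
    ultimately have "?l = dv (hd ws) ?a" using gdist_le_walk_length[OF w(1)] by simp
    from snoc.IH[OF w(1) this] obtain \<gamma> where g: "geodesic X {0..?l} \<gamma>" "\<gamma> 0 = vertex (hd ws)"
      "\<gamma> ?l = vertex ?a" and near: "\<forall>t\<in>{0..?l}. \<exists>a\<in>set ws. gdist \<Gamma> (\<gamma> t) (vertex a) \<le> 1"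
      and on: "\<forall>a\<in>set ws. \<exists>t\<in>{0..?l}. \<gamma> t = vertex a" by blast
    let ?m = "elength \<Gamma> {?a, b}"
    let ?g = "\<lambda>t. if t \<le> ?l then \<gamma> t else edge_point ?a b ((t - ?l) / ?m)"
    have l0: "0 \<le> ?l" by (rule walk_length_nonneg[OF w(1)])
    have m: "0 < ?m" using elength_bounds[OF w(2)] by auto
    have d: "gdist \<Gamma> (\<gamma> 0) (vertex b) = ?l + ?m" using \<open>dv (hd ws) b = _\<close> g(2) by simp
    note ext = geodesic_extend[OF g(1,3) l0 w(2) d]
    have "\<exists>a\<in>set (ws @ [b]). gdist \<Gamma> (?g t) (vertex a) \<le> 1" if "t \<in> {0..?l + ?m}" for t
    proof (cases "t \<le> ?l")
      case True then show ?thesis using near that by auto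
    next
      case False
      then have "t \<in> {?l..?l + ?m}" using that by auto
      from ext(3)[OF this] show ?thesis using \<open>ws \<noteq> []\<close>
        by (intro bexI[of _ ?a]) auto
    qed
    moreover have "\<exists>t\<in>{0..?l + ?m}. ?g t = vertex a" if "a \<in> set (ws @ [b])" for a
    proof (cases "a = b")
      case True
      then show ?thesis using ext(2) l0 m by (intro bexI[of _ "?l + ?m"]) auto
    next
      case False
      then have "a \<in> set ws" using that by simp
      then obtain t where "t \<in> {0..?l}" "\<gamma> t = vertex a" using on by blast
      then show ?thesis using m by (intro bexI[of _ t]) auto
    qed
    ultimately show ?thesis using ext(1,2) g(2) l0 False wl by (intro exI[of _ ?g]) auto
  qed
qed

lemma vertex_geodesic:
  assumes "u \<in> verts \<Gamma>" "w \<in> verts \<Gamma>"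
  shows "\<exists>\<gamma>. geodesic X {0..dv u w} \<gamma> \<and> \<gamma> 0 = vertex u \<and> \<gamma> (dv u w) = vertex w"
proof -
  obtain ws where ws: "graph_walk \<Gamma> ws" "hd ws = u" "last ws = w" "walk_length \<Gamma> ws = dv u w"
    using gdist_walk[OF assms] by blast
  then show ?thesis using walk_geodesic[of ws] by auto
qed

text \<open>The vertex \<open>a\<close> lies on the geodesic traced by \<open>A\<close>, while a
  point of one of the other two geodesics is within 1 of a vertex of its walk. This adds 1 to
  \<open>\<delta>\<close>.\<close>

lemma slim_walks:
  assumes hyp: "hyperbolic X \<delta>"
    and ws: "graph_walk \<Gamma> A" "walk_length \<Gamma> A = dv (hd A) (last A)"
      "graph_walk \<Gamma> B" "walk_length \<Gamma> B = dv (hd B) (last B)"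
      "graph_walk \<Gamma> C" "walk_length \<Gamma> C = dv (hd C) (last C)"
    and ends: "last A = hd B" "last B = hd C" "last C = hd A" and a: "a \<in> set A"
  shows "\<exists>b\<in>set B \<union> set C. dv a b \<le> \<delta> + 1"
proof -
  let ?S = "\<lambda>W \<gamma>. \<gamma> ` {0..walk_length \<Gamma> W}"
  have seg: "\<exists>\<gamma>. geodesic_segment X (vertex (hd W)) (vertex (last W)) (?S W \<gamma>) \<and>
    (\<forall>x\<in>?S W \<gamma>. \<exists>a\<in>set W. gdist \<Gamma> x (vertex a) \<le> 1) \<and> (\<forall>a\<in>set W. vertex a \<in> ?S W \<gamma>) \<and> ?S W \<gamma> \<subseteq> points \<Gamma>"
    if W: "graph_walk \<Gamma> W" "walk_length \<Gamma> W = dv (hd W) (last W)" for W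
  proof -
    obtain \<gamma> where g: "geodesic X {0..walk_length \<Gamma> W} \<gamma>" "\<gamma> 0 = vertex (hd W)" "\<gamma> (walk_length \<Gamma> W) = vertex (last W)"
      "\<forall>t\<in>{0..walk_length \<Gamma> W}. \<exists>a\<in>set W. gdist \<Gamma> (\<gamma> t) (vertex a) \<le> 1"
      "\<forall>a\<in>set W. \<exists>t\<in>{0..walk_length \<Gamma> W}. \<gamma> t = vertex a"
      using walk_geodesic[OF W] by blast
    have "geodesic_segment X (vertex (hd W)) (vertex (last W)) (?S W \<gamma>)"
      unfolding geodesic_segment_def using g(1-3) walk_length_nonneg[OF W(1)] by blast
    moreover have "?S W \<gamma> \<subseteq> points \<Gamma>" using g(1) by (simp add: quasi_geodesic_def)
    ultimately show ?thesis using g(4,5) by (intro exI[of _ \<gamma>]) force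
  qed
  obtain \<alpha> where \<alpha>: "geodesic_segment X (vertex (hd A)) (vertex (last A)) (?S A \<alpha>)" "\<forall>a\<in>set A. vertex a \<in> ?S A \<alpha>"
    using seg[OF ws(1,2)] by blast
  obtain \<beta> where \<beta>: "geodesic_segment X (vertex (hd B)) (vertex (last B)) (?S B \<beta>)"
    "\<forall>x\<in>?S B \<beta>. \<exists>a\<in>set B. gdist \<Gamma> x (vertex a) \<le> 1" "?S B \<beta> \<subseteq> points \<Gamma>"
    using seg[OF ws(3,4)] by blast
  obtain \<gamma> where \<gamma>: "geodesic_segment X (vertex (hd C)) (vertex (last C)) (?S C \<gamma>)"
    "\<forall>x\<in>?S C \<gamma>. \<exists>a\<in>set C. gdist \<Gamma> x (vertex a) \<le> 1" "?S C \<gamma> \<subseteq> points \<Gamma>"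
    using seg[OF ws(5,6)] by blast
  have "\<exists>b\<in>?S B \<beta> \<union> ?S C \<gamma>. gdist \<Gamma> (vertex a) b \<le> \<delta>"
    using hyp \<alpha> \<beta>(1) \<gamma>(1) ends a unfolding hyperbolic_def mdist_X by metis
  then obtain x where x: "x \<in> ?S B \<beta> \<union> ?S C \<gamma>" "gdist \<Gamma> (vertex a) x \<le> \<delta>" by blast
  then obtain b where b: "b \<in> set B \<union> set C" "gdist \<Gamma> x (vertex b) \<le> 1" using \<beta>(2) \<gamma>(2) by blast
  have "a \<in> verts \<Gamma>" "b \<in> verts \<Gamma>" "x \<in> points \<Gamma>"
    using a b x(1) ws \<beta>(3) \<gamma>(3) by (auto simp: graph_walk_def)
  then show ?thesis using M.triangle[of "vertex a" x "vertex b"] x b by (intro bexI[of _ b]) auto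
qed

section \<open>Embedded walks, circuits and fineness\<close>

lemma graph_walk_distinct:
  assumes "graph_walk \<Gamma> ws"
  shows "\<exists>zs. graph_walk \<Gamma> zs \<and> distinct zs \<and> hd zs = hd ws \<and> last zs = last ws \<and>
    set zs \<subseteq> set ws \<and> walk_length \<Gamma> zs \<le> walk_length \<Gamma> ws"
  using assms
proof (induction "length ws" arbitrary: ws rule: less_induct)
  case less
  show ?case
  proof (cases "distinct ws")
    case False
    then obtain as bs cs x where ws: "ws = as @ [x] @ bs @ [x] @ cs" using not_distinct_decomp by blast
    let ?vs = "as @ x # cs"
    have j: "graph_walk \<Gamma> (as @ x # bs @ x # cs)" using less ws by simp
    have w: "graph_walk \<Gamma> (as @ [x])" "graph_walk \<Gamma> (x # bs @ [x])" "graph_walk \<Gamma> (x # cs)"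
      using j graph_walk_join[of \<Gamma> as x "bs @ x # cs"] graph_walk_join[of \<Gamma> "x # bs" x cs]
      unfolding append_Cons by blast+
    have wv: "graph_walk \<Gamma> ?vs" using w graph_walk_join[of \<Gamma> as x cs] by blast
    have "walk_length \<Gamma> ws = walk_length \<Gamma> (as @ [x]) + walk_length \<Gamma> (x # bs @ [x]) + walk_length \<Gamma> (x # cs)"
      using walk_length_join[of \<Gamma> as x "bs @ x # cs"] walk_length_join[of \<Gamma> "x # bs" x cs] ws by simp
    then have l: "walk_length \<Gamma> ?vs \<le> walk_length \<Gamma> ws"
      using walk_length_join[of \<Gamma> as x cs] walk_length_nonneg[OF w(2)] by simp
    have "length ?vs < length ws" using ws by simp
    from less.hyps[OF this wv] obtain zs where zs: "graph_walk \<Gamma> zs" "distinct zs" "hd zs = hd ?vs" "last zs = last ?vs"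
      "set zs \<subseteq> set ?vs" "walk_length \<Gamma> zs \<le> walk_length \<Gamma> ?vs" by blast
    have "hd ?vs = hd ws" "last ?vs = last ws" "set ?vs \<subseteq> set ws" using ws by (cases as; auto)+
    then show ?thesis using zs l by (intro exI[of _ zs]) auto
  qed (use less in blast)
qed

lemma geodesic_walk_suffix:
  assumes "graph_walk \<Gamma> (as @ a # bs)" "walk_length \<Gamma> (as @ a # bs) = dv (hd (as @ a # bs)) (last (a # bs))"
  shows "walk_length \<Gamma> (a # bs) = dv a (last (a # bs))"
proof -
  have w: "graph_walk \<Gamma> (as @ [a])" "graph_walk \<Gamma> (a # bs)" using assms(1) graph_walk_join[of \<Gamma> as a bs] by blast+
  have h: "hd (as @ a # bs) = hd (as @ [a])" by (cases as) auto
  have v: "hd (as @ [a]) \<in> verts \<Gamma>" "a \<in> verts \<Gamma>" "last (a # bs) \<in> verts \<Gamma>"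
    using w last_in_set[of "a # bs"] hd_in_set[of "as @ [a]"] by (auto simp: graph_walk_def)
  have "dv (hd (as @ [a])) (last (a # bs)) \<le> dv (hd (as @ [a])) a + dv a (last (a # bs))"
    using M.triangle v by simp
  moreover have "dv (hd (as @ [a])) a \<le> walk_length \<Gamma> (as @ [a])" using gdist_le_walk_length[OF w(1)] by simp
  ultimately show ?thesis
    using gdist_le_walk_length[OF w(2)] assms(2) walk_length_join[of \<Gamma> as a bs] h by simp
qed

definition circuit_list :: "'v list \<Rightarrow> bool" where
  "circuit_list vs \<longleftrightarrow> 3 \<le> length vs \<and> distinct vs \<and> graph_walk \<Gamma> vs \<and> {last vs, hd vs} \<in> edges \<Gamma>"

text \<open>Fineness concerns circuits of one exact length. Half-integral lengths leave finitely
  many values up to a bound, hence finitely many circuits through the edge, each with finitely many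
  vertices. The length of the list \<open>vs\<close> omits the closing edge, which is at most 1
  long; therefore the bound in the proof is \<open>n + 1\<close>.\<close>

lemma finite_circuit_vertices:
  assumes fine: "fine_graph \<Gamma>" and e: "{v, u} \<in> edges \<Gamma>"
  shows "finite {w. \<exists>vs. circuit_list vs \<and> hd vs = v \<and> hd (tl vs) = u \<and> walk_length \<Gamma> vs \<le> n \<and> w \<in> set vs}"
proof -
  let ?len = "\<lambda>C. \<Sum>c\<in>C. elength \<Gamma> c"
  define \<C> where "\<C> = {C \<in> circuits \<Gamma>. {v, u} \<in> C \<and> ?len C \<le> n + 1}"
  have fin: "finite C" if "C \<in> circuits \<Gamma>" for C
  proof -
    from that obtain vs where "C = {{vs ! i, vs ! (Suc i mod length vs)} |i. i < length vs}"
      unfolding circuits_def by blast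
    then have "C = (\<lambda>i. {vs ! i, vs ! (Suc i mod length vs)}) ` {..<length vs}" by auto
    then show ?thesis by simp
  qed
  have len_half: "\<exists>k::nat. ?len C = k / 2" if "finite C" "C \<subseteq> edges \<Gamma>" for C
    using that
  proof (induction C rule: finite_induct)
    case (insert c C)
    then obtain k :: nat where "?len C = k / 2" by auto
    then show ?case using insert half[of c]
      by (auto intro: exI[of _ "k + 1"] exI[of _ "k + 2"] simp: field_simps)
  qed (auto intro: exI[of _ 0])
  have "\<C> \<subseteq> (\<Union>k\<in>{1..nat \<lceil>2 * (n + 1)\<rceil>}. {C \<in> circuits \<Gamma>. {v, u} \<in> C \<and> ?len C = real k / 2})"
  proof
    fix C assume C: "C \<in> \<C>"
    then have sub: "C \<subseteq> edges \<Gamma>" "finite C" using fin by (auto simp: \<C>_def circuits_def)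
    then obtain k :: nat where k: "?len C = k / 2" using len_half by blast
    have "elength \<Gamma> {v, u} \<le> ?len C"
      using C sub elength_nonneg by (intro member_le_sum) (auto simp: \<C>_def)
    then have "k \<noteq> 0" using k elength_bounds[OF e] by (auto intro: ccontr)
    moreover have "real k \<le> 2 * (n + 1)" using C k by (auto simp: \<C>_def)
    then have "k \<le> nat \<lceil>2 * (n + 1)\<rceil>" by linarith
    ultimately show "C \<in> (\<Union>k\<in>{1..nat \<lceil>2 * (n + 1)\<rceil>}. {C \<in> circuits \<Gamma>. {v, u} \<in> C \<and> ?len C = real k / 2})"
      using C k by (auto simp: \<C>_def)
  qed
  moreover have "finite {C \<in> circuits \<Gamma>. {v, u} \<in> C \<and> ?len C = real k / 2}" if "k \<in> {1..nat \<lceil>2 * (n + 1)\<rceil>}" for k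
    using fine[unfolded fine_graph_def, rule_format, of "real k / 2" "{v, u}"] e that by simp
  ultimately have finC: "finite \<C>" by (meson finite_UN_I finite_atLeastAtMost finite_subset)
  have finE: "finite c" if "c \<in> edges \<Gamma>" for c using edge_card[OF that] card.infinite by force
  have finU: "finite (\<Union>(\<Union>\<C>))"
  proof (rule finite_Union)
    show "finite (\<Union>\<C>)" using finC fin by (auto simp: \<C>_def)
    show "finite c" if "c \<in> \<Union>\<C>" for c using that finE by (auto simp: \<C>_def circuits_def)
  qed
  have "w \<in> \<Union>(\<Union>\<C>)" if vs: "circuit_list vs" "hd vs = v" "hd (tl vs) = u" "walk_length \<Gamma> vs \<le> n" "w \<in> set vs" for vs w
  proof -
    let ?n = "length vs"
    let ?E = "\<lambda>i. {vs ! i, vs ! (Suc i mod ?n)}"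
    have l: "3 \<le> ?n" "distinct vs" "graph_walk \<Gamma> vs" "{last vs, hd vs} \<in> edges \<Gamma>"
      using vs(1) by (auto simp: circuit_list_def)
    have E1: "?E i = {vs ! i, vs ! Suc i}" if "Suc i < ?n" for i using that by simp
    have E2: "?E (?n - 1) = {last vs, hd vs}"
    proof -
      have "Suc (?n - 1) = ?n" "vs \<noteq> []" using l(1) by auto
      then show ?thesis by (simp add: last_conv_nth hd_conv_nth)
    qed
    have Eedge: "?E i \<in> edges \<Gamma>" if "i < ?n" for i
    proof (cases "Suc i < ?n")
      case True
      have "successively (\<lambda>u v. {u, v} \<in> edges \<Gamma>) vs" using l(3) by (simp add: graph_walk_def)
      from successively_nth[OF this True] show ?thesis using E1[OF True] by argo
    next
      case False
      then have "i = ?n - 1" using that by simp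
      then show ?thesis using E2 l(4) by simp
    qed
    define C where "C = {?E i |i. i < ?n}"
    have C: "C \<in> circuits \<Gamma>" unfolding circuits_def C_def using l Eedge by blast
    have img: "C = ?E ` {..<?n}" by (auto simp: C_def)
    have wl: "walk_length \<Gamma> zs = (\<Sum>i<length zs - 1. elength \<Gamma> {zs ! i, zs ! Suc i})" for zs
    proof (induction \<Gamma>\<equiv>\<Gamma> zs rule: walk_length.induct)
      case (3 x y ws)
      then show ?case by (simp add: sum.lessThan_Suc_shift del: sum.lessThan_Suc)
    qed auto
    \<comment> \<open>An upper bound is enough, so the edges \<open>?E i\<close> need not be shown
      to be pairwise distinct.\<close>
    have "?len C \<le> (\<Sum>i<?n. elength \<Gamma> (?E i))"
      unfolding img by (rule sum_image_le[of _ "elength \<Gamma>" ?E, unfolded comp_def])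
        (use Eedge elength_nonneg in auto)
    also have "\<dots> = (\<Sum>i<?n - 1. elength \<Gamma> (?E i)) + elength \<Gamma> (?E (?n - 1))"
    proof -
      have "{..<?n} = insert (?n - 1) {..<?n - 1}" using l(1) by auto
      then show ?thesis by simp
    qed
    also have "(\<Sum>i<?n - 1. elength \<Gamma> (?E i)) = walk_length \<Gamma> vs"
      unfolding wl by (intro sum.cong) auto
    also have "walk_length \<Gamma> vs + elength \<Gamma> (?E (?n - 1)) \<le> n + 1"
      using vs(4) elength_bounds[OF Eedge[of "?n - 1"]] l(1) by (intro add_mono) auto
    finally have "?len C \<le> n + 1" .
    moreover have "{v, u} \<in> C"
    proof -
      obtain xs where "vs = v # u # xs" using vs(2,3) l(1) by (cases vs; cases "tl vs") auto
      then have "?E 0 = {v, u}" by simp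
      moreover have "0 < ?n" using l(1) by linarith
      ultimately show ?thesis unfolding C_def by blast
    qed
    ultimately have "C \<in> \<C>" using C by (simp add: \<C>_def)
    moreover obtain i where "i < ?n" "vs ! i = w" using vs(5) by (auto simp: in_set_conv_nth)
    then have "w \<in> ?E i" "?E i \<in> C" unfolding C_def by blast+
    ultimately show ?thesis by (intro UnionI[of "?E i"] UnionI[of C])
  qed
  then have "{w. \<exists>vs. circuit_list vs \<and> hd vs = v \<and> hd (tl vs) = u \<and> walk_length \<Gamma> vs \<le> n \<and> w \<in> set vs}
      \<subseteq> \<Union>(\<Union>\<C>)" by (intro subsetI) (simp only: mem_Collect_eq, elim exE conjE)
  then show ?thesis using finU by (rule finite_subset)
qed

text \<open>Local finiteness puts a bounded sequence into finitely many vertices and closed edges.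
  One of them contains a subsequence, and on an edge the compactness of the unit interval gives a
  limit of one coordinate, which determines the point.\<close>

lemma bounded_seq_convergent:
  assumes locfin: "\<And>u r. u \<in> verts \<Gamma> \<Longrightarrow> finite {w \<in> verts \<Gamma>. dv u w \<le> r}"
    and p: "p \<in> verts \<Gamma>" and x: "\<And>n. x n \<in> points \<Gamma>" "\<And>n. gdist \<Gamma> (vertex p) (x n) \<le> r"
  shows "\<exists>s y. strict_mono (s :: nat \<Rightarrow> nat) \<and> y \<in> points \<Gamma> \<and> (\<lambda>n. gdist \<Gamma> (x (s n)) y) \<longlonglongrightarrow> 0"
proof -
  define W where "W = {w \<in> verts \<Gamma>. dv p w \<le> r + 2}"
  have finW: "finite W" using locfin p by (simp add: W_def)
  have "\<exists>u\<in>W. \<exists>w\<in>W. x n = vertex u \<or> {u, w} \<in> edges \<Gamma> \<and> x n \<in> cell {u, w}" for n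
  proof -
    have W: "w \<in> W" if "w \<in> verts \<Gamma>" "gdist \<Gamma> (x n) (vertex w) \<le> 1" for w
      using M.triangle[of "vertex p" "x n" "vertex w"] x[of n] p that by (simp add: W_def)
    show ?thesis
    proof (cases "x n \<in> vertex ` verts \<Gamma>")
      case True
      then obtain u where u: "u \<in> verts \<Gamma>" "x n = vertex u" by blast
      then have "u \<in> W" using x(2)[of n] by (simp add: W_def)
      then show ?thesis using u by blast
    next
      case False
      then obtain f where f: "f \<in> edges \<Gamma>" "x n \<in> cell f" using x(1)[of n] unfolding points_def by blast
      then obtain u w where uw: "f = {u, w}" using edge_card by (meson card_2_iff)
      have *: "0 \<le> x n v" "x n v \<le> 1" if "v \<in> f" for v
        using f(2) that sum_nonneg_leq_bound[of f "x n" 1 v] uw by (auto simp: cell_def)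
      have "gdist \<Gamma> (x n) (vertex v) \<le> 1" if "v \<in> f" for v
      proof -
        have "vertex v \<in> cell f" using that uw by (auto simp: vertex_in_cell)
        then have "gdist \<Gamma> (x n) (vertex v) \<le> elength \<Gamma> f * \<bar>x n v - vertex v v\<bar>"
          by (rule gdist_same_cell[OF f(1,2) _ that])
        also have "\<dots> \<le> 1 * 1" using elength_bounds[OF f(1)] *[OF that] by (intro mult_mono) (auto simp: vertex_apply)
        finally show ?thesis by simp
      qed
      then show ?thesis using W edge_verts[OF f(1)] uw f by blast
    qed
  qed
  then obtain u w where uw: "\<And>n. u n \<in> W" "\<And>n. w n \<in> W"
    "\<And>n. x n = vertex (u n) \<or> {u n, w n} \<in> edges \<Gamma> \<and> x n \<in> cell {u n, w n}" by metis
  \<comment> \<open>The third entry keeps the two alternatives apart: when \<open>x n\<close> is a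
    vertex, \<open>{u n, w n}\<close> need not be an edge.\<close>
  let ?h = "\<lambda>n. (u n, w n, x n = vertex (u n))"
  have "range ?h \<subseteq> W \<times> W \<times> UNIV" using uw by auto
  then have "finite (range ?h)" by (rule finite_subset) (use finW in \<open>intro finite_cartesian_product, auto\<close>)
  then obtain z where z: "infinite {n. ?h n = z}"
    using pigeonhole_infinite[of "UNIV :: nat set" ?h] by auto
  then obtain a b c where z': "z = (a, b, c)" by (metis prod_cases3)
  obtain s0 :: "nat \<Rightarrow> nat" where s0: "strict_mono s0" "\<And>n. ?h (s0 n) = z"
    using infinite_enumerate[OF z] by blast
  have ab: "u (s0 n) = a" "w (s0 n) = b" "x (s0 n) = vertex a \<longleftrightarrow> c" for n using s0(2)[of n] z' by auto
  show ?thesis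
  proof (cases c)
    case True
    then have "x (s0 n) = vertex a" for n using ab by blast
    moreover have "a \<in> verts \<Gamma>" using uw(1)[of "s0 0"] ab by (simp add: W_def)
    ultimately show ?thesis using s0(1) by (intro exI[of _ s0] exI[of _ "vertex a"]) auto
  next
    case False
    then have ce: "{a, b} \<in> edges \<Gamma>" "x (s0 n) \<in> cell {a, b}" for n using ab uw(3)[of "s0 n"] by auto
    have neq: "a \<noteq> b" using edge_neq[OF ce(1)] .
    have r: "x (s0 n) b \<in> {0..1}" for n
    proof -
      have "x (s0 n) a + x (s0 n) b = 1" "0 \<le> x (s0 n) a" "0 \<le> x (s0 n) b"
        using ce(2)[of n] neq by (auto simp: cell_def)
      then show ?thesis by auto
    qed
    obtain t s1 where t: "t \<in> {0..1}" "strict_mono (s1 :: nat \<Rightarrow> nat)" "((\<lambda>n. x (s0 n) b) \<circ> s1) \<longlonglongrightarrow> t"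
      using seq_compactE[OF compact_imp_seq_compact[OF compact_Icc[of "0::real" 1]], of "\<lambda>n. x (s0 n) b"] r
      by blast
    have y: "edge_point a b t \<in> cell {a, b}" using edge_point_cell[OF neq] t(1) by simp
    have le: "gdist \<Gamma> (x (s0 (s1 n))) (edge_point a b t) \<le> \<bar>x (s0 (s1 n)) b - t\<bar>" for n
    proof -
      have "gdist \<Gamma> (x (s0 (s1 n))) (edge_point a b t) \<le> elength \<Gamma> {a, b} * \<bar>x (s0 (s1 n)) b - edge_point a b t b\<bar>"
        by (rule gdist_same_cell[OF ce(1) ce(2) y]) simp
      also have "\<dots> \<le> 1 * \<bar>x (s0 (s1 n)) b - t\<bar>"
        using elength_bounds[OF ce(1)] neq by (intro mult_mono) (auto simp: edge_point_def)
      finally show ?thesis by simp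
    qed
    have t0: "(\<lambda>n. \<bar>x (s0 (s1 n)) b - t\<bar>) \<longlonglongrightarrow> 0"
      using tendsto_rabs_zero[OF LIM_zero[OF t(3)]] unfolding comp_def .
    have "(\<lambda>n. gdist \<Gamma> (x (s0 (s1 n))) (edge_point a b t)) \<longlonglongrightarrow> 0"
      by (rule tendsto_sandwich[OF _ _ tendsto_const t0]) (intro always_eventually allI M.nonneg le)+
    moreover have "strict_mono (s0 \<circ> s1)" by (rule strict_mono_o[OF s0(1) t(2)])
    ultimately show ?thesis using cell_points[OF ce(1) y]
      by (intro exI[of _ "s0 \<circ> s1"] exI[of _ "edge_point a b t"]) simp
  qed
qed

end

section \<open>Projection to a peripheral subgroup\<close>

lemma half_graph_cayley_graph:
  assumes "group G" "finite_generating_set G S"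
  shows "half_graph (cayley_graph G S)"
proof
  have S: "S \<subseteq> carrier G" using assms(2) by (simp add: finite_generating_set_def)
  show "wf_mgraph (cayley_graph G S)" by (rule wf_cayley_graph[OF assms(1) S])
  fix u v assume "u \<in> verts (cayley_graph G S)" "v \<in> verts (cayley_graph G S)"
  then show "\<exists>r. polygonal (cayley_graph G S) (vertex u) (vertex v) r"
    using generate_connected[OF assms, of u v "\<lambda>g. g" "cayley_graph G S"]
    by (auto simp: cayley_graph_def)
qed (simp add: cayley_graph_def)

lemma coned_off_cayley_edge:
  "{g, h} \<in> edges (cayley_graph G S) \<Longrightarrow> {Inl g, Inl h} \<in> edges (coned_off_graph G S \<P>)"
proof -
  assume "{g, h} \<in> edges (cayley_graph G S)"
  then have "Inl ` {g, h} \<in> edges (coned_off_graph G S \<P>)"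
    unfolding coned_off_graph_def mgraph.simps by blast
  then show ?thesis by simp
qed

lemma half_graph_coned_off_graph:
  assumes "group G" "finite_generating_set G S" "\<forall>P\<in>\<P>. subgroup P G"
  shows "half_graph (coned_off_graph G S \<P>)"
proof -
  interpret group G by fact
  let ?C = "coned_off_graph G S \<P>"
  have S: "S \<subseteq> carrier G" using assms(2) by (simp add: finite_generating_set_def)
  have base: "\<exists>r. polygonal ?C (vertex (Inl u)) (vertex (Inl v)) r"
    if "u \<in> carrier G" "v \<in> carrier G" for u v
  proof (rule generate_connected[OF assms(1,2) that])
    fix g s assume "g \<in> carrier G" "s \<in> S" "s \<noteq> \<one>\<^bsub>G\<^esub>"
    then have "{g, g \<otimes>\<^bsub>G\<^esub> s} \<in> edges (cayley_graph G S)" by (auto simp: cayley_graph_def)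
    then show "{Inl g, Inl (g \<otimes>\<^bsub>G\<^esub> s)} \<in> edges ?C" by (rule coned_off_cayley_edge)
  qed (simp add: coned_off_graph_def)
  have near: "\<exists>g\<in>carrier G. \<exists>r. polygonal ?C (vertex (Inl g)) (vertex v) r" if v: "v \<in> verts ?C" for v
  proof -
    consider g where "g \<in> carrier G" "v = Inl g"
      | g P where "g \<in> carrier G" "P \<in> \<P>" "v = Inr (g <#\<^bsub>G\<^esub> P)"
      using v by (auto simp: coned_off_graph_def)
    then show ?thesis
    proof cases
      case 2
      then have "\<one>\<^bsub>G\<^esub> \<in> P" using assms(3) subgroup.one_closed by blast
      then have "g \<in> g <#\<^bsub>G\<^esub> P"
        unfolding l_coset_def using 2(1) by (intro UN_I[of "\<one>\<^bsub>G\<^esub>"]) auto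
      then have "{Inl g, v} \<in> edges ?C" unfolding coned_off_graph_def mgraph.simps 2(3) using 2 by blast
      from polygonal_edge[OF this] 2(1) show ?thesis by (intro bexI[of _ g])
    qed (use base in blast)
  qed
  show ?thesis
  proof
    show "wf_mgraph ?C" by (rule wf_coned_off_graph[OF assms(1) S assms(3)])
    show "elength ?C e = 1 / 2 \<or> elength ?C e = 1" for e by (simp add: coned_off_graph_def)
    fix u v assume "u \<in> verts ?C" "v \<in> verts ?C"
    then obtain g h r s where "g \<in> carrier G" "polygonal ?C (vertex (Inl g)) (vertex u) r"
      "h \<in> carrier G" "polygonal ?C (vertex (Inl h)) (vertex v) s"
      using near by meson
    then show "\<exists>r. polygonal ?C (vertex u) (vertex v) r"
      using base polygonal_sym polygonal_trans by meson
  qed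
qed

section \<open>The cone vertex of \<open>P\<close> and the translations of the coned-off
  graph\<close>

locale peripheral_subgroup = group G for G (structure) +
  fixes S :: "'a set" and \<P> :: "'a set set" and P :: "'a set" and \<delta> :: real
  assumes S: "finite_generating_set G S"
    and subgroups: "\<And>Q. Q \<in> \<P> \<Longrightarrow> subgroup Q G"
    and P: "P \<in> \<P>"
    and hyp: "hyperbolic (realization (coned_off_graph G S \<P>)) \<delta>"
    and fine: "fine_graph (coned_off_graph G S \<P>)"
begin

abbreviation C where "C \<equiv> coned_off_graph G S \<P>"
abbreviation v where "v \<equiv> Inr P :: 'a + 'a set"
abbreviation D where "D \<equiv> max 1 (\<delta> + 1)"

sublocale K: half_graph C
  by (rule half_graph_coned_off_graph[OF is_group S]) (use subgroups in blast)

sublocale H: half_graph "cayley_graph G S"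
  by (rule half_graph_cayley_graph[OF is_group S])

lemma PG: "subgroup P G" using subgroups P by blast

lemma P_carrier: "p \<in> P \<Longrightarrow> p \<in> carrier G" using subgroup.subset[OF PG] by blast

lemma one_coset: "\<one> <# P = P" using subgroup.subset[OF PG] by (rule lcos_mult_one)

lemma Inl_vert: "x \<in> carrier G \<Longrightarrow> Inl x \<in> verts C"
  by (simp add: coned_off_graph_def)

lemma v_vert: "v \<in> verts C"
proof -
  have "v = Inr (\<one> <# P)" by (simp add: one_coset)
  then show ?thesis unfolding coned_off_graph_def mgraph.simps using P by blast
qed

lemma cone_edge: "p \<in> P \<Longrightarrow> {Inl p, v} \<in> edges C"
proof -
  assume "p \<in> P"
  then have "p \<in> \<one> <# P" by (simp add: one_coset)
  then have "{Inl p, Inr (\<one> <# P)} \<in> edges C"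
    unfolding coned_off_graph_def mgraph.simps using P by blast
  then show ?thesis by (simp add: one_coset)
qed

lemma cone_edge_length: "elength C {Inl p, v} = 1/2" "elength C {v, Inl p} = 1/2"
  by (auto simp: coned_off_graph_def)

lemma cone_neighbour: "{w, v} \<in> edges C \<Longrightarrow> \<exists>p\<in>P. w = Inl p"
  by (auto simp: coned_off_graph_def doubleton_eq_iff)

text \<open>The left action of the group on the coned-off graph. Elements of \<open>P\<close> fix
  the cone vertex of \<open>P\<close>, and this makes circuits through it comparable.\<close>

definition shift :: "'a \<Rightarrow> 'a + 'a set \<Rightarrow> 'a + 'a set" where
  "shift h = map_sum (\<lambda>x. h \<otimes> x) (\<lambda>A. h <# A)"

lemma shift_simps [simp]: "shift h (Inl x) = Inl (h \<otimes> x)" "shift h (Inr A) = Inr (h <# A)"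
  by (simp_all add: shift_def)

lemma shift_coset: "Q \<in> \<P> \<Longrightarrow> g \<in> carrier G \<Longrightarrow> h \<in> carrier G \<Longrightarrow> h <# (g <# Q) = (h \<otimes> g) <# Q"
  using subgroup.subset[OF subgroups] by (intro lcos_m_assoc)

lemma shift_vert: "h \<in> carrier G \<Longrightarrow> w \<in> verts C \<Longrightarrow> shift h w \<in> verts C"
proof -
  assume h: "h \<in> carrier G" and w: "w \<in> verts C"
  consider x where "x \<in> carrier G" "w = Inl x" | g Q where "g \<in> carrier G" "Q \<in> \<P>" "w = Inr (g <# Q)"
    using w by (auto simp: coned_off_graph_def)
  then show ?thesis
  proof cases
    case 1 then show ?thesis using h by (auto intro!: Inl_vert)
  next
    case 2
    then have "shift h w = Inr ((h \<otimes> g) <# Q)" using shift_coset[OF 2(2,1) h] by simp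
    then show ?thesis using 2 m_closed[OF h 2(1)] unfolding coned_off_graph_def mgraph.simps by blast
  qed
qed

lemma shift_inverse: "h \<in> carrier G \<Longrightarrow> w \<in> verts C \<Longrightarrow> shift (inv h) (shift h w) = w"
proof -
  assume h: "h \<in> carrier G" and w: "w \<in> verts C"
  consider x where "x \<in> carrier G" "w = Inl x" | g Q where "g \<in> carrier G" "Q \<in> \<P>" "w = Inr (g <# Q)"
    using w by (auto simp: coned_off_graph_def)
  then show ?thesis
  proof cases
    case 1 then show ?thesis using h by (simp flip: m_assoc)
  next
    case 2 then show ?thesis using h shift_coset[of Q g h] shift_coset[of Q "h \<otimes> g" "inv h"]
      by (simp flip: m_assoc)
  qed
qed

lemma shift_edge: "h \<in> carrier G \<Longrightarrow> e \<in> edges C \<Longrightarrow> shift h ` e \<in> edges C"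
proof -
  assume h: "h \<in> carrier G" and e: "e \<in> edges C"
  have SG: "S \<subseteq> carrier G" using S by (simp add: finite_generating_set_def)
  consider g s where "g \<in> carrier G" "s \<in> S" "s \<noteq> \<one>" "e = {Inl g, Inl (g \<otimes> s)}"
    | x g Q where "g \<in> carrier G" "Q \<in> \<P>" "x \<in> g <# Q" "e = {Inl x, Inr (g <# Q)}"
    using e by (auto simp: coned_off_graph_def cayley_graph_def)
  then show ?thesis
  proof cases
    case 1
    then have "{h \<otimes> g, (h \<otimes> g) \<otimes> s} \<in> edges (cayley_graph G S)"
      unfolding cayley_graph_def mgraph.simps using h by blast
    moreover have "shift h ` e = {Inl (h \<otimes> g), Inl ((h \<otimes> g) \<otimes> s)}"
      using 1 h SG by (simp add: m_assoc subset_iff)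
    ultimately show ?thesis using coned_off_cayley_edge by metis
  next
    case 2
    have "h \<otimes> x \<in> h <# (g <# Q)" using 2(3) unfolding l_coset_def by blast
    then have "h \<otimes> x \<in> (h \<otimes> g) <# Q" using shift_coset[OF 2(2,1) h] by simp
    then have "{Inl (h \<otimes> x), Inr ((h \<otimes> g) <# Q)} \<in> edges C"
      unfolding coned_off_graph_def mgraph.simps using 2 h by blast
    then show ?thesis using 2 shift_coset[OF 2(2,1) h] by simp
  qed
qed

lemma shift_elength: "elength C (shift h ` e) = elength C e"
proof -
  have "shift h w \<in> range Inl \<longleftrightarrow> w \<in> range Inl" for w by (cases w) auto
  then have "shift h ` e \<subseteq> range Inl \<longleftrightarrow> e \<subseteq> range Inl" by (auto simp: image_subset_iff)
  then show ?thesis by (simp add: coned_off_graph_def)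
qed

lemma shift_walk:
  assumes "h \<in> carrier G" "graph_walk C ws"
  shows "graph_walk C (map (shift h) ws)" "walk_length C (map (shift h) ws) = walk_length C ws"
proof -
  have "successively (\<lambda>x y. {shift h x, shift h y} \<in> edges C) ws"
    using assms(2) shift_edge[OF assms(1), of "{_, _}"]
    by (auto simp: graph_walk_def elim!: successively_mono)
  then show "graph_walk C (map (shift h) ws)"
    using assms shift_vert by (auto simp: graph_walk_def successively_map)
  show "walk_length C (map (shift h) ws) = walk_length C ws"
    by (induction C\<equiv>C ws rule: walk_length.induct) (use shift_elength[of h "{_, _}"] in auto)
qed

text \<open>Fineness speaks about one edge at a time, whereas infinitely many edges may end at the
  cone vertex. Translation by \<open>inv p\<close> fixes \<open>v\<close> and moves its edge to
  \<open>p\<close> onto its edge to \<open>\<one>\<close>, so a single edge represents them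
  all.\<close>

lemma finite_circuits_at_cone:
  "\<exists>Q. finite Q \<and> Q \<subseteq> carrier G \<and> (\<forall>vs p x. K.circuit_list (v # vs) \<and> hd vs = Inl p \<and> p \<in> P \<and>
     walk_length C (v # vs) \<le> n \<and> Inl x \<in> set vs \<longrightarrow> inv p \<otimes> x \<in> Q)"
proof -
  define W where "W = {w. \<exists>vs. K.circuit_list vs \<and> hd vs = v \<and> hd (tl vs) = Inl \<one> \<and> walk_length C vs \<le> n \<and> w \<in> set vs}"
  have "{v, Inl \<one>} \<in> edges C"
    using cone_edge[OF subgroup.one_closed[OF PG]] by (simp add: insert_commute)
  then have finW: "finite W" unfolding W_def by (rule K.finite_circuit_vertices[OF fine])
  have "inv p \<otimes> x \<in> Inl -` W \<and> inv p \<otimes> x \<in> carrier G"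
    if vs: "K.circuit_list (v # vs)" "hd vs = Inl p" "p \<in> P" "walk_length C (v # vs) \<le> n" "Inl x \<in> set vs" for vs p x
  proof -
    have p: "p \<in> carrier G" "inv p \<in> carrier G" "inv p \<in> P"
      using P_carrier[OF vs(3)] subgroup.m_inv_closed[OF PG vs(3)] by auto
    let ?us = "map (shift (inv p)) (v # vs)"
    have c: "3 \<le> length (v # vs)" "distinct (v # vs)" "graph_walk C (v # vs)" "{last (v # vs), v} \<in> edges C"
      using vs(1) by (auto simp: K.circuit_list_def)
    have ne: "vs \<noteq> []" using c(1) by auto
    have "inj_on (shift (inv p)) (verts C)"
      using shift_inverse[OF p(2)] by (rule inj_on_inverseI)
    then have "inj_on (shift (inv p)) (set (v # vs))"
      by (rule inj_on_subset) (use c(3) in \<open>simp add: graph_walk_def\<close>)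
    then have "distinct ?us" using c(2) distinct_map by blast
    moreover have "graph_walk C ?us" by (rule shift_walk(1)[OF p(2) c(3)])
    moreover have "{last ?us, hd ?us} \<in> edges C"
      using shift_edge[OF p(2) c(4)] ne by (simp add: last_map)
    ultimately have circ: "K.circuit_list ?us" using c(1) by (simp add: K.circuit_list_def)
    have "hd ?us = v" using coset_join3[OF p(2) PG p(3)] by simp
    moreover have "hd (tl ?us) = Inl \<one>" using ne vs(2) p by (simp add: hd_map)
    moreover have "walk_length C ?us \<le> n" using shift_walk(2)[OF p(2) c(3)] vs(4) by simp
    moreover have "Inl (inv p \<otimes> x) \<in> set ?us" using vs(5) by force
    ultimately have "Inl (inv p \<otimes> x) \<in> W" using circ unfolding W_def by blast
    moreover have "x \<in> carrier G" using c(3) vs(5) by (auto simp: graph_walk_def coned_off_graph_def)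
    ultimately show ?thesis using p by simp
  qed
  moreover have "finite (Inl -` W)" using finW by (intro finite_vimageI) auto
  ultimately show ?thesis by (intro exI[of _ "Inl -` W \<inter> carrier G"]) blast
qed

text \<open>Freed of loops, a walk from \<open>p\<close> to \<open>q\<close> that avoids
  \<open>v\<close> closes up through \<open>v\<close> to a circuit of bounded length that contains
  \<open>q\<close>. The case \<open>p = q\<close>, in which there may be no circuit, accounts for
  the element \<open>\<one>\<close>.\<close>

lemma finite_joined:
  "\<exists>Z. finite Z \<and> Z \<subseteq> P \<and> (\<forall>p\<in>P. \<forall>q\<in>P. joined C (- {v}) n (Inl p) (Inl q) \<longrightarrow> inv p \<otimes> q \<in> Z)"
proof -
  obtain Q where Q: "finite Q" and Q': "\<And>vs p x. K.circuit_list (v # vs) \<Longrightarrow> hd vs = Inl p \<Longrightarrow> p \<in> P \<Longrightarrow>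
     walk_length C (v # vs) \<le> n + 1/2 \<Longrightarrow> Inl x \<in> set vs \<Longrightarrow> inv p \<otimes> x \<in> Q"
    using finite_circuits_at_cone[of "n + 1/2"] by blast
  have "inv p \<otimes> q \<in> (insert \<one> Q) \<inter> P" if pq: "p \<in> P" "q \<in> P" "joined C (- {v}) n (Inl p) (Inl q)" for p q
  proof -
    obtain ws where ws: "graph_walk C ws" "hd ws = Inl p" "last ws = Inl q" "set ws \<subseteq> - {v}" "walk_length C ws \<le> n"
      using pq(3) by (auto simp: joined_def)
    obtain zs where zs: "graph_walk C zs" "distinct zs" "hd zs = Inl p" "last zs = Inl q" "set zs \<subseteq> - {v}" "walk_length C zs \<le> n"
      using K.graph_walk_distinct[OF ws(1)] ws by (metis order_trans)
    have ne: "zs \<noteq> []" using zs(1) by (simp add: graph_walk_def)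
    have "inv p \<otimes> q \<in> insert \<one> Q"
    proof (cases "p = q")
      case True
      then show ?thesis using P_carrier[OF pq(1)] by simp
    next
      case False
      then obtain x y us where xy: "zs = x # y # us" using zs(3,4) ne by (cases zs; cases "tl zs") auto
      have e: "{v, hd zs} \<in> edges C" "{last zs, v} \<in> edges C"
        using cone_edge[OF pq(1)] cone_edge[OF pq(2)] zs(3,4) by (auto simp: insert_commute)
      have w: "graph_walk C (v # zs)"
        using graph_walk_append[of "[v]" zs C] ne zs(1) e(1) v_vert by (simp add: graph_walk_def)
      have "K.circuit_list (v # zs)"
        using w zs(2,5) e(2) ne xy by (auto simp: K.circuit_list_def)
      moreover have "walk_length C (v # zs) \<le> n + 1/2"
        using walk_length_append[of "[v]" zs C] ne zs(3,6) cone_edge_length(2)[of p] by simp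
      moreover have "Inl q \<in> set zs" using ne zs(4) last_in_set by metis
      ultimately show ?thesis using Q' zs(3) pq(1) by blast
    qed
    moreover have "inv p \<otimes> q \<in> P"
      using pq subgroup.m_closed[OF PG] subgroup.m_inv_closed[OF PG] by blast
    ultimately show ?thesis by blast
  qed
  then show ?thesis using Q by (intro exI[of _ "insert \<one> Q \<inter> P"]) blast
qed

text \<open>The walk \<open>as\<close> followed by the edge from \<open>p\<close> to the cone vertex is a geodesic.\<close>

definition approach :: "'a + 'a set \<Rightarrow> ('a + 'a set) list \<Rightarrow> 'a \<Rightarrow> bool" where
  "approach x as p \<longleftrightarrow> graph_walk C as \<and> distinct as \<and> hd as = x \<and> last as = Inl p \<and> p \<in> P \<and> v \<notin> set as \<and>
     (\<forall>as1 a as2. as = as1 @ a # as2 \<longrightarrow> K.dv a v = walk_length C (a # as2) + 1/2)"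

lemma approach_exists:
  assumes "x \<in> verts C" "x \<noteq> v" shows "\<exists>as p. approach x as p"
proof -
  obtain ws where ws: "graph_walk C ws" "hd ws = x" "last ws = v" "walk_length C ws = K.dv x v"
    using K.gdist_walk[OF assms(1) v_vert] by blast
  obtain zs where zs: "graph_walk C zs" "distinct zs" "hd zs = x" "last zs = v" "walk_length C zs \<le> K.dv x v"
    using K.graph_walk_distinct[OF ws(1)] ws by metis
  have wl: "walk_length C zs = K.dv x v" using K.gdist_le_walk_length[OF zs(1)] zs by simp
  have "zs \<noteq> []" using zs(1) by (simp add: graph_walk_def)
  then obtain as where as: "zs = as @ [v]" using zs(4) by (metis append_butlast_last_id)
  have ne: "as \<noteq> []" using zs(3) as assms(2) by auto
  have w: "graph_walk C as" "{last as, v} \<in> edges C"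
    using zs(1) as ne by (auto simp: graph_walk_append)
  obtain p where p: "p \<in> P" "last as = Inl p" using cone_neighbour[OF w(2)] by blast
  have "K.dv a v = walk_length C (a # as2) + 1/2" if a: "as = as1 @ a # as2" for as1 a as2
  proof -
    have "walk_length C (a # (as2 @ [v])) = K.dv a v"
      using K.geodesic_walk_suffix[of as1 a "as2 @ [v]"] zs wl as a by simp
    moreover have "walk_length C ((a # as2) @ [v]) = walk_length C (a # as2) + 1/2"
      using walk_length_append[of "a # as2" "[v]" C] p a cone_edge_length(1)[of p] by simp
    ultimately show ?thesis by simp
  qed
  then have "approach x as p" unfolding approach_def using w zs(2,3) as ne p by auto
  then show ?thesis by blast
qed

section \<open>Comparison of two geodesics to the cone vertex\<close>

lemma approach_split:
  assumes "approach x as p" "a \<in> set as"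
  shows "joined C (- {v}) (K.dv a v) a (Inl p)" "K.dv a v \<le> K.dv x v" "a \<in> verts C" "a \<noteq> v"
    "\<exists>as2. set as2 \<subseteq> set as \<and> approach a as2 p"
proof -
  have as: "graph_walk C as" "distinct as" "hd as = x" "last as = Inl p" "p \<in> P" "v \<notin> set as"
    and suf: "\<And>as1 a as2. as = as1 @ a # as2 \<Longrightarrow> K.dv a v = walk_length C (a # as2) + 1/2"
    using assms(1) unfolding approach_def by blast+
  show "a \<in> verts C" "a \<noteq> v" using as assms(2) by (auto simp: graph_walk_def)
  obtain as1 as2 where s: "as = as1 @ a # as2" using assms(2) by (meson split_list)
  have w: "graph_walk C (as1 @ [a])" "graph_walk C (a # as2)"
    using as(1) s graph_walk_join[of C as1 a as2] by auto
  show "joined C (- {v}) (K.dv a v) a (Inl p)"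
    unfolding joined_def using w(2) suf[OF s] as(4,6) s by (intro exI[of _ "a # as2"]) auto
  have ne: "as \<noteq> []" using s by simp
  then have "as = [] @ x # tl as" using as(3) by (metis append_Nil list.collapse)
  then have "K.dv x v = walk_length C as + 1/2" using suf by (metis append_Nil)
  also have "walk_length C as = walk_length C (as1 @ [a]) + walk_length C (a # as2)"
    using s walk_length_join[of C as1 a as2] by simp
  finally show "K.dv a v \<le> K.dv x v" using suf[OF s] K.walk_length_nonneg[OF w(1)] by simp
  have "approach a (a # as2) p" unfolding approach_def
  proof (intro conjI allI impI)
    fix bs b cs assume "a # as2 = bs @ b # cs"
    then have "as = (as1 @ bs) @ b # cs" using s by simp
    then show "K.dv b v = walk_length C (b # cs) + 1/2" by (rule suf)
  qed (use as s w in auto)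
  then show "\<exists>as2. set as2 \<subseteq> set as \<and> approach a as2 p" using s by (intro exI[of _ "a # as2"]) auto
qed

lemma approach_head: "approach x as p \<Longrightarrow> x \<in> set as"
  unfolding approach_def graph_walk_def by (metis hd_in_set)

lemma approach_geodesic:
  assumes "approach x as p"
  shows "graph_walk C (as @ [v])" "walk_length C (as @ [v]) = K.dv x v"
proof -
  have as: "graph_walk C as" "hd as = x" "last as = Inl p" "p \<in> P" "as \<noteq> []"
    using assms unfolding approach_def graph_walk_def by auto
  show "graph_walk C (as @ [v])" using as cone_edge[OF as(4)] v_vert graph_walk_append[of as "[v]" C]
    by (simp add: graph_walk_def)
  have "as = [] @ x # tl as" using as by (metis append_Nil list.collapse)
  then have "K.dv x v = walk_length C as + 1/2" using assms unfolding approach_def by (metis append_Nil)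
  then show "walk_length C (as @ [v]) = K.dv x v"
    using walk_length_append[of as "[v]" C] as cone_edge_length(1)[of p] by simp
qed

text \<open>Slimness is applied to the triangle with corners \<open>x\<close>, \<open>y\<close> and
  \<open>v\<close>. Close to \<open>v\<close>, the side from \<open>x\<close> is far from the short
  side between \<open>x\<close> and \<open>y\<close>, hence close to the side from \<open>y\<close>,
  and the connection between them can avoid \<open>v\<close>. The bound \<open>4 * D + 2\<close>
  does not involve \<open>b\<close>; this is why the contraction constant is independent of the step
  length.\<close>

lemma far_approaches:
  assumes x: "approach x as p" and y: "approach y bs q" and b: "K.dv x y \<le> b"
    and far: "K.dv x v > b + 2 * D + 1"
  shows "joined C (- {v}) (4 * D + 2) (Inl p) (Inl q)"
proof -
  have vx: "x \<in> verts C" and vy: "y \<in> verts C"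
    using approach_split(3)[OF x approach_head[OF x]] approach_split(3)[OF y approach_head[OF y]] .
  note tri = K.M.triangle[OF K.vertex_points K.vertex_points K.vertex_points]
  note [simp] = K.M.commute
  have b0: "0 \<le> b" using b K.M.nonneg[of "vertex x" "vertex y"] by linarith
  have "D \<ge> 1" by simp
  then have "K.dv x v > D" using far b0 by (smt (verit))
  then have "\<exists>z\<in>set as. K.dv z v > D" using approach_head[OF x] by blast
  \<comment> \<open>The last vertex of the approach at distance more than \<open>D\<close> from
    \<open>v\<close>. Its successor is within \<open>D\<close> of \<open>v\<close> and at most 1
    away, so \<open>a\<close> is within \<open>D + 1\<close>.\<close>
  then obtain as1 a as2 where s: "as = as1 @ a # as2" "K.dv a v > D" "\<forall>z\<in>set as2. \<not> K.dv z v > D"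
    using split_list_last_prop[of as "\<lambda>z. K.dv z v > D"] by blast
  have a: "a \<in> set as" using s by simp
  note sa = approach_split[OF x a]
  have wa: "graph_walk C (a # as2)" using x s graph_walk_join[of C as1 a as2] unfolding approach_def by blast
  have aD: "K.dv a v \<le> D + 1"
  proof (cases as2)
    case Nil
    have "K.dv a v = walk_length C (a # as2) + 1/2" using x s(1) unfolding approach_def by blast
    then show ?thesis using Nil by simp
  next
    case (Cons c cs)
    then have e: "{a, c} \<in> edges C" using wa by (auto simp: graph_walk_def)
    have "c \<in> verts C" using e K.edge_verts by blast
    moreover have "K.dv c v \<le> D" using s(3) Cons by auto
    ultimately show ?thesis
      using tri[OF sa(3) _ v_vert, of c] K.gdist_edge[OF e] K.elength_bounds[OF e] by linarith
  qed
  obtain zs where zs: "graph_walk C zs" "hd zs = y" "last zs = x" "walk_length C zs = K.dv y x"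
    using K.gdist_walk[OF vy vx] by blast
  note gx = approach_geodesic[OF x] and gy = approach_geodesic[OF y]
  have ne: "as \<noteq> []" "bs \<noteq> []" using approach_head[OF x] approach_head[OF y] by auto
  have hx: "hd as = x" "hd bs = y" using x y by (auto simp: approach_def)
  have "\<exists>c\<in>set (rev (bs @ [v])) \<union> set zs. K.dv a c \<le> \<delta> + 1"
    using gx gy zs ne hx a
    by (intro K.slim_walks[OF hyp, of "as @ [v]"])
      (auto simp del: rev_append simp: graph_walk_rev walk_length_rev hd_rev last_rev)
  then obtain c where c: "c \<in> set (rev (bs @ [v])) \<union> set zs" "K.dv a c \<le> D" by force
  have vc: "c \<in> verts C" using c(1) gy(1) zs(1) unfolding graph_walk_def by auto
  \<comment> \<open>Otherwise \<open>x\<close> would be within \<open>b\<close> of \<open>c\<close>,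
    \<open>c\<close> within \<open>D\<close> of \<open>a\<close> and \<open>a\<close> within
    \<open>D + 1\<close> of \<open>v\<close>, against \<open>far\<close>.\<close>
  have "c \<notin> set zs"
  proof
    assume "c \<in> set zs"
    then obtain z1 z2 where z: "zs = z1 @ c # z2" by (meson split_list)
    have wz: "graph_walk C (z1 @ [c])" "graph_walk C (c # z2)"
      using zs(1) z graph_walk_join[of C z1 c z2] by auto
    have "K.dv c x \<le> walk_length C (c # z2)" using K.gdist_le_walk_length[OF wz(2)] zs(3) z by simp
    also have "\<dots> \<le> walk_length C zs"
      using walk_length_join[of C z1 c z2] z K.walk_length_nonneg[OF wz(1)] by simp
    finally have "K.dv c x \<le> b" using zs(4) b by simp
    moreover have "K.dv x v \<le> K.dv x c + K.dv c v" "K.dv c v \<le> K.dv c a + K.dv a v"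
      using tri vx vc v_vert sa(3) by blast+
    ultimately show False using far aD c(2) K.M.commute[of "vertex c" "vertex x"] K.M.commute[of "vertex c" "vertex a"]
      by (smt (verit))
  qed
  moreover have "c \<noteq> v" using c(2) s(2) by auto
  ultimately have cb: "c \<in> set bs" using c(1) by simp
  obtain us where us: "graph_walk C us" "hd us = a" "last us = c" "walk_length C us = K.dv a c"
    using K.gdist_walk[OF sa(3) vc] by blast
  \<comment> \<open>A geodesic from \<open>a\<close> to \<open>c\<close> through \<open>v\<close>
    would have length more than \<open>D\<close>, the distance that \<open>a\<close> keeps from
    \<open>v\<close>.\<close>
  have "v \<notin> set us"
  proof
    assume "v \<in> set us"
    then obtain z1 z2 where z: "us = z1 @ v # z2" by (meson split_list)
    have wz: "graph_walk C (z1 @ [v])" "graph_walk C (v # z2)"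
      using us(1) z graph_walk_join[of C z1 v z2] by auto
    have "hd (z1 @ [v]) = a" using us(2) z by (cases z1) auto
    then have "K.dv a v \<le> walk_length C (z1 @ [v])" using K.gdist_le_walk_length[OF wz(1)] by simp
    also have "\<dots> \<le> walk_length C us"
      using walk_length_join[of C z1 v z2] z K.walk_length_nonneg[OF wz(2)] by simp
    finally show False using us(4) c(2) s(2) by simp
  qed
  then have j2: "joined C (- {v}) D a c" unfolding joined_def using us c(2) by (intro exI[of _ us]) auto
  have "K.dv c v \<le> K.dv c a + K.dv a v" by (rule tri[OF vc sa(3) v_vert])
  then have "K.dv c v \<le> 2 * D + 1" using aD c(2) K.M.commute[of "vertex c" "vertex a"] by (smt (verit))
  then have j3: "joined C (- {v}) (2 * D + 1) c (Inl q)"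
    using approach_split(1)[OF y cb] by (rule_tac joined_mono) auto
  have j1: "joined C (- {v}) (D + 1) (Inl p) a"
    using joined_sym[OF sa(1)] aD by (rule_tac joined_mono) auto
  \<comment> \<open>The three pieces have lengths at most \<open>D + 1\<close>, \<open>D\<close> and
    \<open>2 * D + 1\<close>.\<close>
  show ?thesis by (rule joined_mono[OF joined_trans[OF joined_trans[OF j1 j2] j3]]) auto
qed

text \<open>If the common vertex \<open>c\<close> is far from \<open>v\<close>, the two tails are
  approaches from points at distance 0 and the previous bound applies. If it is within
  \<open>2 * D + 1\<close>, going along both tails has length at most \<open>4 * D + 2\<close>, the
  same bound.\<close>

lemma meeting_approaches:
  assumes "approach x as p" "approach y bs q" "c \<in> set as" "c \<in> set bs"
  shows "joined C (- {v}) (4 * D + 2) (Inl p) (Inl q)"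
proof (cases "K.dv c v > 2 * D + 1")
  case True
  obtain as2 bs2 where "approach c as2 p" "approach c bs2 q" using approach_split(5) assms by metis
  moreover have "K.dv c c \<le> 0" using approach_split(3)[OF assms(1,3)] by simp
  ultimately show ?thesis using True by (intro far_approaches[of c as2 p c bs2 q 0]) auto
next
  case False
  have "joined C (- {v}) (K.dv c v + K.dv c v) (Inl p) (Inl q)"
    using joined_trans[OF joined_sym] approach_split(1) assms by metis
  then show ?thesis using False by (rule_tac joined_mono) auto
qed

text \<open>The circuit goes from \<open>v\<close> to \<open>p\<close>, back along
  \<open>as\<close>, along a piece of \<open>zs\<close>, and along \<open>bs\<close> to
  \<open>q\<close> and \<open>v\<close>. The piece of \<open>zs\<close> starts at the last vertex on
  \<open>as\<close> and stops at the next vertex on \<open>bs\<close>, so it meets the approaches at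
  its ends only. The vertex \<open>z\<close> ties the circuit to the walk between \<open>x\<close>
  and \<open>y\<close>, and thereby bounds the position of \<open>x\<close> relative to
  \<open>p\<close>.\<close>

lemma disjoint_approaches:
  assumes x: "approach x as p" and y: "approach y bs q" and disj: "set as \<inter> set bs = {}"
    and zs: "graph_walk C zs" "distinct zs" "hd zs = x" "last zs = y" "v \<notin> set zs"
  shows "\<exists>z\<in>set zs. \<exists>vs. K.circuit_list (v # vs) \<and> hd vs = Inl p \<and> z \<in> set vs \<and>
    walk_length C (v # vs) \<le> K.dv x v + walk_length C zs + K.dv y v + 1"
proof -
  have A: "graph_walk C as" "distinct as" "hd as = x" "last as = Inl p" "p \<in> P" "v \<notin> set as"
    and B: "graph_walk C bs" "distinct bs" "hd bs = y" "last bs = Inl q" "q \<in> P" "v \<notin> set bs"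
    using x y by (auto simp: approach_def)
  have ne: "zs \<noteq> []" "as \<noteq> []" "bs \<noteq> []" using zs A B by (auto simp: graph_walk_def)
  have xz: "x \<in> set zs" "y \<in> set zs" using zs(3,4) ne hd_in_set last_in_set by metis+
  obtain z1 zi z2 where s1: "zs = z1 @ zi # z2" "zi \<in> set as" "\<forall>z\<in>set z2. z \<notin> set as"
    using split_list_last_prop[of zs "\<lambda>z. z \<in> set as"] xz(1) approach_head[OF x] by blast
  have "z2 \<noteq> []"
  proof
    assume "z2 = []"
    then have "zi = y" using s1(1) zs(4) by simp
    then show False using s1(2) disj approach_head[OF y] by blast
  qed
  then have "y \<in> set z2" using s1(1) zs(4) by (metis last_ConsR last_appendR last_in_set list.distinct(1))
  then obtain z3 zj z4 where s2: "z2 = z3 @ zj # z4" "zj \<in> set bs" "\<forall>z\<in>set z3. z \<notin> set bs"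
    using split_list_first_prop[of z2 "\<lambda>z. z \<in> set bs"] approach_head[OF y] by blast
  obtain a1 a2 where a: "as = a1 @ zi # a2" using s1(2) by (meson split_list)
  obtain b1 b2 where b: "bs = b1 @ zj # b2" using s2(2) by (meson split_list)
  let ?A = "rev (zi # a2)" and ?Z = "zi # (z3 @ [zj])" and ?B = "zj # b2"
  let ?vs = "rev a2 @ zi # (z3 @ zj # b2)"
  have zw: "graph_walk C ?Z" "walk_length C ?Z \<le> walk_length C zs"
  proof -
    have 1: "graph_walk C (z1 @ [zi])" "graph_walk C (zi # z3 @ zj # z4)"
      using zs(1) s1(1) s2(1) graph_walk_join[of C z1 zi "z3 @ zj # z4"] by auto
    then have 2: "graph_walk C ((zi # z3) @ [zj])" "graph_walk C (zj # z4)"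
      using graph_walk_join[of C "zi # z3" zj z4] by auto
    show "graph_walk C ?Z" using 2 by simp
    have "walk_length C zs = walk_length C (z1 @ [zi]) + (walk_length C ((zi # z3) @ [zj]) + walk_length C (zj # z4))"
      using s1(1) s2(1) walk_length_join[of C z1 zi "z3 @ zj # z4"] walk_length_join[of C "zi # z3" zj z4] by simp
    then show "walk_length C ?Z \<le> walk_length C zs"
      using K.walk_length_nonneg[OF 1(1)] K.walk_length_nonneg[OF 2(2)] by simp
  qed
  have aw: "graph_walk C ?A" "walk_length C ?A \<le> K.dv x v"
  proof -
    have "graph_walk C (zi # a2)" using A(1) a graph_walk_join[of C a1 zi a2] by blast
    then show "graph_walk C ?A" using graph_walk_rev by blast
    have "K.dv zi v = walk_length C (zi # a2) + 1/2" using x a unfolding approach_def by blast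
    then show "walk_length C ?A \<le> K.dv x v"
      using approach_split(2)[OF x s1(2)] walk_length_rev[of C "zi # a2"] by linarith
  qed
  have bw: "graph_walk C ?B" "walk_length C ?B \<le> K.dv y v"
  proof -
    show "graph_walk C ?B" using B(1) b graph_walk_join[of C b1 zj b2] by blast
    have "K.dv zj v = walk_length C (zj # b2) + 1/2" using y b unfolding approach_def by blast
    then show "walk_length C ?B \<le> K.dv y v"
      using approach_split(2)[OF y s2(2)] by linarith
  qed
  have w1: "graph_walk C (zi # z3 @ zj # b2)"
    using graph_walk_join[of C "zi # z3" zj b2] zw(1) bw(1) by simp
  have w: "graph_walk C ?vs" using graph_walk_join[of C "rev a2" zi "z3 @ zj # b2"] aw(1) w1 by simp
  have l: "walk_length C ?vs \<le> K.dv x v + walk_length C zs + K.dv y v"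
    using walk_length_join[of C "rev a2" zi "z3 @ zj # b2"] walk_length_join[of C "zi # z3" zj b2] zw(2) aw(2) bw(2)
    by simp
  have h: "hd ?vs = Inl p"
  proof -
    have "last (zi # a2) = Inl p" using A(4) a by simp
    then show ?thesis by (cases a2 rule: rev_cases) auto
  qed
  have la: "last ?vs = Inl q" using B(4) b by simp
  have dist: "distinct ?vs"
  proof -
    have "set a2 \<subseteq> set as" "set b2 \<subseteq> set bs" "zi \<notin> set a2" "distinct a2" "zj \<notin> set b2" "distinct b2"
      using A(2) B(2) a b by auto
    moreover have "zi \<notin> set z3" "zj \<notin> set z3" "distinct z3" "zi \<noteq> zj" using zs(2) s1(1) s2(1) by auto
    moreover have "set z3 \<inter> set as = {}" "set z3 \<inter> set bs = {}" "zj \<notin> set as" using s1(3) s2 by auto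
    ultimately show ?thesis using disj s1(2) s2(2) by auto
  qed
  have vn: "v \<notin> set ?vs" using A(6) B(6) zs(5) a b s1(1) s2(1) by auto
  have "graph_walk C ([v] @ ?vs)" using graph_walk_append[of "[v]" ?vs C] w h cone_edge[OF A(5)] v_vert
    by (simp add: graph_walk_def insert_commute)
  moreover have "{last ?vs, v} \<in> edges C" using la cone_edge[OF B(5)] by simp
  ultimately have "K.circuit_list (v # ?vs)"
    using dist vn by (simp add: K.circuit_list_def)
  moreover have "walk_length C ([v] @ ?vs) = 1/2 + walk_length C ?vs"
    using walk_length_append[of "[v]" ?vs C] h cone_edge_length(2)[of p] by simp
  ultimately show ?thesis using l h s1(1) by (intro bexI[of _ zi] exI[of _ ?vs]) auto
qed

text \<open>One walk from \<open>\<one>\<close> to each \<open>b\<close> is fixed, and its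
  translates serve all \<open>x\<close>; hence \<open>n\<close> and \<open>B'\<close> are uniform in
  \<open>x\<close>. The walks run through group elements only, so they avoid all cone
  vertices.\<close>

lemma cayley_walks:
  assumes "finite B" "B \<subseteq> carrier G"
  shows "\<exists>B' n. finite B' \<and> B' \<subseteq> carrier G \<and> 0 \<le> n \<and> (\<forall>x\<in>carrier G. \<forall>b\<in>B. \<exists>zs. graph_walk C zs \<and> distinct zs \<and>
    hd zs = Inl x \<and> last zs = Inl (x \<otimes> b) \<and> walk_length C zs \<le> n \<and> set zs \<subseteq> (\<lambda>z. Inl (x \<otimes> z)) ` B')"
  using assms
proof (induction B rule: finite_induct)
  case empty
  then show ?case by (intro exI[of _ "{}"] exI[of _ 0]) simp
next
  case (insert b B)
  then obtain B' n where IH: "finite B'" "B' \<subseteq> carrier G" "0 \<le> n" "\<And>x c. x \<in> carrier G \<Longrightarrow> c \<in> B \<Longrightarrow>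
    \<exists>zs. graph_walk C zs \<and> distinct zs \<and> hd zs = Inl x \<and> last zs = Inl (x \<otimes> c) \<and>
      walk_length C zs \<le> n \<and> set zs \<subseteq> (\<lambda>z. Inl (x \<otimes> z)) ` B'" by auto
  have b: "b \<in> carrier G" using insert by simp
  have vc: "verts (cayley_graph G S) = carrier G" by (simp add: cayley_graph_def)
  obtain ws0 where ws0: "graph_walk (cayley_graph G S) ws0" "hd ws0 = \<one>" "last ws0 = b"
    using H.gdist_walk[of \<one> b] b vc by auto
  obtain ws where ws: "graph_walk (cayley_graph G S) ws" "distinct ws" "hd ws = \<one>" "last ws = b"
    using H.graph_walk_distinct[OF ws0(1)] ws0 by metis
  have wsG: "set ws \<subseteq> carrier G" and ne: "ws \<noteq> []" using ws(1) vc by (auto simp: graph_walk_def)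
  have suc: "successively (\<lambda>u w. {Inl u, Inl w} \<in> edges C) ws"
    using ws(1) coned_off_cayley_edge unfolding graph_walk_def by (auto elim!: successively_mono)
  have w1: "graph_walk C (map Inl ws)"
    unfolding graph_walk_def successively_map using suc ne wsG Inl_vert by auto
  let ?m = "walk_length C (map Inl ws)"
  have new: "\<exists>zs. graph_walk C zs \<and> distinct zs \<and> hd zs = Inl x \<and> last zs = Inl (x \<otimes> b) \<and>
      walk_length C zs \<le> ?m \<and> set zs \<subseteq> (\<lambda>z. Inl (x \<otimes> z)) ` set ws" if x: "x \<in> carrier G" for x
  proof -
    let ?zs = "map (shift x) (map Inl ws)"
    have "inj_on (\<lambda>z. Inl (x \<otimes> z) :: 'a + 'a set) (set ws)" 
      using x wsG by (auto simp: inj_on_def subset_iff)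
    then have "distinct ?zs" using ws(2) by (simp add: distinct_map comp_def)
    moreover have "hd ?zs = Inl x" "last ?zs = Inl (x \<otimes> b)" using ws(3,4) ne x by (auto simp: hd_map last_map)
    ultimately show ?thesis using shift_walk[OF x w1] by (intro exI[of _ ?zs]) auto
  qed
  show ?case
  proof (intro exI[of _ "B' \<union> set ws"] exI[of _ "max n ?m"] conjI ballI)
    fix x c assume x: "x \<in> carrier G" and c: "c \<in> insert b B"
    show "\<exists>zs. graph_walk C zs \<and> distinct zs \<and> hd zs = Inl x \<and> last zs = Inl (x \<otimes> c) \<and>
      walk_length C zs \<le> max n ?m \<and> set zs \<subseteq> (\<lambda>z. Inl (x \<otimes> z)) ` (B' \<union> set ws)"
    proof (cases "c = b")
      case True
      from new[OF x] obtain zs where "graph_walk C zs" "distinct zs" "hd zs = Inl x" "last zs = Inl (x \<otimes> b)"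
        "walk_length C zs \<le> ?m" "set zs \<subseteq> (\<lambda>z. Inl (x \<otimes> z)) ` set ws" by blast
      then show ?thesis using True by (intro exI[of _ zs]) auto
    next
      case False
      then have "c \<in> B" using c by simp
      from IH(4)[OF x this] obtain zs where "graph_walk C zs" "distinct zs" "hd zs = Inl x" "last zs = Inl (x \<otimes> c)"
        "walk_length C zs \<le> n" "set zs \<subseteq> (\<lambda>z. Inl (x \<otimes> z)) ` B'" by blast
      then show ?thesis by (intro exI[of _ zs]) auto
    qed
  qed (use IH wsG in auto)
qed

text \<open>If the geodesics from \<open>x\<close> and \<open>y\<close> to the cone vertex meet, or if \<open>x\<close> is far from it, then
  hyperbolicity bounds the distance of their entry points independently of \<open>B\<close>. Otherwise they are
  part of a circuit through the cone vertex that passes close to \<open>x\<close>, and there are finitely many of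
  these up to translation.\<close>

lemma coarse_projection:
  "\<exists>\<pi> F. finite F \<and> F \<subseteq> P \<and> \<pi> \<in> carrier G \<rightarrow> P \<and> (\<forall>p\<in>P. \<pi> p = p) \<and>
    (\<forall>B. finite B \<and> B \<subseteq> carrier G \<longrightarrow> (\<exists>R. finite R \<and> R \<subseteq> carrier G \<and>
      (\<forall>x\<in>carrier G. \<forall>y\<in>carrier G. inv x \<otimes> y \<in> B \<longrightarrow> inv (\<pi> x) \<otimes> \<pi> y \<in> F \<or> inv (\<pi> x) \<otimes> x \<in> R)))"
proof -
  define \<pi> where "\<pi> x = (SOME p. \<exists>as. approach (Inl x) as p)" for x
  have ap: "\<exists>as. approach (Inl x) as (\<pi> x)" if "x \<in> carrier G" for x
  proof -
    have "\<exists>p as. approach (Inl x) as p" using approach_exists[of "Inl x"] Inl_vert[OF that] by blast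
    then show ?thesis unfolding \<pi>_def by (rule someI_ex)
  qed
  have \<pi>P: "\<pi> x \<in> P" if "x \<in> carrier G" for x using ap[OF that] by (auto simp: approach_def)
  \<comment> \<open>The distance from \<open>p\<close> to \<open>v\<close> is at most
    \<open>1/2\<close>, the length of the final edge of the approach, so the approach itself has
    length 0.\<close>
  have \<pi>id: "\<pi> p = p" if p: "p \<in> P" for p
  proof -
    obtain as where as: "approach (Inl p) as (\<pi> p)" using ap P_carrier[OF p] by blast
    have j: "joined C (- {v}) (K.dv (Inl p) v) (Inl p) (Inl (\<pi> p))"
      by (rule approach_split(1)[OF as approach_head[OF as]])
    have w: "graph_walk C as" "as \<noteq> []" "hd as = Inl p" "last as = Inl (\<pi> p)"
      using as by (auto simp: approach_def graph_walk_def)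
    have "as = [] @ Inl p # tl as" using w by (metis append_Nil list.collapse)
    then have "K.dv (Inl p) v = walk_length C as + 1/2" using as unfolding approach_def by (metis append_Nil)
    moreover have "K.dv (Inl p) v \<le> 1/2" using K.gdist_edge[OF cone_edge[OF p]] cone_edge_length(1)[of p] by simp
    ultimately have "walk_length C as \<le> 0" by simp
    then have "K.dv (Inl p) (Inl (\<pi> p)) \<le> 0" using K.gdist_le_walk_length[OF w(1)] w by simp
    then have "K.dv (Inl p) (Inl (\<pi> p)) = 0" using K.M.nonneg[of "vertex (Inl p)" "vertex (Inl (\<pi> p))"] by linarith
    moreover have "Inl p \<in> verts C" "Inl (\<pi> p) \<in> verts C"
      using Inl_vert P_carrier p \<pi>P by blast+
    ultimately have "vertex (Inl p :: 'a + 'a set) = vertex (Inl (\<pi> p))" by simp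
    from fun_cong[OF this, of "Inl p"] show ?thesis unfolding K.vertex_apply by (auto split: if_splits)
  qed
  \<comment> \<open>Chosen before \<open>B\<close>: the bound \<open>4 * D + 2\<close> depends on
    \<open>\<delta>\<close> only.\<close>
  obtain F where F: "finite F" "F \<subseteq> P" "\<And>p q. p \<in> P \<Longrightarrow> q \<in> P \<Longrightarrow> joined C (- {v}) (4 * D + 2) (Inl p) (Inl q) \<Longrightarrow> inv p \<otimes> q \<in> F"
    using finite_joined[of "4 * D + 2"] by blast
  have main: "\<exists>R. finite R \<and> R \<subseteq> carrier G \<and>
      (\<forall>x\<in>carrier G. \<forall>y\<in>carrier G. inv x \<otimes> y \<in> B \<longrightarrow> inv (\<pi> x) \<otimes> \<pi> y \<in> F \<or> inv (\<pi> x) \<otimes> x \<in> R)"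
    if B: "finite B" "B \<subseteq> carrier G" for B
  proof -
    obtain B' n where B': "finite B'" "B' \<subseteq> carrier G" "0 \<le> n" and
      walk: "\<And>x b. x \<in> carrier G \<Longrightarrow> b \<in> B \<Longrightarrow> \<exists>zs. graph_walk C zs \<and> distinct zs \<and>
        hd zs = Inl x \<and> last zs = Inl (x \<otimes> b) \<and> walk_length C zs \<le> n \<and> set zs \<subseteq> (\<lambda>z. Inl (x \<otimes> z)) ` B'"
      using cayley_walks[OF B] by metis
    let ?M = "n + 2 * D + 1"
    \<comment> \<open>In the remaining case \<open>x\<close> is within \<open>?M\<close> of
      \<open>v\<close>, \<open>y\<close> within \<open>n + ?M\<close>, and the walk between them has
      length at most \<open>n\<close>.\<close>
    obtain Q where Q: "finite Q" "Q \<subseteq> carrier G" and Q': "\<And>vs p x. K.circuit_list (v # vs) \<Longrightarrow> hd vs = Inl p \<Longrightarrow> p \<in> P \<Longrightarrow>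
       walk_length C (v # vs) \<le> 2 * ?M + 2 * n + 1 \<Longrightarrow> Inl x \<in> set vs \<Longrightarrow> inv p \<otimes> x \<in> Q"
      using finite_circuits_at_cone[of "2 * ?M + 2 * n + 1"] by blast
    \<comment> \<open>The circuit meets the walk at \<open>x \<otimes> h\<close> with
      \<open>h\<close> in \<open>B'\<close>, so \<open>inv (\<pi> x) \<otimes> x\<close> is an
      element of \<open>Q\<close> times \<open>inv h\<close>.\<close>
    define R where "R = (\<lambda>(g, h). g \<otimes> inv h) ` (Q \<times> B')"
    have "inv (\<pi> x) \<otimes> \<pi> y \<in> F \<or> inv (\<pi> x) \<otimes> x \<in> R"
      if xy: "x \<in> carrier G" "y \<in> carrier G" "inv x \<otimes> y \<in> B" for x y
    proof -
      have "x \<otimes> (inv x \<otimes> y) = y" using xy by (simp flip: m_assoc)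
      then obtain zs where zs: "graph_walk C zs" "distinct zs" "hd zs = Inl x" "last zs = Inl y"
        "walk_length C zs \<le> n" "set zs \<subseteq> (\<lambda>z. Inl (x \<otimes> z)) ` B'" using walk[OF xy(1,3)] by metis
      have dxy: "K.dv (Inl x) (Inl y) \<le> n" using K.gdist_le_walk_length[OF zs(1)] zs by simp
      obtain as bs where as: "approach (Inl x) as (\<pi> x)" and bs: "approach (Inl y) bs (\<pi> y)"
        using ap xy by blast
      consider "K.dv (Inl x) v > ?M" | c where "c \<in> set as" "c \<in> set bs"
        | "K.dv (Inl x) v \<le> ?M" "set as \<inter> set bs = {}" by fastforce
      then show ?thesis
      proof cases
        case 1
        then show ?thesis using far_approaches[OF as bs dxy] F(3) \<pi>P xy by auto
      next
        case 2
        then show ?thesis using meeting_approaches[OF as bs] F(3) \<pi>P xy by auto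
      next
        case 3
        have "v \<notin> set zs" using zs(6) by auto
        from disjoint_approaches[OF as bs 3(2) zs(1-4) this] obtain z vs where vs: "z \<in> set zs"
          "K.circuit_list (v # vs)" "hd vs = Inl (\<pi> x)" "z \<in> set vs"
          "walk_length C (v # vs) \<le> K.dv (Inl x) v + walk_length C zs + K.dv (Inl y) v + 1" by blast
        obtain h where h: "h \<in> B'" "z = Inl (x \<otimes> h)" using zs(6) vs(1) by blast
        have hG: "h \<in> carrier G" using h(1) B'(2) by blast
        have "K.dv (Inl y) v \<le> K.dv (Inl y) (Inl x) + K.dv (Inl x) v"
          using K.M.triangle[OF K.vertex_points K.vertex_points K.vertex_points] Inl_vert xy v_vert by blast
        then have "K.dv (Inl y) v \<le> n + ?M"
          using dxy 3(1) K.M.commute[of "vertex (Inl y)" "vertex (Inl x)"] by linarith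
        then have "inv (\<pi> x) \<otimes> (x \<otimes> h) \<in> Q"
          using Q'[OF vs(2,3) \<pi>P[OF xy(1)], of "x \<otimes> h"] vs(4,5) h(2) zs(5) 3(1) by simp
        moreover have "inv (\<pi> x) \<otimes> x = (inv (\<pi> x) \<otimes> (x \<otimes> h)) \<otimes> inv h"
          using xy hG P_carrier[OF \<pi>P[OF xy(1)]] by (simp add: m_assoc)
        ultimately have "inv (\<pi> x) \<otimes> x \<in> R" using h(1) by (auto simp: R_def intro!: image_eqI[of _ _ "(_, h)"])
        then show ?thesis by blast
      qed
    qed
    moreover have "finite R" using Q(1) B'(1) by (simp add: R_def)
    moreover have "R \<subseteq> carrier G" using Q(2) B'(2) by (auto simp: R_def)
    ultimately show ?thesis by blast
  qed
  show ?thesis using F(1,2) \<pi>P \<pi>id main by (intro exI[of _ \<pi>] exI[of _ F]) blast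
qed

end

text \<open>The conclusion mentions neither a generating set nor the coned-off graph, so it can be
  used with arbitrary finite generating sets of \<open>G\<close> and \<open>P\<close>.\<close>

lemma peripheral_projection:
  fixes G (structure)
  assumes "relatively_hyperbolic G \<P>" "P \<in> \<P>"
  shows "\<exists>\<pi> F. finite F \<and> F \<subseteq> P \<and> \<pi> \<in> carrier G \<rightarrow> P \<and> (\<forall>p\<in>P. \<pi> p = p) \<and>
    (\<forall>B. finite B \<and> B \<subseteq> carrier G \<longrightarrow> (\<exists>R. finite R \<and> R \<subseteq> carrier G \<and>
      (\<forall>x\<in>carrier G. \<forall>y\<in>carrier G. inv x \<otimes> y \<in> B \<longrightarrow> inv (\<pi> x) \<otimes> \<pi> y \<in> F \<or> inv (\<pi> x) \<otimes> x \<in> R)))"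
proof -
  obtain S \<delta> where "group G" "\<forall>P\<in>\<P>. subgroup P G" "finite_generating_set G S"
    "hyperbolic (realization (coned_off_graph G S \<P>)) \<delta>" "fine_graph (coned_off_graph G S \<P>)"
    using assms(1) unfolding relatively_hyperbolic_def by blast
  then have "peripheral_subgroup G S \<P> P \<delta>"
    using assms(2) by (auto simp: peripheral_subgroup_def peripheral_subgroup_axioms_def)
  then show ?thesis by (rule peripheral_subgroup.coarse_projection)
qed

section \<open>Geodesic rays and quasi-geodesics\<close>

text \<open>Modelled on a Cayley graph with vertex set \<open>V\<close>. Exact geodesics are
  required between vertices only, and \<open>seq_compact\<close> is properness in the form that the
  Arzela-Ascoli argument uses.\<close>

locale geo_space =
  fixes X :: "'a metric" and V :: "'a set" and p :: 'a
  assumes V: "V \<subseteq> mspace X" and base: "p \<in> V"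
    and dense: "x \<in> mspace X \<Longrightarrow> \<exists>u\<in>V. mdist X x u \<le> 1"
    and geodesics: "u \<in> V \<Longrightarrow> w \<in> V \<Longrightarrow>
      \<exists>\<gamma>. geodesic X {0..mdist X u w} \<gamma> \<and> \<gamma> 0 = u \<and> \<gamma> (mdist X u w) = w"
    and seq_compact: "\<And>x r. (\<And>n. x n \<in> mspace X) \<Longrightarrow> (\<And>n. mdist X p (x n) \<le> r) \<Longrightarrow>
      \<exists>s y. strict_mono (s :: nat \<Rightarrow> nat) \<and> y \<in> mspace X \<and> (\<lambda>n. mdist X (x (s n)) y) \<longlonglongrightarrow> 0"

lemma mdist_tendsto_zeroI:
  assumes "\<And>\<epsilon>. 0 < \<epsilon> \<Longrightarrow> \<forall>\<^sub>F n in sequentially. mdist X (f n) (g n) < \<epsilon>"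
  shows "(\<lambda>n. mdist X (f n) (g n)) \<longlonglongrightarrow> 0"
proof (rule order_tendstoI)
  fix a :: real assume "a < 0"
  then have "a < mdist X (f n) (g n)" for n using mdist_nonneg[of X "f n" "g n"] by linarith
  then show "\<forall>\<^sub>F n in sequentially. a < mdist X (f n) (g n)" by simp
qed (rule assms)

lemma quasi_geodesicD:
  assumes "quasi_geodesic X K L I \<gamma>" "s \<in> I" "t \<in> I"
  shows "\<gamma> s \<in> mspace X" "1 / K * \<bar>s - t\<bar> - L \<le> mdist X (\<gamma> s) (\<gamma> t)" "mdist X (\<gamma> s) (\<gamma> t) \<le> K * \<bar>s - t\<bar> + L"
  using assms by (auto simp: quasi_geodesic_def)

lemma geodesicD:
  assumes "geodesic X I \<gamma>" "s \<in> I" "t \<in> I"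
  shows "\<gamma> s \<in> mspace X" "mdist X (\<gamma> s) (\<gamma> t) = \<bar>s - t\<bar>"
  using quasi_geodesicD[OF assms] by auto

text \<open>With a common origin, the parameters \<open>s\<close> and \<open>t\<close> are distances
  from it, so they differ by at most the distance of the two points.\<close>

lemma geodesic_points_near:
  assumes "geodesic X {0..} \<alpha>" "geodesic X {0..} \<beta>" "\<alpha> 0 = \<beta> 0" "s \<ge> 0" "t \<ge> 0"
  shows "mdist X (\<alpha> s) (\<beta> s) \<le> 2 * mdist X (\<alpha> s) (\<beta> t)"
proof -
  have p: "\<alpha> s \<in> mspace X" "\<beta> s \<in> mspace X" "\<beta> t \<in> mspace X" "\<alpha> 0 \<in> mspace X"
    using assms geodesicD(1) by (metis atLeast_iff order_refl)+
  have "mdist X (\<alpha> 0) (\<alpha> s) = s" "mdist X (\<alpha> 0) (\<beta> t) = t" "mdist X (\<beta> t) (\<beta> s) = \<bar>t - s\<bar>"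
    using geodesicD(2)[OF assms(1), of 0 s] geodesicD(2)[OF assms(2), of 0 t] geodesicD(2)[OF assms(2), of t s] assms
    by auto
  moreover have "mdist X (\<alpha> 0) (\<alpha> s) \<le> mdist X (\<alpha> 0) (\<beta> t) + mdist X (\<beta> t) (\<alpha> s)"
    "mdist X (\<alpha> 0) (\<beta> t) \<le> mdist X (\<alpha> 0) (\<alpha> s) + mdist X (\<alpha> s) (\<beta> t)"
    "mdist X (\<alpha> s) (\<beta> s) \<le> mdist X (\<alpha> s) (\<beta> t) + mdist X (\<beta> t) (\<beta> s)"
    using p by (auto intro!: mdist_triangle)
  ultimately show ?thesis using mdist_commute[of X "\<beta> t" "\<alpha> s"] by linarith
qed

context geo_space
begin

lemma base_point: "p \<in> mspace X" using V base by blast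

text \<open>The ends are replaced by nearby vertices and attached by jumps. The constant 3 is one
  unit for each end and one for the reparametrization.\<close>

lemma coarse_geodesic:
  assumes "x \<in> mspace X" "y \<in> mspace X"
  shows "\<exists>l\<ge>0. \<exists>\<sigma>. quasi_geodesic X 1 3 {0..l} \<sigma> \<and> \<sigma> 0 = x \<and> \<sigma> l = y"
proof -
  obtain u w where u: "u \<in> V" "mdist X x u \<le> 1" and w: "w \<in> V" "mdist X y w \<le> 1"
    using dense assms by meson
  let ?d = "mdist X u w"
  obtain \<gamma> where g: "geodesic X {0..?d} \<gamma>" "\<gamma> 0 = u" "\<gamma> ?d = w" using geodesics[OF u(1) w(1)] by blast
  define h where "h t = max 0 (min t ?d)" for t :: real
  \<comment> \<open>The interval exceeds the geodesic by 1, so its ends are distinct and both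
    \<open>x\<close> and \<open>y\<close> are attained even if \<open>u = w\<close>.\<close>
  define \<sigma> where "\<sigma> t = (if t \<le> 0 then x else if t \<ge> ?d + 1 then y else \<gamma> (h t))" for t
  have hd: "h t \<in> {0..?d}" for t by (auto simp: h_def)
  have gX: "\<gamma> (h t) \<in> mspace X" for t using geodesicD(1)[OF g(1) hd hd] .
  have near: "mdist X (\<sigma> t) (\<gamma> (h t)) \<le> 1" if "t \<in> {0..?d + 1}" for t
  proof -
    have "h 0 = 0" "h (?d + 1) = ?d" by (auto simp: h_def)
    moreover have "mdist X (\<gamma> (h t)) (\<gamma> (h t)) \<le> 1" using gX by (metis mdist_zero zero_le_one)
    ultimately show ?thesis using u w g gX[of t] that by (auto simp: \<sigma>_def)
  qed
  have sX: "\<sigma> t \<in> mspace X" for t using assms gX by (simp add: \<sigma>_def)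
  have "quasi_geodesic X 1 3 {0..?d + 1} \<sigma>"
    unfolding quasi_geodesic_def
  proof (intro conjI ballI)
    fix s t assume st: "s \<in> {0..?d + 1}" "t \<in> {0..?d + 1}"
    have 1: "\<bar>\<bar>h s - h t\<bar> - \<bar>s - t\<bar>\<bar> \<le> 1" using st by (auto simp: h_def)
    have 2: "mdist X (\<gamma> (h s)) (\<gamma> (h t)) = \<bar>h s - h t\<bar>" by (rule geodesicD(2)[OF g(1) hd hd])
    have "mdist X (\<sigma> s) (\<sigma> t) \<le> mdist X (\<sigma> s) (\<gamma> (h s)) + mdist X (\<gamma> (h s)) (\<sigma> t)"
      "mdist X (\<gamma> (h s)) (\<sigma> t) \<le> mdist X (\<gamma> (h s)) (\<gamma> (h t)) + mdist X (\<gamma> (h t)) (\<sigma> t)"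
      "mdist X (\<gamma> (h s)) (\<gamma> (h t)) \<le> mdist X (\<gamma> (h s)) (\<sigma> s) + mdist X (\<sigma> s) (\<gamma> (h t))"
      "mdist X (\<sigma> s) (\<gamma> (h t)) \<le> mdist X (\<sigma> s) (\<sigma> t) + mdist X (\<sigma> t) (\<gamma> (h t))"
      using sX gX by (auto intro!: mdist_triangle)
    then show "1 / 1 * \<bar>s - t\<bar> - 3 \<le> mdist X (\<sigma> s) (\<sigma> t)" "mdist X (\<sigma> s) (\<sigma> t) \<le> 1 * \<bar>s - t\<bar> + 3"
      using 1 2 near[OF st(1)] near[OF st(2)] mdist_commute[of X "\<gamma> (h t)" "\<sigma> t"] mdist_commute[of X "\<gamma> (h s)" "\<sigma> s"]
      by auto
  qed (use sX in \<open>auto simp: is_interval_cc\<close>)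
  moreover have "\<not> ?d + 1 \<le> 0" using mdist_nonneg[of X u w] by linarith
  then have "\<sigma> 0 = x" "\<sigma> (?d + 1) = y" "0 \<le> ?d + 1" by (auto simp: \<sigma>_def)
  ultimately show ?thesis by blast
qed

text \<open>Properness gives convergence at one time along a subsequence, and diagonalization at all
  nonnegative rational times. The Lipschitz bound extends this to real times and makes it uniform on
  compact sets.\<close>

lemma arzela_ascoli_lipschitz:
  assumes mem: "\<And>n t. 0 \<le> t \<Longrightarrow> f n t \<in> mspace X"
    and lip: "\<And>n s t. 0 \<le> s \<Longrightarrow> 0 \<le> t \<Longrightarrow> mdist X (f n s) (f n t) \<le> \<bar>s - t\<bar>"
    and f0: "\<And>n. f n 0 = p"
  shows "\<exists>r g. strict_mono (r :: nat \<Rightarrow> nat) \<and> (\<forall>t\<ge>0. g t \<in> mspace X) \<and>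
    converges_uniformly_on_compacts X (f \<circ> r) g"
proof -
  note tri = mdist_triangle[of _ X]
  define q where "q k = \<bar>real_of_rat (from_nat k)\<bar>" for k
  define Q where "Q k s \<longleftrightarrow> (\<exists>y\<in>mspace X. (\<lambda>n. mdist X (f (s n) (q k)) y) \<longlonglongrightarrow> 0)" for k and s :: "nat \<Rightarrow> nat"
  have q0: "0 \<le> q k" for k by (simp add: q_def)
  have sub: "\<exists>s' y. strict_mono (s' :: nat \<Rightarrow> nat) \<and> y \<in> mspace X \<and> (\<lambda>n. mdist X (f (s (s' n)) t) y) \<longlonglongrightarrow> 0"
    if "0 \<le> t" for t and s :: "nat \<Rightarrow> nat"
  proof (rule seq_compact)
    show "mdist X p (f (s n) t) \<le> t" for n using lip[of 0 t "s n"] f0 that by simp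
  qed (use mem that in simp)
  interpret subseqs Q
  proof
    fix n :: nat and s :: "nat \<Rightarrow> nat"
    show "\<exists>r'. strict_mono r' \<and> Q n (s \<circ> r')" using sub[OF q0] unfolding Q_def comp_def by blast
  qed
  define r where "r = diagseq"
  have r: "strict_mono r" unfolding r_def by (rule subseq_diagseq)
  have conv_q: "\<exists>y\<in>mspace X. (\<lambda>n. mdist X (f (r n) (q k)) y) \<longlonglongrightarrow> 0" for k
  proof -
    have "Q k (diagseq \<circ> ((+) (Suc k)))"
    proof (rule diagseq_holds)
      fix r s :: "nat \<Rightarrow> nat" and n assume "strict_mono r" "Q n s"
      then show "Q n (s \<circ> r)" unfolding Q_def comp_def
        using LIMSEQ_subseq_LIMSEQ[of "\<lambda>m. mdist X (f (s m) (q n)) _" 0 r] by (auto simp: comp_def)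
    qed
    then obtain y where y: "y \<in> mspace X" "(\<lambda>n. mdist X (f (r (Suc k + n)) (q k)) y) \<longlonglongrightarrow> 0"
      unfolding Q_def comp_def r_def by blast
    have "(\<lambda>n. mdist X (f (r n) (q k)) y) \<longlonglongrightarrow> 0"
      by (rule LIMSEQ_offset[of _ "Suc k"]) (use y(2) in \<open>simp only: add.commute\<close>)
    then show ?thesis using y(1) by blast
  qed
  have conv: "\<exists>y\<in>mspace X. (\<lambda>n. mdist X (f (r n) t) y) \<longlonglongrightarrow> 0" if t: "0 \<le> t" for t
  proof -
    obtain s y where s: "strict_mono s" and y: "y \<in> mspace X" and lim: "(\<lambda>n. mdist X (f (r (s n)) t) y) \<longlonglongrightarrow> 0"
      using sub[OF t] by blast
    have "\<forall>\<^sub>F n in sequentially. mdist X (f (r n) t) y < \<epsilon>" if e: "\<epsilon> > 0" for \<epsilon>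
    proof -
      \<comment> \<open>The point \<open>y\<close> is a limit along a further subsequence.
        Comparison with the limit \<open>z\<close> at a nearby rational time, which exists along the
        whole sequence, shows that \<open>y\<close> is the limit of the whole sequence.\<close>
      obtain k where k: "\<bar>q k - t\<bar> < \<epsilon> / 5"
      proof -
        obtain c where c: "c \<in> \<rat>" "t < c" "c < t + \<epsilon> / 5" using Rats_dense_in_real[of t "t + \<epsilon> / 5"] e by auto
        then obtain c' where "c = real_of_rat c'" by (auto elim: Rats_cases)
        moreover have "0 < c'" using calculation c t by (metis le_less_trans zero_less_of_rat_iff)
        ultimately have "q (to_nat c') = c" by (simp add: q_def)
        then show ?thesis using that[of "to_nat c'"] c by auto
      qed
      obtain z where z: "z \<in> mspace X" "(\<lambda>n. mdist X (f (r n) (q k)) z) \<longlonglongrightarrow> 0" using conv_q by blast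
      have ez: "\<forall>\<^sub>F n in sequentially. mdist X (f (r n) (q k)) z < \<epsilon> / 5"
        using order_tendstoD(2)[OF z(2), of "\<epsilon> / 5"] e by simp
      have "\<forall>\<^sub>F n in sequentially. mdist X (f (r (s n)) (q k)) z < \<epsilon> / 5"
        using eventually_subseq[OF s ez] .
      moreover have "\<forall>\<^sub>F n in sequentially. mdist X (f (r (s n)) t) y < \<epsilon> / 5"
        using order_tendstoD(2)[OF lim, of "\<epsilon> / 5"] e by simp
      ultimately have "\<forall>\<^sub>F n in sequentially. mdist X z y < 3 * (\<epsilon> / 5)"
      proof eventually_elim
        case (elim n)
        have "mdist X z y \<le> mdist X z (f (r (s n)) (q k)) + mdist X (f (r (s n)) (q k)) y"
          "mdist X (f (r (s n)) (q k)) y \<le> mdist X (f (r (s n)) (q k)) (f (r (s n)) t) + mdist X (f (r (s n)) t) y"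
          using z(1) y mem[OF q0] mem[OF t] by (auto intro!: tri)
        then show ?case using elim lip[OF q0 t, of "r (s n)" k] k
            mdist_commute[of X z "f (r (s n)) (q k)"] by linarith
      qed
      then have zy: "mdist X z y < 3 * (\<epsilon> / 5)" by simp
      show ?thesis using ez
      proof eventually_elim
        case (elim n)
        have "mdist X (f (r n) t) y \<le> mdist X (f (r n) t) (f (r n) (q k)) + mdist X (f (r n) (q k)) y"
          "mdist X (f (r n) (q k)) y \<le> mdist X (f (r n) (q k)) z + mdist X z y"
          using z(1) y mem[OF q0] mem[OF t] by (auto intro!: tri)
        then show ?case using elim lip[OF t q0, of "r n" k] k zy by linarith
      qed
    qed
    then have "(\<lambda>n. mdist X (f (r n) t) y) \<longlonglongrightarrow> 0" by (rule mdist_tendsto_zeroI)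
    then show ?thesis using y by blast
  qed
  then obtain g where g: "\<And>t. 0 \<le> t \<Longrightarrow> g t \<in> mspace X" "\<And>t. 0 \<le> t \<Longrightarrow> (\<lambda>n. mdist X (f (r n) t) (g t)) \<longlonglongrightarrow> 0"
    by metis
  have glip: "mdist X (g s) (g t) \<le> \<bar>s - t\<bar>" if st: "0 \<le> s" "0 \<le> t" for s t
  proof -
    have "(\<lambda>n. mdist X (f (r n) s) (g s) + (\<bar>s - t\<bar> + mdist X (f (r n) t) (g t))) \<longlonglongrightarrow> 0 + (\<bar>s - t\<bar> + 0)"
      using g(2) st by (intro tendsto_intros) auto
    moreover have "mdist X (g s) (g t) \<le> mdist X (f (r n) s) (g s) + (\<bar>s - t\<bar> + mdist X (f (r n) t) (g t))" for n
    proof -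
      have "mdist X (g s) (g t) \<le> mdist X (g s) (f (r n) s) + mdist X (f (r n) s) (g t)"
        "mdist X (f (r n) s) (g t) \<le> mdist X (f (r n) s) (f (r n) t) + mdist X (f (r n) t) (g t)"
        using g(1) mem st by (auto intro!: tri)
      then show ?thesis using lip[OF st, of "r n"] mdist_commute[of X "g s" "f (r n) s"] by linarith
    qed
    ultimately show ?thesis using LIMSEQ_le_const by fastforce
  qed
  have "converges_uniformly_on_compacts X (f \<circ> r) g"
    unfolding converges_uniformly_on_compacts_def
  proof (intro allI impI)
    fix K :: "real set" and \<epsilon> :: real assume K: "compact K \<and> K \<subseteq> {0..}" and e: "0 < \<epsilon>"
    obtain T where T: "\<And>t. t \<in> K \<Longrightarrow> t \<le> T" using compact_imp_bounded K bounded_imp_bdd_above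
      by (metis bdd_above.unfold)
    \<comment> \<open>Finitely many grid points of mesh \<open>\<epsilon> / 3\<close> suffice below
      \<open>T\<close>. Convergence on the grid costs one third of \<open>\<epsilon>\<close>, the
      Lipschitz bounds for the sequence and for \<open>g\<close> the other two.\<close>
    define m where "m = nat \<lceil>T / (\<epsilon> / 3)\<rceil>"
    have "\<forall>\<^sub>F n in sequentially. \<forall>i\<in>{..m}. mdist X (f (r n) (real i * (\<epsilon> / 3))) (g (real i * (\<epsilon> / 3))) < \<epsilon> / 3"
    proof (intro eventually_ball_finite ballI)
      fix i
      show "\<forall>\<^sub>F n in sequentially. mdist X (f (r n) (real i * (\<epsilon> / 3))) (g (real i * (\<epsilon> / 3))) < \<epsilon> / 3"
        by (rule order_tendstoD(2)[OF g(2)]) (use e in auto)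
    qed simp
    then show "\<forall>\<^sub>F n in sequentially. \<forall>t\<in>K. mdist X ((f \<circ> r) n t) (g t) < \<epsilon>"
    proof (eventually_elim, intro ballI)
      case (elim n) fix t assume "t \<in> K"
      then have t: "0 \<le> t" "t \<le> T" using K T by auto
      define i where "i = nat \<lfloor>t / (\<epsilon> / 3)\<rfloor>"
      have "t / (\<epsilon> / 3) \<le> T / (\<epsilon> / 3)" using t e by (simp add: field_simps)
      then have im: "i \<le> m" unfolding i_def m_def by linarith
      have "0 \<le> t / (\<epsilon> / 3)" using t e by simp
      then have "real i \<le> t / (\<epsilon> / 3)" "t / (\<epsilon> / 3) < real i + 1"
        unfolding i_def by linarith+
      then have "\<bar>t - real i * (\<epsilon> / 3)\<bar> \<le> \<epsilon> / 3" using e by (auto simp: field_simps)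
      moreover have i0: "0 \<le> real i * (\<epsilon> / 3)" using e by simp
      moreover have "mdist X (f (r n) (real i * (\<epsilon> / 3))) (g (real i * (\<epsilon> / 3))) < \<epsilon> / 3" using elim im by auto
      moreover have "mdist X (f (r n) t) (g t) \<le> mdist X (f (r n) t) (f (r n) (real i * (\<epsilon> / 3))) + mdist X (f (r n) (real i * (\<epsilon> / 3))) (g t)"
        "mdist X (f (r n) (real i * (\<epsilon> / 3))) (g t) \<le> mdist X (f (r n) (real i * (\<epsilon> / 3))) (g (real i * (\<epsilon> / 3))) + mdist X (g (real i * (\<epsilon> / 3))) (g t)"
        using g(1) mem i0 t by (auto intro!: tri)
      ultimately show "mdist X ((f \<circ> r) n t) (g t) < \<epsilon>"
        using lip[OF t(1) i0, of "r n"] glip[OF i0 t(1)] by (simp add: abs_minus_commute)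
    qed
  qed
  then show ?thesis using r g(1) by blast
qed

lemma uniform_imp_pointwise:
  assumes "converges_uniformly_on_compacts X f g" "0 \<le> t"
  shows "(\<lambda>n. mdist X (f n t) (g t)) \<longlonglongrightarrow> 0"
proof (rule mdist_tendsto_zeroI)
  fix a :: real assume "0 < a"
  then have "\<forall>\<^sub>F n in sequentially. \<forall>t\<in>{t}. mdist X (f n t) (g t) < a"
    using assms(1)[unfolded converges_uniformly_on_compacts_def, rule_format, of "{t}" a] assms(2) by simp
  then show "\<forall>\<^sub>F n in sequentially. mdist X (f n t) (g t) < a" by simp
qed

text \<open>The distance identity is assumed only eventually on each interval from 0 to
  \<open>T\<close>, because the limit is also taken of geodesic segments whose lengths tend to
  infinity.\<close>

lemma limit_geodesic:
  assumes mem: "\<And>n t. 0 \<le> t \<Longrightarrow> f n t \<in> mspace X" and f0: "\<And>n. f n 0 = p"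
    and geo: "\<And>T. \<forall>\<^sub>F n in sequentially. \<forall>s\<in>{0..T}. \<forall>t\<in>{0..T}. mdist X (f n s) (f n t) = \<bar>s - t\<bar>"
    and g: "\<And>t. 0 \<le> t \<Longrightarrow> g t \<in> mspace X" and conv: "converges_uniformly_on_compacts X f g"
  shows "geodesic X {0..} g" "g 0 = p"
proof -
  note pw = uniform_imp_pointwise[OF conv]
  have "mdist X (g s) (g t) = \<bar>s - t\<bar>" if st: "0 \<le> s" "0 \<le> t" for s t
  proof -
    have "(\<lambda>n. mdist X (f n s) (g s) + mdist X (f n t) (g t)) \<longlonglongrightarrow> 0 + 0"
      using pw st by (intro tendsto_add) auto
    moreover have "\<forall>\<^sub>F n in sequentially. \<bar>mdist X (g s) (g t) - \<bar>s - t\<bar>\<bar> \<le> mdist X (f n s) (g s) + mdist X (f n t) (g t)"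
      using geo[of "max s t"]
    proof eventually_elim
      case (elim n)
      have e: "mdist X (f n s) (f n t) = \<bar>s - t\<bar>" using elim st by auto
      have "mdist X (g s) (g t) \<le> mdist X (g s) (f n s) + mdist X (f n s) (g t)"
        "mdist X (f n s) (g t) \<le> mdist X (f n s) (f n t) + mdist X (f n t) (g t)"
        "mdist X (f n s) (f n t) \<le> mdist X (f n s) (g s) + mdist X (g s) (f n t)"
        "mdist X (g s) (f n t) \<le> mdist X (g s) (g t) + mdist X (g t) (f n t)"
        using g mem st by (auto intro!: mdist_triangle)
      then show ?case using e mdist_commute[of X "g s" "f n s"] mdist_commute[of X "g t" "f n t"] by linarith
    qed
    ultimately have "\<bar>mdist X (g s) (g t) - \<bar>s - t\<bar>\<bar> \<le> 0 + 0"
      by (rule tendsto_lowerbound) simp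
    then show ?thesis by simp
  qed
  then show "geodesic X {0..} g" using g by (auto simp: quasi_geodesic_def is_interval_ci)
  have "(\<lambda>n. mdist X p (g 0)) \<longlonglongrightarrow> 0" using pw[of 0] f0 by simp
  then have "mdist X p (g 0) = 0" by (simp add: LIMSEQ_const_iff)
  then show "g 0 = p" using g[of 0] base_point by simp
qed

text \<open>A quasi-geodesic ray that stays close to a Morse ray is followed up to a point that almost realizes
  the distance to a far point of the Morse ray. Jumping there yields again a quasi-geodesic, with
  uniform constants.\<close>

lemma quasi_geodesic_near_morse:
  assumes morse: "morse_with X N {0..} \<alpha>" and \<alpha>: "\<alpha> ` {0..} \<subseteq> mspace X" "\<alpha> 0 = p"
    and \<tau>: "quasi_geodesic X K L {0..} \<tau>" "\<tau> 0 = p" and K: "1 \<le> K" and L: "0 \<le> L"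
    and close: "\<And>t. 0 \<le> t \<Longrightarrow> \<exists>s\<ge>0. mdist X (\<tau> t) (\<alpha> s) \<le> D" and t: "0 \<le> t"
  shows "\<exists>s\<ge>0. mdist X (\<tau> t) (\<alpha> s) \<le> N (3 * K) (L + 6)"
proof -
  have D0: "0 \<le> D" using close[of 0] mdist_nonneg by (meson order_refl order_trans)
  \<comment> \<open>Large enough that the almost closest point \<open>\<tau> T'\<close> found below
    cannot come before time \<open>t\<close>.\<close>
  define T where "T = t + K * (2 * D + 1 + L)"
  have T: "t \<le> T" using K L D0 by (simp add: T_def)
  obtain s where s: "0 \<le> s" "mdist X (\<tau> T) (\<alpha> s) \<le> D" using close[of T] T t by auto
  define x where "x = \<alpha> s"
  have xX: "x \<in> mspace X" using s \<alpha> by (auto simp: x_def)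
  have \<tau>X: "\<tau> u \<in> mspace X" if "0 \<le> u" for u using quasi_geodesicD(1)[OF \<tau>(1), of u] that by simp
  define I where "I = (INF u\<in>{0..}. mdist X (\<tau> u) x)"
  have bdd: "bdd_below ((\<lambda>u. mdist X (\<tau> u) x) ` {0..})" by (auto intro!: bdd_belowI[of _ 0])
  have "I < I + 1" by simp
  then obtain T' where T': "0 \<le> T'" "mdist X (\<tau> T') x < I + 1"
    using cINF_less_iff[OF _ bdd, of "I + 1"] by (auto simp: I_def)
  have best: "mdist X (\<tau> T') x \<le> mdist X (\<tau> u) x + 1" if "0 \<le> u" for u
    using T'(2) cINF_lower[OF bdd, of u] that by (simp add: I_def)
  define y where "y = \<tau> T'"
  have yX: "y \<in> mspace X" using \<tau>X T' by (simp add: y_def)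
  have tT': "t \<le> T'"
  proof (rule ccontr)
    assume "\<not> t \<le> T'"
    then have l: "T - T' > K * (2 * D + 1 + L)" by (simp add: T_def)
    have "mdist X (\<tau> T) (\<tau> T') \<le> mdist X (\<tau> T) x + mdist X x (\<tau> T')"
      using \<tau>X T T'(1) t xX by (auto intro!: mdist_triangle)
    also have "\<dots> \<le> 2 * D + 1"
      using s(2) best[of T] T t mdist_commute[of X x "\<tau> T'"] by (simp add: x_def)
    finally have "1 / K * \<bar>T - T'\<bar> - L \<le> 2 * D + 1"
      using quasi_geodesicD(2)[OF \<tau>(1), of T T'] T T'(1) t by simp
    then have "\<bar>T - T'\<bar> \<le> K * (2 * D + 1 + L)" using K by (simp add: field_simps)
    then show False using l by linarith
  qed
  obtain l \<sigma> where l: "0 \<le> l" and \<sigma>: "quasi_geodesic X 1 3 {0..l} \<sigma>" "\<sigma> 0 = y" "\<sigma> l = x"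
    using coarse_geodesic[OF yX xX] by blast
  have \<sigma>X: "\<sigma> u \<in> mspace X" if "u \<in> {0..l}" for u using quasi_geodesicD(1)[OF \<sigma>(1) that that] .
  define \<gamma> where "\<gamma> u = (if u \<le> T' then \<tau> u else \<sigma> (u - T'))" for u
  have g1: "\<gamma> u = \<tau> u" if "u \<le> T'" for u using that by (simp add: \<gamma>_def)
  have g2: "\<gamma> u = \<sigma> (u - T')" if "T' \<le> u" for u using that \<sigma>(2) by (auto simp: \<gamma>_def y_def)
  have K1: "1 / (3 * K) * c \<le> 1 / K * c" "1 / (3 * K) * c \<le> c" "c \<le> 3 * K * c" "K * c \<le> 3 * K * c" if "0 \<le> c" for c
  proof -
    have a: "1 / (3 * K) \<le> 1 / K" "1 / (3 * K) \<le> 1" "1 \<le> 3 * K" "K \<le> 3 * K" using K by (auto simp: field_simps)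
    show "1 / (3 * K) * c \<le> 1 / K * c" "1 / (3 * K) * c \<le> c" "c \<le> 3 * K * c" "K * c \<le> 3 * K * c"
      using mult_right_mono[OF a(1) that] mult_right_mono[OF a(2) that] mult_right_mono[OF a(3) that]
        mult_right_mono[OF a(4) that] by auto
  qed
  have bounds: "1 / (3 * K) * (w - u) - (L + 6) \<le> mdist X (\<gamma> u) (\<gamma> w) \<and> mdist X (\<gamma> u) (\<gamma> w) \<le> 3 * K * (w - u) + (L + 6)"
    if uw: "0 \<le> u" "u \<le> w" "w \<le> T' + l" for u w
  proof -
    consider "w \<le> T'" | "T' \<le> u" | "u \<le> T'" "T' \<le> w" by linarith
    then show ?thesis
    proof cases
      case 1
      then show ?thesis
        using g1[of u] g1[of w] quasi_geodesicD(2,3)[OF \<tau>(1), of u w] uw K1(1,4)[of "w - u"] by auto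
    next
      case 2
      then show ?thesis
        using g2[of u] g2[of w] quasi_geodesicD(2,3)[OF \<sigma>(1), of "u - T'" "w - T'"] uw K1(2,3)[of "w - u"] L by auto
    next
      case 3
      define c where "c = w - T'"
      define z where "z = \<sigma> c"
      have c: "c \<in> {0..l}" using uw 3 by (auto simp: c_def)
      have zX: "z \<in> mspace X" using \<sigma>X[OF c] by (simp add: z_def)
      have uX: "\<tau> u \<in> mspace X" using \<tau>X uw by simp
      have guw: "\<gamma> u = \<tau> u" "\<gamma> w = z" using g1 g2 3 by (auto simp: z_def c_def)
      have yz: "mdist X y z \<le> c + 3" using quasi_geodesicD(3)[OF \<sigma>(1), of 0 c] c l \<sigma>(2) by (simp add: z_def)
      have zx: "mdist X z x \<le> l - c + 3" using quasi_geodesicD(3)[OF \<sigma>(1) c, of l] c l \<sigma>(3) by (simp add: z_def)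
      have yx: "l - 3 \<le> mdist X y x" using quasi_geodesicD(2)[OF \<sigma>(1), of 0 l] l \<sigma>(2,3) by simp
      have uy: "1 / K * (T' - u) - L \<le> mdist X (\<tau> u) y" "mdist X (\<tau> u) y \<le> K * (T' - u) + L"
        using quasi_geodesicD(2,3)[OF \<tau>(1), of u T'] uw T' 3 by (auto simp: y_def)
      have "mdist X y x \<le> mdist X (\<tau> u) x + 1" using best[of u] uw by (simp add: y_def)
      moreover have "mdist X (\<tau> u) x \<le> mdist X (\<tau> u) z + mdist X z x"
        "mdist X (\<tau> u) y \<le> mdist X (\<tau> u) z + mdist X z y" "mdist X (\<tau> u) z \<le> mdist X (\<tau> u) y + mdist X y z"
        using uX zX xX yX by (auto intro!: mdist_triangle)
      \<comment> \<open>The choice of \<open>y\<close> gives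
        \<open>c - 7 \<le> mdist X (\<tau> u) z\<close>. Twice this is added to
        \<open>1 / K * (T' - u) - L - c - 3 \<le> mdist X (\<tau> u) z\<close>. Division by 3
        accounts for \<open>3 * K\<close>, and \<open>L + 6\<close> bounds a third of
        \<open>L + 17\<close>.\<close>
      ultimately have low: "3 * mdist X (\<tau> u) z \<ge> c + 1 / K * (T' - u) - (L + 17)"
        and up: "mdist X (\<tau> u) z \<le> K * (T' - u) + c + (L + 3)"
        using yz zx yx uy mdist_commute[of X z y] by linarith+
      have "1 / (3 * K) * (w - u) = (1 / K * c + 1 / K * (T' - u)) / 3" using K by (simp add: c_def field_simps)
      also have "\<dots> \<le> (c + 1 / K * (T' - u)) / 3"
        using K c mult_right_mono[of "1 / K" 1 c] by (simp add: field_simps)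
      finally have e: "1 / (3 * K) * (w - u) \<le> (c + 1 / K * (T' - u)) / 3" .
      have "A - (L + 6) \<le> m" if "A \<le> (c + B) / 3" "c + B - (L + 17) \<le> 3 * m" for A B m :: real
        using that L by argo
      from this[OF e low] have "1 / (3 * K) * (w - u) - (L + 6) \<le> mdist X (\<tau> u) z" .
      moreover have "K * (T' - u) + c \<le> 3 * K * (T' - u) + 3 * K * c"
        using K1(3)[of c] K1(4)[of "T' - u"] c 3 by auto
      then have "mdist X (\<tau> u) z \<le> 3 * K * (w - u) + (L + 6)" using up by (simp add: c_def algebra_simps)
      ultimately show ?thesis using guw by simp
    qed
  qed
  have "quasi_geodesic X (3 * K) (L + 6) {0..T' + l} \<gamma>"
    unfolding quasi_geodesic_def
  proof (intro conjI ballI)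
    show "\<gamma> ` {0..T' + l} \<subseteq> mspace X" using \<tau>X \<sigma>X by (auto simp: \<gamma>_def)
    fix u w assume uw: "u \<in> {0..T' + l}" "w \<in> {0..T' + l}"
    show "1 / (3 * K) * \<bar>u - w\<bar> - (L + 6) \<le> mdist X (\<gamma> u) (\<gamma> w)" "mdist X (\<gamma> u) (\<gamma> w) \<le> 3 * K * \<bar>u - w\<bar> + (L + 6)"
      using bounds[of u w] bounds[of w u] uw mdist_commute[of X "\<gamma> u" "\<gamma> w"] by (cases "u \<le> w"; auto)+
  qed (simp add: is_interval_cc)
  moreover have "\<gamma> 0 \<in> \<alpha> ` {0..}" using g1[of 0] T'(1) \<tau>(2) \<alpha>(2) by (metis atLeast_iff image_eqI order_refl)
  moreover have "\<gamma> (T' + l) \<in> \<alpha> ` {0..}" using g2[of "T' + l"] l \<sigma>(3) s(1) by (simp add: x_def)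
  moreover have "0 \<le> T' + l" "1 \<le> 3 * K" "0 < L + 6" using T' l K L by auto
  ultimately have "\<forall>u\<in>{0..T' + l}. \<exists>s\<in>{0..}. mdist X (\<gamma> u) (\<alpha> s) \<le> N (3 * K) (L + 6)"
    using morse unfolding morse_with_def by blast
  then show ?thesis using g1[OF tT'] t tT' l by force
qed

end

section \<open>Coarsely embedded pairs of spaces\<close>

text \<open>If \<open>e x y\<close> is the distance from \<open>\<Phi> x\<close> to
  \<open>y\<close>, this bounds the Hausdorff distance between the images of
  \<open>\<Phi> \<circ> \<alpha>\<close> and \<open>\<beta>\<close>. The parameters \<open>s\<close>
  and \<open>t\<close> are unrelated.\<close>

definition fellow :: "('a \<Rightarrow> 'b \<Rightarrow> real) \<Rightarrow> real \<Rightarrow> (real \<Rightarrow> 'a) \<Rightarrow> (real \<Rightarrow> 'b) \<Rightarrow> bool" where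
  "fellow e D \<alpha> \<beta> \<longleftrightarrow> (\<forall>t\<ge>0. \<exists>s\<ge>0. e (\<alpha> t) (\<beta> s) \<le> D) \<and> (\<forall>s\<ge>0. \<exists>t\<ge>0. e (\<alpha> t) (\<beta> s) \<le> D)"

lemma fellow_swap: "fellow (\<lambda>y x. e x y) D \<beta> \<alpha> \<longleftrightarrow> fellow e D \<alpha> \<beta>"
  by (auto simp: fellow_def)

text \<open>The function \<open>e\<close> plays the role of \<open>\<lambda>x y. d (\<Phi> x, y)\<close> for a quasi-isometric embedding \<open>\<Phi>\<close>. Points with
  a small value of \<open>e\<close> are partners. The axioms are invariant under exchanging the two spaces, so that the
  results about \<open>\<Phi>\<close> also apply to its inverse, which is defined on a subset only.\<close>

locale coarse_pair = GX: geo_space X V p + GY: geo_space Y W q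
  for X :: "'a metric" and V p and Y :: "'b metric" and W q +
  fixes e :: "'a \<Rightarrow> 'b \<Rightarrow> real" and k :: real
  assumes k1: "1 \<le> k"
    and e_right: "x \<in> mspace X \<Longrightarrow> y \<in> mspace Y \<Longrightarrow> y' \<in> mspace Y \<Longrightarrow> e x y' \<le> e x y + k * mdist Y y y' + k"
    and e_left: "x \<in> mspace X \<Longrightarrow> x' \<in> mspace X \<Longrightarrow> y \<in> mspace Y \<Longrightarrow> e x' y \<le> e x y + k * mdist X x x' + k"
    and e_Y: "x \<in> mspace X \<Longrightarrow> x' \<in> mspace X \<Longrightarrow> y \<in> mspace Y \<Longrightarrow> y' \<in> mspace Y \<Longrightarrow>
      mdist Y y y' \<le> k * mdist X x x' + k * e x y + k * e x' y' + k"
    and e_X: "x \<in> mspace X \<Longrightarrow> x' \<in> mspace X \<Longrightarrow> y \<in> mspace Y \<Longrightarrow> y' \<in> mspace Y \<Longrightarrow>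
      mdist X x x' \<le> k * mdist Y y y' + k * e x y + k * e x' y' + k"
    and e_base: "e p q \<le> k"
    and qc_X: "1 \<le> K \<Longrightarrow> 0 \<le> L \<Longrightarrow> 0 \<le> C \<Longrightarrow> \<exists>C'. \<forall>\<sigma> a b. a \<le> b \<and> quasi_geodesic X K L {a..b} \<sigma> \<and>
      (\<exists>y\<in>mspace Y. e (\<sigma> a) y \<le> C) \<and> (\<exists>y\<in>mspace Y. e (\<sigma> b) y \<le> C) \<longrightarrow>
      (\<forall>t\<in>{a..b}. \<exists>y\<in>mspace Y. e (\<sigma> t) y \<le> C')"
    and qc_Y: "1 \<le> K \<Longrightarrow> 0 \<le> L \<Longrightarrow> 0 \<le> C \<Longrightarrow> \<exists>C'. \<forall>\<sigma> a b. a \<le> b \<and> quasi_geodesic Y K L {a..b} \<sigma> \<and>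
      (\<exists>x\<in>mspace X. e x (\<sigma> a) \<le> C) \<and> (\<exists>x\<in>mspace X. e x (\<sigma> b) \<le> C) \<longrightarrow>
      (\<forall>t\<in>{a..b}. \<exists>x\<in>mspace X. e x (\<sigma> t) \<le> C')"
    and total: "(\<forall>x\<in>mspace X. \<exists>y\<in>mspace Y. e x y \<le> k) \<or> (\<forall>y\<in>mspace Y. \<exists>x\<in>mspace X. e x y \<le> k)"
begin

text \<open>Doubles every result below. The disjunction in \<open>total\<close> is what makes the
  axioms symmetric although partners exist everywhere on one side only.\<close>

lemma swap: "coarse_pair Y W q X V p (\<lambda>y x. e x y) k"
proof (intro coarse_pair.intro coarse_pair_axioms.intro GX.geo_space_axioms GY.geo_space_axioms k1 e_base)
  show "e x y \<le> e x' y + k * mdist X x' x + k" if "y \<in> mspace Y" "x' \<in> mspace X" "x \<in> mspace X" for y x' x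
    using e_left that by blast
  show "e x y' \<le> e x y + k * mdist Y y y' + k" if "y \<in> mspace Y" "y' \<in> mspace Y" "x \<in> mspace X" for x y y'
    using e_right that by blast
  show "mdist X x x' \<le> k * mdist Y y y' + k * e x y + k * e x' y' + k"
    if "y \<in> mspace Y" "y' \<in> mspace Y" "x \<in> mspace X" "x' \<in> mspace X" for x x' y y'
    using e_X that by blast
  show "mdist Y y y' \<le> k * mdist X x x' + k * e x y + k * e x' y' + k"
    if "y \<in> mspace Y" "y' \<in> mspace Y" "x \<in> mspace X" "x' \<in> mspace X" for x x' y y'
    using e_Y that by blast
qed (use qc_X qc_Y total in blast)+

text \<open>By \<open>e_X\<close> and \<open>e_Y\<close>, distances of points and of their partners
  agree up to the factor \<open>k\<close> and an additive constant.\<close>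

lemma partner_quasi_geodesic:
  assumes \<sigma>: "quasi_geodesic Y K L I \<sigma>" and K: "1 \<le> K" and L: "0 \<le> L" and C: "0 \<le> C"
    and \<tau>: "\<And>t. t \<in> I \<Longrightarrow> \<tau> t \<in> mspace X \<and> e (\<tau> t) (\<sigma> t) \<le> C"
  shows "quasi_geodesic X (k * K) (k * L + 2 * k * C + k) I \<tau>"
  unfolding quasi_geodesic_def
proof (intro conjI ballI)
  show "is_interval I" using \<sigma> by (simp add: quasi_geodesic_def)
  show "\<tau> ` I \<subseteq> mspace X" using \<tau> by blast
  fix s t assume st: "s \<in> I" "t \<in> I"
  note q = quasi_geodesicD[OF \<sigma> st] quasi_geodesicD(1)[OF \<sigma> st(2,1)]
  let ?dX = "mdist X (\<tau> s) (\<tau> t)" and ?dY = "mdist Y (\<sigma> s) (\<sigma> t)"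
  have C1: "k * e (\<tau> s) (\<sigma> s) \<le> k * C" "k * e (\<tau> t) (\<sigma> t) \<le> k * C"
    using \<tau> st k1 by (auto intro!: mult_left_mono)
  have "?dX \<le> k * ?dY + k * e (\<tau> s) (\<sigma> s) + k * e (\<tau> t) (\<sigma> t) + k"
    using e_X \<tau> st q by blast
  also have "\<dots> \<le> k * (K * \<bar>s - t\<bar> + L) + k * C + k * C + k"
    using C1 mult_left_mono[OF q(3), of k] k1 by linarith
  finally show "?dX \<le> k * K * \<bar>s - t\<bar> + (k * L + 2 * k * C + k)" by (simp add: algebra_simps)
  have "?dY \<le> k * ?dX + k * e (\<tau> s) (\<sigma> s) + k * e (\<tau> t) (\<sigma> t) + k"
    using e_Y \<tau> st q by blast
  then have "1 / K * \<bar>s - t\<bar> \<le> L + (k * ?dX + k * C + k * C + k)"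
    using q(2) C1 by linarith
  also have "\<dots> = k * (?dX + (L / k + 2 * C + 1))" using k1 by (simp add: field_simps)
  finally have "(1 / K * \<bar>s - t\<bar>) / k \<le> k * (?dX + (L / k + 2 * C + 1)) / k"
    using k1 by (intro divide_right_mono) auto
  also have "\<dots> = ?dX + (L / k + 2 * C + 1)" using k1 by (intro nonzero_mult_div_cancel_left) auto
  finally have "(1 / K * \<bar>s - t\<bar>) / k \<le> ?dX + (L / k + 2 * C + 1)" .
  moreover have "L / k \<le> k * L" "2 * C \<le> 2 * k * C"
    using k1 L C mult_right_mono[of 1 k L] mult_right_mono[of 1 k C] frac_le[of L L 1 k] by auto
  moreover have "(1 / K * \<bar>s - t\<bar>) / k = 1 / (k * K) * \<bar>s - t\<bar>" by (simp add: field_simps)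
  ultimately show "1 / (k * K) * \<bar>s - t\<bar> - (k * L + 2 * k * C + k) \<le> ?dX" using k1 by linarith
qed

text \<open>Quasi-convexity provides partners for the points of \<open>\<sigma>\<close>. They form a
  quasi-geodesic of \<open>X\<close> with ends on \<open>\<alpha>\<close>, to which the Morse
  property applies. The bound \<open>E\<close> precedes the rays: it depends on the gauge and the
  constants.\<close>

lemma morse_pull:
  assumes N: "N \<in> morse_gauges" and K: "1 \<le> K" and L: "0 \<le> L" and D: "0 \<le> D"
  shows "\<exists>E\<ge>0. \<forall>\<alpha> \<sigma> a b. morse_with X N {0..} \<alpha> \<and> \<alpha> ` {0..} \<subseteq> mspace X \<and> a \<le> b \<and> quasi_geodesic Y K L {a..b} \<sigma> \<and>
    (\<exists>u\<ge>0. e (\<alpha> u) (\<sigma> a) \<le> D) \<and> (\<exists>u\<ge>0. e (\<alpha> u) (\<sigma> b) \<le> D) \<longrightarrow> (\<forall>t\<in>{a..b}. \<exists>u\<ge>0. e (\<alpha> u) (\<sigma> t) \<le> E)"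
proof -
  obtain C' where C': "\<And>\<sigma> a b. a \<le> b \<Longrightarrow> quasi_geodesic Y K L {a..b} \<sigma> \<Longrightarrow> \<exists>x\<in>mspace X. e x (\<sigma> a) \<le> D \<Longrightarrow>
      \<exists>x\<in>mspace X. e x (\<sigma> b) \<le> D \<Longrightarrow> \<forall>t\<in>{a..b}. \<exists>x\<in>mspace X. e x (\<sigma> t) \<le> C'"
    using qc_Y[OF K L D] by metis
  define C where "C = max C' D"
  have C: "0 \<le> C" "D \<le> C" "C' \<le> C" using D by (auto simp: C_def)
  define K' where "K' = k * K"
  define L' where "L' = k * L + 2 * k * C + k"
  have K': "1 \<le> K'" using mult_mono[of 1 k 1 K] k1 K by (simp add: K'_def)
  \<comment> \<open>The condition in \<open>morse_with\<close> is about positive additive constants.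
    The summand \<open>k\<close> ensures positivity even for \<open>L = 0\<close>, that is, for
    geodesics.\<close>
  have L': "0 < L'" using k1 L C by (auto simp: L'_def intro!: add_nonneg_pos)
  have N0: "0 \<le> N K' L'" using N K' L' by (simp add: morse_gauges_def)
  let ?E = "C + k * N K' L' + k"
  have "\<exists>u\<ge>0. e (\<alpha> u) (\<sigma> t) \<le> ?E"
    if \<alpha>: "morse_with X N {0..} \<alpha>" "\<alpha> ` {0..} \<subseteq> mspace X" and ab: "a \<le> b" and \<sigma>: "quasi_geodesic Y K L {a..b} \<sigma>"
    and ua: "0 \<le> ua" "e (\<alpha> ua) (\<sigma> a) \<le> D" and ub: "0 \<le> ub" "e (\<alpha> ub) (\<sigma> b) \<le> D" and t: "t \<in> {a..b}" for \<alpha> \<sigma> a b ua ub t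
  proof -
    have mem: "\<alpha> u \<in> mspace X" if "0 \<le> u" for u using \<alpha>(2) that by auto
    have "\<forall>t\<in>{a..b}. \<exists>x\<in>mspace X. e x (\<sigma> t) \<le> C'"
      by (rule C'[OF ab \<sigma>]) (use mem ua ub in blast)+
    then obtain \<tau>0 where \<tau>0: "\<And>t. t \<in> {a..b} \<Longrightarrow> \<tau>0 t \<in> mspace X \<and> e (\<tau>0 t) (\<sigma> t) \<le> C'" by metis
    \<comment> \<open>The Morse property asks for endpoints on the ray itself, so the end partners
      are replaced by points of \<open>\<alpha>\<close>.\<close>
    define \<tau> where "\<tau> t = (if t = a then \<alpha> ua else if t = b then \<alpha> ub else \<tau>0 t)" for t
    have \<tau>: "\<tau> t \<in> mspace X \<and> e (\<tau> t) (\<sigma> t) \<le> C" if "t \<in> {a..b}" for t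
      using \<tau>0[OF that] mem ua ub C by (auto simp: \<tau>_def)
    have "quasi_geodesic X K' L' {a..b} \<tau>"
      unfolding K'_def L'_def by (rule partner_quasi_geodesic[OF \<sigma> K L C(1) \<tau>])
    moreover have "\<tau> a \<in> \<alpha> ` {0..}" "\<tau> b \<in> \<alpha> ` {0..}" using ua ub by (auto simp: \<tau>_def)
    ultimately obtain u where u: "u \<ge> 0" "mdist X (\<tau> t) (\<alpha> u) \<le> N K' L'"
      using \<alpha>(1) K' L' ab t unfolding morse_with_def by (metis atLeast_iff)
    have "e (\<alpha> u) (\<sigma> t) \<le> e (\<tau> t) (\<sigma> t) + k * mdist X (\<tau> t) (\<alpha> u) + k"
      using \<tau>[OF t] mem[OF u(1)] quasi_geodesicD(1)[OF \<sigma> t t] by (intro e_left) auto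
    also have "\<dots> \<le> ?E" using \<tau>[OF t] mult_left_mono[OF u(2), of k] k1 by linarith
    finally show ?thesis using u(1) by blast
  qed
  moreover have "0 \<le> ?E" using C N0 k1 by simp
  ultimately show ?thesis by (intro exI[of _ ?E]) blast
qed

text \<open>The new gauge is assembled from one bound for each \<open>K\<close> and
  \<open>L\<close>. Each bound holds for all pairs of rays at once, so the gauge is common to all of
  them.\<close>

lemma morse_transfer:
  assumes N: "N \<in> morse_gauges" and D: "0 \<le> D"
  shows "\<exists>N'\<in>morse_gauges. \<forall>\<alpha> \<beta>. morse_with X N {0..} \<alpha> \<and> \<alpha> ` {0..} \<subseteq> mspace X \<and> \<beta> ` {0..} \<subseteq> mspace Y \<and>
    fellow e D \<alpha> \<beta> \<longrightarrow> morse_with Y N' {0..} \<beta>"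
proof -
  define good where "good K L M \<longleftrightarrow> 0 \<le> M \<and> (\<forall>\<alpha> \<beta>. morse_with X N {0..} \<alpha> \<and> \<alpha> ` {0..} \<subseteq> mspace X \<and>
    \<beta> ` {0..} \<subseteq> mspace Y \<and> fellow e D \<alpha> \<beta> \<longrightarrow>
    (\<forall>a b \<sigma>. a \<le> b \<and> quasi_geodesic Y K L {a..b} \<sigma> \<and> \<sigma> a \<in> \<beta> ` {0..} \<and> \<sigma> b \<in> \<beta> ` {0..} \<longrightarrow>
      (\<forall>t\<in>{a..b}. \<exists>s\<in>{0..}. mdist Y (\<sigma> t) (\<beta> s) \<le> M)))" for K L M
  have "\<exists>M. good K L M" if KL: "1 \<le> K" "0 < L" for K L
  proof -
    obtain E where E: "0 \<le> E" and pull: "\<And>\<alpha> \<sigma> a b. morse_with X N {0..} \<alpha> \<Longrightarrow> \<alpha> ` {0..} \<subseteq> mspace X \<Longrightarrow> a \<le> b \<Longrightarrow>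
      quasi_geodesic Y K L {a..b} \<sigma> \<Longrightarrow> \<exists>u\<ge>0. e (\<alpha> u) (\<sigma> a) \<le> D \<Longrightarrow> \<exists>u\<ge>0. e (\<alpha> u) (\<sigma> b) \<le> D \<Longrightarrow>
      \<forall>t\<in>{a..b}. \<exists>u\<ge>0. e (\<alpha> u) (\<sigma> t) \<le> E"
      using morse_pull[OF N KL(1) _ D, of L] KL(2) by (metis less_imp_le)
    have "good K L (k * E + k * D + k)"
      unfolding good_def
    proof (intro conjI allI impI ballI, goal_cases)
      case 1 then show ?case using k1 E D by simp
    next
      case (2 \<alpha> \<beta> a b \<sigma> t)
      then have \<alpha>: "morse_with X N {0..} \<alpha>" "\<alpha> ` {0..} \<subseteq> mspace X" and \<beta>: "\<beta> ` {0..} \<subseteq> mspace Y" and f: "fellow e D \<alpha> \<beta>"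
        and \<sigma>: "a \<le> b" "quasi_geodesic Y K L {a..b} \<sigma>" "\<sigma> a \<in> \<beta> ` {0..}" "\<sigma> b \<in> \<beta> ` {0..}" "t \<in> {a..b}" by auto
      have "\<exists>u\<ge>0. e (\<alpha> u) z \<le> D" if "z \<in> \<beta> ` {0..}" for z using f that by (auto simp: fellow_def)
      then obtain u where u: "0 \<le> u" "e (\<alpha> u) (\<sigma> t) \<le> E" using pull[OF \<alpha> \<sigma>(1,2)] \<sigma>(3-5) by meson
      then obtain s where s: "0 \<le> s" "e (\<alpha> u) (\<beta> s) \<le> D" using f by (auto simp: fellow_def)
      have aX: "\<alpha> u \<in> mspace X" using \<alpha>(2) u(1) by auto
      have "mdist Y (\<sigma> t) (\<beta> s) \<le> k * mdist X (\<alpha> u) (\<alpha> u) + k * e (\<alpha> u) (\<sigma> t) + k * e (\<alpha> u) (\<beta> s) + k"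
        using aX \<beta> s(1) quasi_geodesicD(1)[OF \<sigma>(2,5,5)] by (intro e_Y) auto
      also have "mdist X (\<alpha> u) (\<alpha> u) = 0" using aX by simp
      also have "k * 0 + k * e (\<alpha> u) (\<sigma> t) + k * e (\<alpha> u) (\<beta> s) + k \<le> k * E + k * D + k"
        using mult_left_mono[OF u(2), of k] mult_left_mono[OF s(2), of k] k1 by linarith
      finally show ?case using s(1) by auto
    qed
    then show ?thesis by blast
  qed
  then have "\<forall>K L. \<exists>M. 1 \<le> K \<and> 0 < L \<longrightarrow> good K L M" by blast
  then obtain f where f: "\<And>K L. 1 \<le> K \<Longrightarrow> 0 < L \<Longrightarrow> good K L (f K L)" by metis
  \<comment> \<open>A gauge must also be nonnegative at \<open>L = 0\<close>, where
    \<open>morse_with\<close> gives no value; 0 is the default.\<close>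
  define N' where "N' K L = (if 1 \<le> K \<and> 0 < L then f K L else 0)" for K L
  have "N' \<in> morse_gauges" using f by (auto simp: N'_def morse_gauges_def good_def)
  moreover have "morse_with Y N' {0..} \<beta>" if "morse_with X N {0..} \<alpha> \<and> \<alpha> ` {0..} \<subseteq> mspace X \<and>
    \<beta> ` {0..} \<subseteq> mspace Y \<and> fellow e D \<alpha> \<beta>" for \<alpha> \<beta>
    unfolding morse_with_def
  proof (intro allI impI)
    fix K L :: real and a b \<sigma> assume KL: "1 \<le> K" "0 < L"
      and \<sigma>: "a \<le> b \<and> quasi_geodesic Y K L {a..b} \<sigma> \<and> \<sigma> a \<in> \<beta> ` {0..} \<and> \<sigma> b \<in> \<beta> ` {0..}"
    show "\<forall>t\<in>{a..b}. \<exists>s\<in>{0..}. mdist Y (\<sigma> t) (\<beta> s) \<le> N' K L"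
    proof -
      have "N' K L = f K L" using KL by (simp add: N'_def)
      then show ?thesis using f[OF KL] that \<sigma> unfolding good_def by metis
    qed
  qed
  ultimately show ?thesis by blast
qed

text \<open>Following \<open>\<beta>\<close>, the partners move along \<open>\<alpha>\<close> from the origin to infinity in bounded steps, so they come close to
  every point of \<open>\<alpha>\<close>.\<close>

lemma half_fellow:
  assumes \<alpha>: "geodesic X {0..} \<alpha>" "\<alpha> 0 = p" and \<beta>: "geodesic Y {0..} \<beta>" "\<beta> 0 = q" and D: "k \<le> D"
    and half: "\<And>s. 0 \<le> s \<Longrightarrow> \<exists>t\<ge>0. e (\<alpha> t) (\<beta> s) \<le> D"
  shows "fellow e (D + k * (3 * k + 2 * k * D) + k) \<alpha> \<beta>"
proof -
  let ?J = "3 * k + 2 * k * D"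
  have kD: "0 \<le> k * D" "0 \<le> k * ?J" using k1 D by auto
  have aX: "\<alpha> t \<in> mspace X" "\<beta> t \<in> mspace Y" if "0 \<le> t" for t
    using geodesicD(1)[OF \<alpha>(1), of t t] geodesicD(1)[OF \<beta>(1), of t t] that by auto
  have "\<exists>s\<ge>0. e (\<alpha> u) (\<beta> s) \<le> D + k * ?J + k" if u: "0 \<le> u" for u
  proof -
    \<comment> \<open>The times \<open>s\<close> with a partner of \<open>\<beta> s\<close> on
      \<open>\<alpha>\<close> up to \<open>u\<close>. Just after the supremum the partner has passed
      \<open>\<alpha> u\<close>, and since steps are bounded it was close to
      \<open>\<alpha> u\<close> just before.\<close>
    define A where "A = {s. 0 \<le> s \<and> (\<exists>t. 0 \<le> t \<and> t \<le> u \<and> e (\<alpha> t) (\<beta> s) \<le> D)}"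
    have 0: "0 \<in> A" using u \<alpha> \<beta> e_base D by (auto simp: A_def intro!: exI[of _ 0])
    have "s \<le> k * u + k * k + k * D + k" if sA: "s \<in> A" for s
    proof -
      obtain t where t: "0 \<le> s" "0 \<le> t" "t \<le> u" "e (\<alpha> t) (\<beta> s) \<le> D" using sA by (auto simp: A_def)
      have "mdist Y q (\<beta> s) \<le> k * mdist X p (\<alpha> t) + k * e p q + k * e (\<alpha> t) (\<beta> s) + k"
        using aX t GX.base_point GY.base_point by (intro e_Y) auto
      moreover have "mdist Y q (\<beta> s) = s" using geodesicD(2)[OF \<beta>(1), of 0 s] \<beta>(2) t by simp
      moreover have "mdist X p (\<alpha> t) \<le> u" using geodesicD(2)[OF \<alpha>(1), of 0 t] \<alpha>(2) t by simp
      ultimately have "s \<le> k * mdist X p (\<alpha> t) + k * e p q + k * e (\<alpha> t) (\<beta> s) + k" "mdist X p (\<alpha> t) \<le> u" by simp_all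
      moreover from this have "k * mdist X p (\<alpha> t) \<le> k * u" "k * e p q \<le> k * k" "k * e (\<alpha> t) (\<beta> s) \<le> k * D"
        using t e_base k1 by (auto intro!: mult_left_mono)
      ultimately show ?thesis by linarith
    qed
    then have bdd: "bdd_above A" by (rule bdd_aboveI)
    obtain s1 where s1: "s1 \<in> A" "Sup A - 1 < s1" using less_cSup_iff[OF _ bdd, of "Sup A - 1"] 0 by auto
    obtain u1 where u1: "0 \<le> s1" "0 \<le> u1" "u1 \<le> u" "e (\<alpha> u1) (\<beta> s1) \<le> D" using s1 by (auto simp: A_def)
    define s2 where "s2 = s1 + 1"
    have s2: "0 \<le> s2" "s2 \<notin> A" using s1 u1 cSup_upper[OF _ bdd, of s2] by (auto simp: s2_def)
    obtain u2 where u2: "0 \<le> u2" "e (\<alpha> u2) (\<beta> s2) \<le> D" using half[OF s2(1)] by blast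
    then have "u < u2" using s2 unfolding A_def by force
    have d1: "mdist Y (\<beta> s1) (\<beta> s2) = 1" using geodesicD(2)[OF \<beta>(1), of s1 s2] u1 s2 by (simp add: s2_def)
    have "mdist X (\<alpha> u1) (\<alpha> u2) \<le> k * mdist Y (\<beta> s1) (\<beta> s2) + k * e (\<alpha> u1) (\<beta> s1) + k * e (\<alpha> u2) (\<beta> s2) + k"
      using aX u1 u2 s2 by (intro e_X) auto
    then have "mdist X (\<alpha> u1) (\<alpha> u2) \<le> k + k * e (\<alpha> u1) (\<beta> s1) + k * e (\<alpha> u2) (\<beta> s2) + k"
      unfolding d1 by simp
    moreover have "k * e (\<alpha> u1) (\<beta> s1) \<le> k * D" "k * e (\<alpha> u2) (\<beta> s2) \<le> k * D"
      using u1 u2 k1 by (auto intro!: mult_left_mono)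
    moreover have "mdist X (\<alpha> u1) (\<alpha> u2) = u2 - u1" using geodesicD(2)[OF \<alpha>(1), of u1 u2] u1 u2 \<open>u < u2\<close> by simp
    ultimately have "u2 - u1 \<le> ?J" using k1 by linarith
    moreover have "mdist X (\<alpha> u1) (\<alpha> u) = u - u1" using geodesicD(2)[OF \<alpha>(1), of u1 u] u1 u by simp
    ultimately have "k * mdist X (\<alpha> u1) (\<alpha> u) \<le> k * ?J" using \<open>u < u2\<close> k1 by (intro mult_left_mono) auto
    moreover have "e (\<alpha> u) (\<beta> s1) \<le> e (\<alpha> u1) (\<beta> s1) + k * mdist X (\<alpha> u1) (\<alpha> u) + k"
      using aX u1 u by (intro e_left) auto
    ultimately show ?thesis using u1 by (intro exI[of _ s1]) auto
  qed
  moreover have "\<exists>t\<ge>0. e (\<alpha> t) (\<beta> s) \<le> D + k * ?J + k" if "0 \<le> s" for s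
  proof -
    have "D \<le> D + k * ?J + k" using kD k1 by linarith
    then show ?thesis using half[OF that] by (meson order_trans)
  qed
  ultimately show ?thesis by (auto simp: fellow_def)
qed

text \<open>Geodesics from \<open>q\<close> to partners of the points \<open>\<alpha> n\<close> stay
  uniformly close to \<open>\<alpha>\<close> by \<open>morse_pull\<close>. Their lengths tend to
  infinity, so a limit of them is a ray.\<close>

lemma exists_fellow_ray:
  assumes N: "N \<in> morse_gauges" and C: "0 \<le> C"
  shows "\<exists>D\<ge>0. \<forall>\<alpha>. geodesic X {0..} \<alpha> \<and> \<alpha> 0 = p \<and> morse_with X N {0..} \<alpha> \<and> (\<forall>t\<ge>0. \<exists>y\<in>mspace Y. e (\<alpha> t) y \<le> C) \<longrightarrow>
    (\<exists>\<beta>. geodesic Y {0..} \<beta> \<and> \<beta> 0 = q \<and> fellow e D \<alpha> \<beta>)"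
proof -
  let ?C = "C + 2 * k"
  have C0: "0 \<le> ?C" "k \<le> ?C" using C k1 by auto
  obtain E where E: "0 \<le> E" and pull: "\<And>\<alpha> \<sigma> a b. morse_with X N {0..} \<alpha> \<Longrightarrow> \<alpha> ` {0..} \<subseteq> mspace X \<Longrightarrow> a \<le> b \<Longrightarrow>
    geodesic Y {a..b} \<sigma> \<Longrightarrow> \<exists>u\<ge>0. e (\<alpha> u) (\<sigma> a) \<le> ?C \<Longrightarrow> \<exists>u\<ge>0. e (\<alpha> u) (\<sigma> b) \<le> ?C \<Longrightarrow>
    \<forall>t\<in>{a..b}. \<exists>u\<ge>0. e (\<alpha> u) (\<sigma> t) \<le> E"
    using morse_pull[OF N _ _ C0(1), of 1 0] by (metis order_refl)
  let ?E = "E + 2 * k"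
  have E2: "k \<le> ?E" using E k1 by simp
  let ?D = "?E + k * (3 * k + 2 * k * ?E) + k"
  have "\<exists>\<beta>. geodesic Y {0..} \<beta> \<and> \<beta> 0 = q \<and> fellow e ?D \<alpha> \<beta>"
    if \<alpha>: "geodesic X {0..} \<alpha>" "\<alpha> 0 = p" "morse_with X N {0..} \<alpha>" and part: "\<And>t. 0 \<le> t \<Longrightarrow> \<exists>y\<in>mspace Y. e (\<alpha> t) y \<le> C" for \<alpha>
  proof -
    have aX: "\<alpha> t \<in> mspace X" if "0 \<le> t" for t using geodesicD(1)[OF \<alpha>(1), of t t] that by auto
    \<comment> \<open>Geodesics are available between points of \<open>W\<close>, and a partner in
      \<open>W\<close> costs an additional \<open>2 * k\<close>.\<close>
    have "\<exists>w\<in>W. e (\<alpha> (real n)) w \<le> ?C" for n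
    proof -
      obtain y where y: "y \<in> mspace Y" "e (\<alpha> (real n)) y \<le> C" using part[of "real n"] by auto
      obtain w where w: "w \<in> W" "mdist Y y w \<le> 1" using GY.dense[OF y(1)] by blast
      have "e (\<alpha> (real n)) w \<le> e (\<alpha> (real n)) y + k * mdist Y y w + k"
        using aX y w GY.V by (intro e_right) auto
      moreover have "k * mdist Y y w \<le> k * 1" using w(2) k1 by (intro mult_left_mono) auto
      ultimately have "e (\<alpha> (real n)) w \<le> ?C" using y(2) by linarith
      then show ?thesis using w(1) by blast
    qed
    then obtain w where w: "\<And>n. w n \<in> W" "\<And>n. e (\<alpha> (real n)) (w n) \<le> ?C" by metis
    define l where "l n = mdist Y q (w n)" for n
    have l0: "0 \<le> l n" for n by (simp add: l_def)
    obtain \<eta> where \<eta>: "\<And>n. geodesic Y {0..l n} (\<eta> n)" "\<And>n. \<eta> n 0 = q" "\<And>n. \<eta> n (l n) = w n"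
      using GY.geodesics[OF GY.base w(1)] unfolding l_def by metis
    have ln: "real n \<le> k * l n + (k * k + k * ?C + k)" for n
    proof -
      have "mdist X p (\<alpha> n) \<le> k * mdist Y q (w n) + k * e p q + k * e (\<alpha> n) (w n) + k"
        using aX w GY.V GX.base_point GY.base_point by (intro e_X) auto
      moreover have "mdist X p (\<alpha> n) = n" using geodesicD(2)[OF \<alpha>(1), of 0 n] \<alpha>(2) by simp
      moreover have "k * e p q \<le> k * k" "k * e (\<alpha> n) (w n) \<le> k * ?C"
        using w e_base k1 by (auto intro!: mult_left_mono)
      ultimately show ?thesis by (simp add: l_def)
    qed
    have lT: "\<forall>\<^sub>F n in sequentially. T \<le> l n" for T
    proof -
      obtain m :: nat where m: "k * T + (k * k + k * ?C + k) < m" using reals_Archimedean2 by blast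
      have "T \<le> l n" if "m \<le> n" for n
      proof -
        have "real m \<le> real n" using that by simp
        then have "k * T \<le> k * l n" using m ln[of n] by linarith
        then show ?thesis using k1 by simp
      qed
      then show ?thesis by (auto simp: eventually_sequentially)
    qed
    \<comment> \<open>The segments are continued as constants, which gives 1-Lipschitz maps on the
      whole half-line.\<close>
    define f where "f n t = \<eta> n (max 0 (min t (l n)))" for n t
    have fm: "max 0 (min t (l n)) \<in> {0..l n}" for t n using l0 by auto
    have fX: "f n t \<in> mspace Y" for n t unfolding f_def using geodesicD(1)[OF \<eta>(1) fm fm] .
    have fd: "mdist Y (f n s) (f n t) = \<bar>max 0 (min s (l n)) - max 0 (min t (l n))\<bar>" for n s t
      unfolding f_def by (rule geodesicD(2)[OF \<eta>(1) fm fm])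
    have f0: "f n 0 = q" for n using \<eta>(2) l0[of n] by (simp add: f_def)
    obtain r \<beta> where r: "strict_mono r" and \<beta>m: "\<forall>t\<ge>0. \<beta> t \<in> mspace Y" and conv: "converges_uniformly_on_compacts Y (f \<circ> r) \<beta>"
      using GY.arzela_ascoli_lipschitz[of f] fX fd f0 by (smt (verit) max_def min_def)
    have \<beta>: "geodesic Y {0..} \<beta>" "\<beta> 0 = q"
    proof -
      have "\<forall>\<^sub>F n in sequentially. \<forall>s\<in>{0..T}. \<forall>t\<in>{0..T}. mdist Y ((f \<circ> r) n s) ((f \<circ> r) n t) = \<bar>s - t\<bar>" for T
        using eventually_subseq[OF r lT[of T]] by eventually_elim (auto simp: fd)
      from GY.limit_geodesic[OF _ _ this _ conv] show "geodesic Y {0..} \<beta>" "\<beta> 0 = q"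
        using fX f0 \<beta>m by auto
    qed
    have "\<exists>t\<ge>0. e (\<alpha> t) (\<beta> s) \<le> ?E" if s: "0 \<le> s" for s
    proof -
      have "\<forall>\<^sub>F n in sequentially. mdist Y ((f \<circ> r) n s) (\<beta> s) < 1"
        using order_tendstoD(2)[OF GY.uniform_imp_pointwise[OF conv s], of 1] by simp
      then have "\<forall>\<^sub>F n in sequentially. mdist Y ((f \<circ> r) n s) (\<beta> s) < 1 \<and> s \<le> l (r n)"
        using eventually_subseq[OF r lT[of s]] by eventually_elim simp
      then obtain n where n: "mdist Y (f (r n) s) (\<beta> s) < 1" "s \<le> l (r n)"
        by (auto simp: eventually_sequentially)
      have fs: "f (r n) s = \<eta> (r n) s" using n(2) s by (simp add: f_def)
      have "\<alpha> ` {0..} \<subseteq> mspace X" using aX by auto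
      moreover have "\<exists>u\<ge>0. e (\<alpha> u) (\<eta> (r n) 0) \<le> ?C" using \<alpha>(2) \<eta>(2) e_base C0 by (intro exI[of _ 0]) auto
      moreover have "\<exists>u\<ge>0. e (\<alpha> u) (\<eta> (r n) (l (r n))) \<le> ?C" using w(2)[of "r n"] \<eta>(3)[of "r n"] by (intro exI[of _ "real (r n)"]) auto
      ultimately obtain u where u: "0 \<le> u" "e (\<alpha> u) (\<eta> (r n) s) \<le> E"
        using pull[OF \<alpha>(3) _ l0 \<eta>(1)] n(2) s by (meson atLeastAtMost_iff)
      have "e (\<alpha> u) (\<beta> s) \<le> e (\<alpha> u) (f (r n) s) + k * mdist Y (f (r n) s) (\<beta> s) + k"
        using aX u fX \<beta>m s by (intro e_right) auto
      moreover have "k * mdist Y (f (r n) s) (\<beta> s) \<le> k * 1" using n(1) k1 by (intro mult_left_mono) auto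
      moreover have "e (\<alpha> u) (f (r n) s) \<le> E" using u(2) fs by simp
      ultimately have "e (\<alpha> u) (\<beta> s) \<le> ?E" by linarith
      then show ?thesis using u(1) by blast
    qed
    from half_fellow[OF \<alpha>(1,2) \<beta> E2 this] show ?thesis using \<beta> by blast
  qed
  moreover have "0 \<le> ?D" using k1 E by simp
  ultimately show ?thesis by blast
qed

text \<open>The constant \<open>D'\<close> belongs to one pair of rays and has to be replaced by a
  uniform one. If every point of \<open>X\<close> has a partner, there is a uniformly fellow ray
  \<open>\<beta>'\<close>; it is Morse, so \<open>\<beta>\<close> is uniformly close to it. If every
  point of \<open>Y\<close> has a partner, the partners of \<open>\<beta>\<close> form a
  quasi-geodesic of \<open>X\<close>, which is uniformly close to \<open>\<alpha>\<close>. In both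
  cases \<open>D'\<close> enters only as the unspecified finite distance in
  \<open>quasi_geodesic_near_morse\<close>.\<close>

lemma uniform_fellow:
  assumes N: "N \<in> morse_gauges"
  shows "\<exists>D\<ge>0. \<exists>N'\<in>morse_gauges. \<forall>\<alpha> \<beta> D'. geodesic X {0..} \<alpha> \<and> \<alpha> 0 = p \<and> morse_with X N {0..} \<alpha> \<and>
    geodesic Y {0..} \<beta> \<and> \<beta> 0 = q \<and> fellow e D' \<alpha> \<beta> \<longrightarrow> fellow e D \<alpha> \<beta> \<and> morse_with Y N' {0..} \<beta>"
proof -
  have "\<exists>E. \<forall>\<alpha> \<beta> D'. geodesic X {0..} \<alpha> \<and> \<alpha> 0 = p \<and> morse_with X N {0..} \<alpha> \<and>
    geodesic Y {0..} \<beta> \<and> \<beta> 0 = q \<and> fellow e D' \<alpha> \<beta> \<longrightarrow> (\<forall>s\<ge>0. \<exists>t\<ge>0. e (\<alpha> t) (\<beta> s) \<le> E)"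
    using total
  proof
    assume tot: "\<forall>x\<in>mspace X. \<exists>y\<in>mspace Y. e x y \<le> k"
    have k0: "0 \<le> k" using k1 by simp
    obtain D1 where D1: "0 \<le> D1" and ex: "\<And>\<alpha>. geodesic X {0..} \<alpha> \<Longrightarrow> \<alpha> 0 = p \<Longrightarrow> morse_with X N {0..} \<alpha> \<Longrightarrow>
        (\<forall>t\<ge>0. \<exists>y\<in>mspace Y. e (\<alpha> t) y \<le> k) \<Longrightarrow> \<exists>\<beta>. geodesic Y {0..} \<beta> \<and> \<beta> 0 = q \<and> fellow e D1 \<alpha> \<beta>"
      using exists_fellow_ray[OF N k0] by metis
    obtain N1 where N1: "\<And>\<alpha> \<beta>. morse_with X N {0..} \<alpha> \<Longrightarrow> \<alpha> ` {0..} \<subseteq> mspace X \<Longrightarrow> \<beta> ` {0..} \<subseteq> mspace Y \<Longrightarrow>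
        fellow e D1 \<alpha> \<beta> \<Longrightarrow> morse_with Y N1 {0..} \<beta>"
      using morse_transfer[OF N D1] by metis
    let ?M = "N1 (3 * 1) (0 + 6)"
    show ?thesis
    proof (rule exI[of _ "D1 + k * ?M + k"], intro allI impI, goal_cases)
      case (1 \<alpha> \<beta> D' s)
      then have \<alpha>: "geodesic X {0..} \<alpha>" "\<alpha> 0 = p" "morse_with X N {0..} \<alpha>" and \<beta>: "geodesic Y {0..} \<beta>" "\<beta> 0 = q"
        and f: "fellow e D' \<alpha> \<beta>" and s: "0 \<le> s" by auto
      have mem: "\<alpha> t \<in> mspace X" "\<beta> t \<in> mspace Y" if "0 \<le> t" for t
        using geodesicD(1)[OF \<alpha>(1), of t t] geodesicD(1)[OF \<beta>(1), of t t] that by auto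
      obtain \<beta>' where \<beta>': "geodesic Y {0..} \<beta>'" "\<beta>' 0 = q" "fellow e D1 \<alpha> \<beta>'" using ex[OF \<alpha>] tot mem by blast
      have mem': "\<beta>' t \<in> mspace Y" if "0 \<le> t" for t using geodesicD(1)[OF \<beta>'(1), of t t] that by auto
      have mor: "morse_with Y N1 {0..} \<beta>'" using mem mem' by (intro N1[OF \<alpha>(3) _ _ \<beta>'(3)]) auto
      have close: "\<exists>s\<ge>0. mdist Y (\<beta> t) (\<beta>' s) \<le> k * D' + k * D1 + k" if t: "0 \<le> t" for t
      proof -
        obtain u where u: "0 \<le> u" "e (\<alpha> u) (\<beta> t) \<le> D'" using f t by (auto simp: fellow_def)
        obtain v where v: "0 \<le> v" "e (\<alpha> u) (\<beta>' v) \<le> D1" using \<beta>'(3) u(1) by (auto simp: fellow_def)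
        have "mdist Y (\<beta> t) (\<beta>' v) \<le> k * mdist X (\<alpha> u) (\<alpha> u) + k * e (\<alpha> u) (\<beta> t) + k * e (\<alpha> u) (\<beta>' v) + k"
          using mem mem' u v t by (intro e_Y) auto
        moreover have "mdist X (\<alpha> u) (\<alpha> u) = 0" using mem[OF u(1)] by simp
        ultimately show ?thesis using v(1) mult_left_mono[OF u(2) k0] mult_left_mono[OF v(2) k0]
          by (intro exI[of _ v]) auto
      qed
      obtain v where v: "0 \<le> v" "mdist Y (\<beta> s) (\<beta>' v) \<le> ?M"
        using GY.quasi_geodesic_near_morse[OF mor _ \<beta>'(2) \<beta>(1,2) _ _ close s] mem' by auto
      obtain u where u: "0 \<le> u" "e (\<alpha> u) (\<beta>' v) \<le> D1" using \<beta>'(3) v(1) by (auto simp: fellow_def)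
      have "e (\<alpha> u) (\<beta> s) \<le> e (\<alpha> u) (\<beta>' v) + k * mdist Y (\<beta>' v) (\<beta> s) + k"
        using mem mem' u v s by (intro e_right) auto
      then show ?case using u mult_left_mono[OF v(2) k0] mdist_commute[of Y "\<beta>' v" "\<beta> s"] by (intro exI[of _ u]) auto
    qed
  next
    assume tot: "\<forall>y\<in>mspace Y. \<exists>x\<in>mspace X. e x y \<le> k"
    have k0: "0 \<le> k" using k1 by simp
    let ?K = "k * 1" and ?L = "k * 0 + 2 * k * k + k"
    let ?M = "N (3 * ?K) (?L + 6)"
    show ?thesis
    proof (rule exI[of _ "k + k * ?M + k"], intro allI impI, goal_cases)
      case (1 \<alpha> \<beta> D' s)
      then have \<alpha>: "geodesic X {0..} \<alpha>" "\<alpha> 0 = p" "morse_with X N {0..} \<alpha>" and \<beta>: "geodesic Y {0..} \<beta>" "\<beta> 0 = q"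
        and f: "fellow e D' \<alpha> \<beta>" and s: "0 \<le> s" by auto
      have mem: "\<alpha> t \<in> mspace X" "\<beta> t \<in> mspace Y" if "0 \<le> t" for t
        using geodesicD(1)[OF \<alpha>(1), of t t] geodesicD(1)[OF \<beta>(1), of t t] that by auto
      obtain \<tau>0 where \<tau>0: "\<And>t. 0 \<le> t \<Longrightarrow> \<tau>0 t \<in> mspace X \<and> e (\<tau>0 t) (\<beta> t) \<le> k"
      proof -
        have "\<forall>t. \<exists>x. 0 \<le> t \<longrightarrow> x \<in> mspace X \<and> e x (\<beta> t) \<le> k" using tot mem(2) by blast
        then show ?thesis using that by metis
      qed
      \<comment> \<open>The quasi-geodesic must start at the origin of \<open>\<alpha>\<close>;
        \<open>p\<close> is an admissible partner of \<open>\<beta> 0\<close> by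
        \<open>e_base\<close>.\<close>
      define \<tau> where "\<tau> t = (if t = 0 then p else \<tau>0 t)" for t
      have \<tau>: "\<tau> t \<in> mspace X \<and> e (\<tau> t) (\<beta> t) \<le> k" if "t \<in> {0..}" for t
        using \<tau>0[of t] that GX.base_point e_base \<beta>(2) by (auto simp: \<tau>_def)
      have \<tau>q: "quasi_geodesic X ?K ?L {0..} \<tau>"
        by (rule partner_quasi_geodesic[OF \<beta>(1) _ _ k0 \<tau>]) auto
      have close: "\<exists>u\<ge>0. mdist X (\<tau> t) (\<alpha> u) \<le> k * k + k * D' + k" if t: "0 \<le> t" for t
      proof -
        obtain u where u: "0 \<le> u" "e (\<alpha> u) (\<beta> t) \<le> D'" using f t by (auto simp: fellow_def)
        have "mdist X (\<tau> t) (\<alpha> u) \<le> k * mdist Y (\<beta> t) (\<beta> t) + k * e (\<tau> t) (\<beta> t) + k * e (\<alpha> u) (\<beta> t) + k"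
          using mem \<tau>[of t] u t by (intro e_X) auto
        moreover have "mdist Y (\<beta> t) (\<beta> t) = 0" using mem[OF t] by simp
        moreover have "e (\<tau> t) (\<beta> t) \<le> k" using \<tau>[of t] t by simp
        ultimately show ?thesis using u(1) mult_left_mono[OF u(2) k0] mult_left_mono[of "e (\<tau> t) (\<beta> t)" k, OF _ k0]
          by (intro exI[of _ u]) auto
      qed
      have "\<alpha> ` {0..} \<subseteq> mspace X" "\<tau> 0 = p" "1 \<le> ?K" "0 \<le> ?L" using mem k1 by (auto simp: \<tau>_def)
      from GX.quasi_geodesic_near_morse[OF \<alpha>(3) this(1) \<alpha>(2) \<tau>q this(2-4) close s]
      obtain u where u: "0 \<le> u" "mdist X (\<tau> s) (\<alpha> u) \<le> ?M" by blast
      have "e (\<alpha> u) (\<beta> s) \<le> e (\<tau> s) (\<beta> s) + k * mdist X (\<tau> s) (\<alpha> u) + k"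
        using mem u s \<tau>[of s] by (intro e_left) auto
      then show ?case using u mult_left_mono[OF u(2) k0] \<tau>[of s] s by (intro exI[of _ u]) auto
    qed
  qed
  then obtain E where E: "\<And>\<alpha> \<beta> D' s. geodesic X {0..} \<alpha> \<Longrightarrow> \<alpha> 0 = p \<Longrightarrow> morse_with X N {0..} \<alpha> \<Longrightarrow>
    geodesic Y {0..} \<beta> \<Longrightarrow> \<beta> 0 = q \<Longrightarrow> fellow e D' \<alpha> \<beta> \<Longrightarrow> 0 \<le> s \<Longrightarrow> \<exists>t\<ge>0. e (\<alpha> t) (\<beta> s) \<le> E" by metis
  let ?E = "max E k"
  let ?D = "?E + k * (3 * k + 2 * k * ?E) + k"
  have "0 \<le> ?E" using k1 by simp
  then have D: "0 \<le> ?D" using k1 by simp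
  obtain N' where N': "N' \<in> morse_gauges" "\<And>\<alpha> \<beta>. morse_with X N {0..} \<alpha> \<Longrightarrow> \<alpha> ` {0..} \<subseteq> mspace X \<Longrightarrow> \<beta> ` {0..} \<subseteq> mspace Y \<Longrightarrow>
        fellow e ?D \<alpha> \<beta> \<Longrightarrow> morse_with Y N' {0..} \<beta>"
    using morse_transfer[OF N D] by metis
  show ?thesis
  proof (intro exI[of _ ?D] conjI D bexI[of _ N'] N'(1) allI impI)
    fix \<alpha> \<beta> D' assume a: "geodesic X {0..} \<alpha> \<and> \<alpha> 0 = p \<and> morse_with X N {0..} \<alpha> \<and>
      geodesic Y {0..} \<beta> \<and> \<beta> 0 = q \<and> fellow e D' \<alpha> \<beta>"
    have "\<exists>t\<ge>0. e (\<alpha> t) (\<beta> s) \<le> ?E" if "0 \<le> s" for s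
      using E[of \<alpha> \<beta> D' s] a that by (meson max.coboundedI1)
    then show f: "fellow e ?D \<alpha> \<beta>" using a by (intro half_fellow) auto
    show "morse_with Y N' {0..} \<beta>"
      by (rule N'(2)[OF _ _ _ f]) (use a in \<open>auto simp: quasi_geodesic_def\<close>)
  qed
qed

end

section \<open>Maps between Morse boundaries\<close>

lemma morse_rays_mem: "\<alpha> \<in> morse_rays X p \<Longrightarrow> 0 \<le> t \<Longrightarrow> \<alpha> t \<in> mspace X"
  by (auto simp: morse_rays_def quasi_geodesic_def)

lemma morse_raysD:
  assumes "\<alpha> \<in> morse_rays X p" shows "geodesic X {0..} \<alpha>" "\<alpha> 0 = p" "\<exists>N\<in>morse_gauges. morse_with X N {0..} \<alpha>"
  using assms by (auto simp: morse_rays_def)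

lemma asymptoticI:
  assumes "\<alpha> \<in> morse_rays X p" "\<beta> \<in> morse_rays X p" "\<And>t. 0 \<le> t \<Longrightarrow> mdist X (\<alpha> t) (\<beta> t) \<le> K"
  shows "(\<alpha>, \<beta>) \<in> asymptotic X p"
proof -
  have "mdist X (\<alpha> t) (\<beta> t) < K + 1" if "0 < t" for t using assms(3)[of t] that by simp
  then show ?thesis using assms by (auto simp: asymptotic_def)
qed

text \<open>The definition bounds the distance at positive times; at time 0 both rays are at the
  base point.\<close>

lemma asymptoticD:
  assumes "(\<alpha>, \<beta>) \<in> asymptotic X p"
  shows "\<alpha> \<in> morse_rays X p" "\<beta> \<in> morse_rays X p" "\<exists>K. \<forall>t\<ge>0. mdist X (\<alpha> t) (\<beta> t) \<le> K"
proof -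
  show r: "\<alpha> \<in> morse_rays X p" "\<beta> \<in> morse_rays X p" using assms by (auto simp: asymptotic_def)
  obtain K where K: "\<And>t. 0 < t \<Longrightarrow> mdist X (\<alpha> t) (\<beta> t) < K" using assms by (auto simp: asymptotic_def)
  have "\<alpha> 0 = \<beta> 0" "\<beta> 0 \<in> mspace X" using r morse_rays_mem[of _ X p 0] by (auto simp: morse_rays_def)
  then have "mdist X (\<alpha> 0) (\<beta> 0) = 0" by simp
  then have "mdist X (\<alpha> t) (\<beta> t) \<le> max 0 K" if "0 \<le> t" for t
    using K[of t] that by (cases "t = 0") auto
  then show "\<exists>K. \<forall>t\<ge>0. mdist X (\<alpha> t) (\<beta> t) \<le> K" by blast
qed

lemma equiv_asymptotic: "equiv (morse_rays X p) (asymptotic X p)"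
proof (rule equivI)
  show "asymptotic X p \<subseteq> morse_rays X p \<times> morse_rays X p" by (auto simp: asymptotic_def)
  show "refl_on (morse_rays X p) (asymptotic X p)"
  proof (rule refl_onI)
    fix \<alpha> assume a: "\<alpha> \<in> morse_rays X p"
    have "mdist X (\<alpha> t) (\<alpha> t) \<le> 0" if "0 \<le> t" for t using morse_rays_mem[OF a that] by (metis mdist_zero order_refl)
    then show "(\<alpha>, \<alpha>) \<in> asymptotic X p" by (rule asymptoticI[OF a a])
  qed
  show "sym (asymptotic X p)" by (auto simp: sym_def asymptotic_def mdist_commute)
  show "trans (asymptotic X p)"
  proof (rule transI)
    fix \<alpha> \<beta> \<gamma> assume 1: "(\<alpha>, \<beta>) \<in> asymptotic X p" and 2: "(\<beta>, \<gamma>) \<in> asymptotic X p"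
    note r = asymptoticD(1,2)[OF 1] asymptoticD(2)[OF 2]
    obtain K K' where K: "\<forall>t\<ge>0. mdist X (\<alpha> t) (\<beta> t) \<le> K" "\<forall>t\<ge>0. mdist X (\<beta> t) (\<gamma> t) \<le> K'"
      using asymptoticD(3)[OF 1] asymptoticD(3)[OF 2] by blast
    have "mdist X (\<alpha> t) (\<gamma> t) \<le> K + K'" if t: "0 \<le> t" for t
    proof -
      have "mdist X (\<alpha> t) (\<gamma> t) \<le> mdist X (\<alpha> t) (\<beta> t) + mdist X (\<beta> t) (\<gamma> t)"
        by (rule mdist_triangle[OF morse_rays_mem[OF r(1) t] morse_rays_mem[OF r(2) t] morse_rays_mem[OF r(3) t]])
      then show ?thesis using K(1)[rule_format, OF t] K(2)[rule_format, OF t] by linarith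
    qed
    then show "(\<alpha>, \<gamma>) \<in> asymptotic X p" by (rule asymptoticI[OF r(1,3)])
  qed
qed

lemma boundary_ray:
  assumes "x \<in> morse_boundary X p" "\<alpha> \<in> x" shows "\<alpha> \<in> morse_rays X p"
  using in_quotient_imp_subset[OF equiv_asymptotic assms(1)[unfolded morse_boundary_def]] assms(2) by blast

lemma boundary_same:
  assumes "x \<in> morse_boundary X p" "\<alpha> \<in> x" "\<beta> \<in> x" shows "(\<alpha>, \<beta>) \<in> asymptotic X p"
  using in_quotient_imp_in_rel[OF equiv_asymptotic assms(1)[unfolded morse_boundary_def]] assms(2,3) by blast

lemma boundary_nonempty: "x \<in> morse_boundary X p \<Longrightarrow> \<exists>\<alpha>. \<alpha> \<in> x"
  using in_quotient_imp_non_empty[OF equiv_asymptotic] unfolding morse_boundary_def by fastforce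

lemma boundary_eqI:
  assumes "x \<in> morse_boundary X p" "y \<in> morse_boundary X p" "\<alpha> \<in> x" "\<beta> \<in> y" "(\<alpha>, \<beta>) \<in> asymptotic X p"
  shows "x = y"
  by (rule quotient_eqI[OF equiv_asymptotic assms(1,2)[unfolded morse_boundary_def] assms(3-5)])

lemma boundary_class:
  assumes "\<alpha> \<in> morse_rays X p"
  shows "asymptotic X p `` {\<alpha>} \<in> morse_boundary X p \<and> \<alpha> \<in> asymptotic X p `` {\<alpha>}"
  using equiv_class_self[OF equiv_asymptotic assms] quotientI[OF assms] unfolding morse_boundary_def by blast

lemma morse_stratumI: "x \<in> morse_boundary X p \<Longrightarrow> \<alpha> \<in> x \<Longrightarrow> morse_with X N {0..} \<alpha> \<Longrightarrow> x \<in> morse_stratum X p N"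
  by (auto simp: morse_stratum_def)

text \<open>In terms of closed sets the direct limit topology is a condition on convergent sequences
  in each stratum, and this is the form in which it can be transferred.\<close>

lemma closedin_morse_boundary_topology:
  "closedin (morse_boundary_topology X p) F \<longleftrightarrow>
    F \<subseteq> morse_boundary X p \<and> (\<forall>N\<in>morse_gauges. stratum_closed X p N (F \<inter> morse_stratum X p N))"
proof -
  have "(morse_boundary X p - F) \<inter> morse_stratum X p N \<subseteq> morse_stratum X p N"
    "morse_stratum X p N - (morse_boundary X p - F) \<inter> morse_stratum X p N = F \<inter> morse_stratum X p N" for N
    by (auto simp: morse_stratum_def)
  then show ?thesis
    by (simp add: closedin_def openin_morse_boundary_topology openin_stratum_topology)
qed

lemma converges_subsequence:
  assumes "converges_uniformly_on_compacts X f g" "strict_mono (r :: nat \<Rightarrow> nat)"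
  shows "converges_uniformly_on_compacts X (f \<circ> r) g"
  unfolding converges_uniformly_on_compacts_def
proof (intro allI impI)
  fix C :: "real set" and \<epsilon> :: real assume C: "compact C \<and> C \<subseteq> {0..}" and e: "0 < \<epsilon>"
  have "\<forall>\<^sub>F n in sequentially. \<forall>t\<in>C. mdist X (f n t) (g t) < \<epsilon>"
    using assms(1)[unfolded converges_uniformly_on_compacts_def, rule_format, OF C e] .
  from eventually_subseq[OF assms(2) this]
  show "\<forall>\<^sub>F n in sequentially. \<forall>t\<in>C. mdist X ((f \<circ> r) n t) (g t) < \<epsilon>" by simp
qed

lemma (in geo_space) rays_subconverge:
  assumes "\<And>n. geodesic X {0..} (f n)" "\<And>n. f n 0 = p"
  shows "\<exists>r g. strict_mono (r :: nat \<Rightarrow> nat) \<and> geodesic X {0..} g \<and> g 0 = p \<and> converges_uniformly_on_compacts X (f \<circ> r) g"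
proof -
  have mem: "f n t \<in> mspace X" if "0 \<le> t" for n t using geodesicD(1)[OF assms(1), of t t] that by simp
  have d: "mdist X (f n s) (f n t) = \<bar>s - t\<bar>" if "0 \<le> s" "0 \<le> t" for n s t
    using geodesicD(2)[OF assms(1), of s t] that by simp
  have lip: "mdist X (f n s) (f n t) \<le> \<bar>s - t\<bar>" if "0 \<le> s" "0 \<le> t" for n s t using d that by simp
  obtain r g where r: "strict_mono r" and g: "\<forall>t\<ge>0. g t \<in> mspace X" and conv: "converges_uniformly_on_compacts X (f \<circ> r) g"
    using arzela_ascoli_lipschitz[of f, OF mem lip assms(2)] by blast
  have "\<forall>\<^sub>F n in sequentially. \<forall>s\<in>{0..T}. \<forall>t\<in>{0..T}. mdist X ((f \<circ> r) n s) ((f \<circ> r) n t) = \<bar>s - t\<bar>" for T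
    using d by (intro always_eventually) auto
  from limit_geodesic[OF _ _ this _ conv] have "geodesic X {0..} g" "g 0 = p" using mem assms(2) g by auto
  then show ?thesis using r conv by blast
qed

section \<open>The relation between the two boundaries\<close>

context coarse_pair
begin

lemma fellow_perturb:
  assumes f: "fellow e D \<alpha> \<beta>" and mem: "\<And>t. 0 \<le> t \<Longrightarrow> \<alpha> t \<in> mspace X \<and> \<alpha>' t \<in> mspace X \<and> \<beta> t \<in> mspace Y \<and> \<beta>' t \<in> mspace Y"
    and K: "\<And>t. 0 \<le> t \<Longrightarrow> mdist X (\<alpha> t) (\<alpha>' t) \<le> K" "\<And>t. 0 \<le> t \<Longrightarrow> mdist Y (\<beta> t) (\<beta>' t) \<le> K'"
  shows "fellow e (D + k * K + k + k * K' + k) \<alpha>' \<beta>'"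
proof -
  have "e (\<alpha>' t) (\<beta>' s) \<le> D + k * K + k + k * K' + k" if st: "0 \<le> s" "0 \<le> t" "e (\<alpha> t) (\<beta> s) \<le> D" for s t
  proof -
    have m: "\<alpha> t \<in> mspace X" "\<alpha>' t \<in> mspace X" "\<beta> s \<in> mspace Y" "\<beta>' s \<in> mspace Y"
      using mem[OF st(1)] mem[OF st(2)] by auto
    have "e (\<alpha>' t) (\<beta>' s) \<le> e (\<alpha>' t) (\<beta> s) + k * mdist Y (\<beta> s) (\<beta>' s) + k"
      "e (\<alpha>' t) (\<beta> s) \<le> e (\<alpha> t) (\<beta> s) + k * mdist X (\<alpha> t) (\<alpha>' t) + k"
      by (rule e_right[OF m(2-4)], rule e_left[OF m(1-3)])
    moreover have "k * mdist Y (\<beta> s) (\<beta>' s) \<le> k * K'" "k * mdist X (\<alpha> t) (\<alpha>' t) \<le> k * K"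
      using K st k1 by (auto intro!: mult_left_mono)
    ultimately show ?thesis using st by linarith
  qed
  note * = this
  show ?thesis unfolding fellow_def
  proof (intro conjI allI impI)
    fix t :: real assume t: "0 \<le> t"
    obtain s where "0 \<le> s" "e (\<alpha> t) (\<beta> s) \<le> D" using f t unfolding fellow_def by blast
    then show "\<exists>s\<ge>0. e (\<alpha>' t) (\<beta>' s) \<le> D + k * K + k + k * K' + k" using *[of s t] t by blast
  next
    fix s :: real assume s: "0 \<le> s"
    obtain t where "0 \<le> t" "e (\<alpha> t) (\<beta> s) \<le> D" using f s unfolding fellow_def by blast
    then show "\<exists>t\<ge>0. e (\<alpha>' t) (\<beta>' s) \<le> D + k * K + k + k * K' + k" using *[of s t] s by blast
  qed
qed

text \<open>A relation in place of a map, since in one of the two directions partners of boundary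
  points need not exist. One pair of representatives is as good as any other, by
  \<open>related_fellow\<close>.\<close>

definition related :: "(real \<Rightarrow> 'a) set \<Rightarrow> (real \<Rightarrow> 'b) set \<Rightarrow> bool" where
  "related x y \<longleftrightarrow> x \<in> morse_boundary X p \<and> y \<in> morse_boundary Y q \<and> (\<exists>\<alpha>\<in>x. \<exists>\<beta>\<in>y. \<exists>D. fellow e D \<alpha> \<beta>)"

lemma related_swap: "coarse_pair.related Y q X p (\<lambda>y x. e x y) y x \<longleftrightarrow> related x y"
  unfolding coarse_pair.related_def[OF swap] related_def fellow_swap[of e] by blast

lemma related_fellow:
  assumes r: "related x y" and \<alpha>: "\<alpha> \<in> x" and \<beta>: "\<beta> \<in> y"
  shows "\<exists>D. fellow e D \<alpha> \<beta>"
proof -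
  obtain \<alpha>0 \<beta>0 D where f: "\<alpha>0 \<in> x" "\<beta>0 \<in> y" "fellow e D \<alpha>0 \<beta>0" using r by (auto simp: related_def)
  have xy: "x \<in> morse_boundary X p" "y \<in> morse_boundary Y q" using r by (auto simp: related_def)
  obtain K K' where K: "\<forall>t\<ge>0. mdist X (\<alpha>0 t) (\<alpha> t) \<le> K" "\<forall>t\<ge>0. mdist Y (\<beta>0 t) (\<beta> t) \<le> K'"
    using asymptoticD(3) boundary_same[OF xy(1) f(1) \<alpha>] boundary_same[OF xy(2) f(2) \<beta>] by metis
  note m = morse_rays_mem[OF boundary_ray]
  have "fellow e (D + k * K + k + k * K' + k) \<alpha> \<beta>"
    using m[OF xy(1) f(1)] m[OF xy(1) \<alpha>] m[OF xy(2) f(2)] m[OF xy(2) \<beta>] K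
    by (intro fellow_perturb[OF f(3)]) auto
  then show ?thesis by blast
qed

lemma relatedI:
  assumes "x \<in> morse_boundary X p" "\<alpha> \<in> x" "\<beta> \<in> morse_rays Y q" "fellow e D \<alpha> \<beta>"
  shows "related x (asymptotic Y q `` {\<beta>})"
  using assms boundary_class[OF assms(3)] unfolding related_def by blast

text \<open>Both rays come close to the same points of \<open>\<alpha>\<close>, hence to each other,
  and \<open>geodesic_points_near\<close> turns this into closeness at equal times. For the
  exchanged pair this is injectivity.\<close>

lemma related_unique:
  assumes "related x y" "related x y'" shows "y = y'"
proof -
  have xy: "x \<in> morse_boundary X p" "y \<in> morse_boundary Y q" "y' \<in> morse_boundary Y q" using assms by (auto simp: related_def)
  obtain \<alpha> \<beta> \<beta>' where r: "\<alpha> \<in> x" "\<beta> \<in> y" "\<beta>' \<in> y'" using xy boundary_nonempty by meson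
  note rays = boundary_ray[OF xy(1) r(1)] boundary_ray[OF xy(2) r(2)] boundary_ray[OF xy(3) r(3)]
  obtain D D' where f: "fellow e D \<alpha> \<beta>" "fellow e D' \<alpha> \<beta>'" using related_fellow assms r by meson
  have "mdist Y (\<beta> s) (\<beta>' s) \<le> 2 * (k * D + k * D' + k)" if s: "0 \<le> s" for s
  proof -
    obtain u where u: "0 \<le> u" "e (\<alpha> u) (\<beta> s) \<le> D" using f(1) s by (auto simp: fellow_def)
    obtain v where v: "0 \<le> v" "e (\<alpha> u) (\<beta>' v) \<le> D'" using f(2) u(1) by (auto simp: fellow_def)
    have "mdist Y (\<beta> s) (\<beta>' v) \<le> k * mdist X (\<alpha> u) (\<alpha> u) + k * e (\<alpha> u) (\<beta> s) + k * e (\<alpha> u) (\<beta>' v) + k"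
      using morse_rays_mem[OF rays(1)] morse_rays_mem[OF rays(2)] morse_rays_mem[OF rays(3)] u v s by (intro e_Y) auto
    moreover have "mdist X (\<alpha> u) (\<alpha> u) = 0" using morse_rays_mem[OF rays(1) u(1)] by simp
    moreover have "k * e (\<alpha> u) (\<beta> s) \<le> k * D" "k * e (\<alpha> u) (\<beta>' v) \<le> k * D'" using u v k1 by (auto intro!: mult_left_mono)
    ultimately have "mdist Y (\<beta> s) (\<beta>' v) \<le> k * D + k * D' + k" by simp
    then show ?thesis
      using geodesic_points_near[OF morse_raysD(1)[OF rays(2)] morse_raysD(1)[OF rays(3)] _ s v(1)]
        morse_raysD(2)[OF rays(2)] morse_raysD(2)[OF rays(3)] by simp
  qed
  then have "(\<beta>, \<beta>') \<in> asymptotic Y q" by (rule asymptoticI[OF rays(2,3)])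
  then show ?thesis using boundary_eqI xy r by metis
qed

lemma related_morse_ray:
  assumes \<alpha>: "\<alpha> \<in> morse_rays X p" and \<beta>: "geodesic Y {0..} \<beta>" "\<beta> 0 = q" and f: "fellow e D \<alpha> \<beta>"
  shows "\<beta> \<in> morse_rays Y q"
proof -
  obtain N where N: "N \<in> morse_gauges" "morse_with X N {0..} \<alpha>" using morse_raysD(3)[OF \<alpha>] by blast
  obtain D0 N' where N': "N' \<in> morse_gauges" "\<And>\<alpha> \<beta> D'. geodesic X {0..} \<alpha> \<Longrightarrow> \<alpha> 0 = p \<Longrightarrow> morse_with X N {0..} \<alpha> \<Longrightarrow>
    geodesic Y {0..} \<beta> \<Longrightarrow> \<beta> 0 = q \<Longrightarrow> fellow e D' \<alpha> \<beta> \<Longrightarrow> fellow e D0 \<alpha> \<beta> \<and> morse_with Y N' {0..} \<beta>"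
    using uniform_fellow[OF N(1)] by metis
  then have "morse_with Y N' {0..} \<beta>" using morse_raysD[OF \<alpha>] N \<beta> f by metis
  then show ?thesis using \<beta> N'(1) by (auto simp: morse_rays_def)
qed

text \<open>Existence is where the two directions differ: it requires a partner of every point of
  \<open>X\<close>.\<close>

lemma related_exists:
  assumes tot: "\<forall>x\<in>mspace X. \<exists>y\<in>mspace Y. e x y \<le> k" and x: "x \<in> morse_boundary X p"
  shows "\<exists>y. related x y"
proof -
  obtain \<alpha> where \<alpha>: "\<alpha> \<in> x" using boundary_nonempty[OF x] by blast
  have r: "\<alpha> \<in> morse_rays X p" by (rule boundary_ray[OF x \<alpha>])
  obtain N where N: "N \<in> morse_gauges" "morse_with X N {0..} \<alpha>" using morse_raysD(3)[OF r] by blast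
  have "\<forall>t\<ge>0. \<exists>y\<in>mspace Y. e (\<alpha> t) y \<le> k" using tot morse_rays_mem[OF r] by blast
  moreover have "0 \<le> k" using k1 by simp
  ultimately obtain D \<beta> where \<beta>: "geodesic Y {0..} \<beta>" "\<beta> 0 = q" "fellow e D \<alpha> \<beta>"
    using exists_fellow_ray[OF N(1), of k] morse_raysD[OF r] N(2) by blast
  then show ?thesis using relatedI[OF x \<alpha> related_morse_ray[OF r \<beta>] \<beta>(3)] by blast
qed

text \<open>The times \<open>s n\<close> are bounded by \<open>?B\<close>, because
  \<open>a n t\<close> stays at distance \<open>t\<close> from the base point. So one index
  \<open>n\<close>, for which \<open>a n\<close> and \<open>b n\<close> are within 1 of their limits
  at \<open>t\<close> and on \<open>{0..?B}\<close>, yields a partner of the limit point.\<close>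

lemma fellow_limit_half:
  assumes a: "\<And>n. geodesic X {0..} (a n)" "\<And>n. a n 0 = p" and b: "\<And>n. geodesic Y {0..} (b n)" "\<And>n. b n 0 = q"
    and lim: "\<And>t. 0 \<le> t \<Longrightarrow> \<alpha> t \<in> mspace X" "\<And>t. 0 \<le> t \<Longrightarrow> \<beta> t \<in> mspace Y"
    and conv: "converges_uniformly_on_compacts X a \<alpha>" "converges_uniformly_on_compacts Y b \<beta>"
    and f: "\<And>n t. 0 \<le> t \<Longrightarrow> \<exists>s\<ge>0. e (a n t) (b n s) \<le> D" and t: "0 \<le> t"
  shows "\<exists>s\<ge>0. e (\<alpha> t) (\<beta> s) \<le> D + 4 * k"
proof -
  have mem: "a n t \<in> mspace X" "b n t \<in> mspace Y" if "0 \<le> t" for n t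
    using geodesicD(1)[OF a(1), of t t] geodesicD(1)[OF b(1), of t t] that by auto
  obtain s where s: "\<And>n. 0 \<le> s n" "\<And>n. e (a n t) (b n (s n)) \<le> D" using f[OF t] by metis
  let ?B = "k * t + k * k + k * D + k"
  have sB: "s n \<le> ?B" for n
  proof -
    have "mdist Y q (b n (s n)) \<le> k * mdist X p (a n t) + k * e p q + k * e (a n t) (b n (s n)) + k"
      using mem s t GX.base_point GY.base_point by (intro e_Y) auto
    moreover have "mdist Y q (b n (s n)) = s n" using geodesicD(2)[OF b(1), of 0 "s n" n] b(2) s by simp
    moreover have "mdist X p (a n t) = t" using geodesicD(2)[OF a(1), of 0 t n] a(2) t by simp
    moreover have "k * e p q \<le> k * k" "k * e (a n t) (b n (s n)) \<le> k * D"
      using s e_base k1 by (auto intro!: mult_left_mono)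
    ultimately show ?thesis by simp
  qed
  have "compact {0..?B} \<and> {0..?B} \<subseteq> {0::real..}" by simp
  from conv(2)[unfolded converges_uniformly_on_compacts_def, rule_format, OF this, of 1]
  have "\<forall>\<^sub>F n in sequentially. \<forall>s\<in>{0..?B}. mdist Y (b n s) (\<beta> s) < 1" by simp
  moreover have "\<forall>\<^sub>F n in sequentially. mdist X (a n t) (\<alpha> t) < 1"
    using order_tendstoD(2)[OF GX.uniform_imp_pointwise[OF conv(1) t], of 1] by simp
  ultimately have "\<forall>\<^sub>F n in sequentially. (\<forall>s\<in>{0..?B}. mdist Y (b n s) (\<beta> s) < 1) \<and> mdist X (a n t) (\<alpha> t) < 1"
    by (rule eventually_conj)
  then obtain n where n: "\<forall>s\<in>{0..?B}. mdist Y (b n s) (\<beta> s) < 1" "mdist X (a n t) (\<alpha> t) < 1"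
    using eventually_happens'[OF sequentially_bot] by blast
  have n1: "mdist Y (b n (s n)) (\<beta> (s n)) < 1" using n(1) s(1)[of n] sB[of n] by auto
  have "e (\<alpha> t) (\<beta> (s n)) \<le> e (\<alpha> t) (b n (s n)) + k * mdist Y (b n (s n)) (\<beta> (s n)) + k"
    "e (\<alpha> t) (b n (s n)) \<le> e (a n t) (b n (s n)) + k * mdist X (a n t) (\<alpha> t) + k"
    by (rule e_right[OF lim(1)[OF t] mem(2)[OF s(1)] lim(2)[OF s(1)]],
        rule e_left[OF mem(1)[OF t] lim(1)[OF t] mem(2)[OF s(1)]])
  moreover have "k * mdist Y (b n (s n)) (\<beta> (s n)) \<le> k * 1" "k * mdist X (a n t) (\<alpha> t) \<le> k * 1"
    using n1 n(2) k1 by (auto intro!: mult_left_mono)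
  ultimately have "e (\<alpha> t) (\<beta> (s n)) \<le> D + 4 * k" using s(2)[of n] by linarith
  then show ?thesis using s(1) by blast
qed

lemma fellow_limit:
  assumes a: "\<And>n. geodesic X {0..} (a n)" "\<And>n. a n 0 = p" and b: "\<And>n. geodesic Y {0..} (b n)" "\<And>n. b n 0 = q"
    and lim: "\<And>t. 0 \<le> t \<Longrightarrow> \<alpha> t \<in> mspace X" "\<And>t. 0 \<le> t \<Longrightarrow> \<beta> t \<in> mspace Y"
    and conv: "converges_uniformly_on_compacts X a \<alpha>" "converges_uniformly_on_compacts Y b \<beta>"
    and f: "\<And>n. fellow e D (a n) (b n)"
  shows "fellow e (D + 4 * k) \<alpha> \<beta>"
proof -
  interpret S: coarse_pair Y W q X V p "\<lambda>y x. e x y" k by (rule swap)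
  have 1: "\<exists>s\<ge>0. e (a n t) (b n s) \<le> D" "\<exists>s\<ge>0. e (a n s) (b n t) \<le> D" if "0 \<le> t" for n t
    using f[of n] that by (auto simp: fellow_def)
  show ?thesis unfolding fellow_def
    using fellow_limit_half[OF a b lim conv 1(1)] S.fellow_limit_half[OF b a lim(2,1) conv(2,1) 1(2)] by blast
qed

text \<open>Convergence follows from compactness: each subsequence of the partner rays subconverges,
  the limit fellow-travels the limit of the given rays, and uniqueness makes its class independent
  of the subsequence. The limit class \<open>y'\<close> is a result of this argument, so the lemma
  also covers the direction without \<open>related_exists\<close>.\<close>

lemma boundary_transfer:
  assumes N: "N \<in> morse_gauges"
  shows "\<exists>N'\<in>morse_gauges. (\<forall>x y. related x y \<and> x \<in> morse_stratum X p N \<longrightarrow> y \<in> morse_stratum Y q N') \<and>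
    (\<forall>x y x'. stratum_converges X N x x' \<and> x' \<in> morse_boundary X p \<and> (\<forall>n. related (x n) (y n)) \<longrightarrow>
      (\<exists>y'. related x' y' \<and> stratum_converges Y N' y y'))"
proof -
  obtain D N' where N': "N' \<in> morse_gauges" and uf: "\<And>\<alpha> \<beta> D'. geodesic X {0..} \<alpha> \<Longrightarrow> \<alpha> 0 = p \<Longrightarrow> morse_with X N {0..} \<alpha> \<Longrightarrow>
    geodesic Y {0..} \<beta> \<Longrightarrow> \<beta> 0 = q \<Longrightarrow> fellow e D' \<alpha> \<beta> \<Longrightarrow> fellow e D \<alpha> \<beta> \<and> morse_with Y N' {0..} \<beta>"
    using uniform_fellow[OF N] by metis
  \<comment> \<open>Every representative of \<open>y\<close> obeys the same \<open>D\<close> and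
    \<open>N'\<close>, so the rays \<open>\<beta> n\<close> below may be chosen arbitrarily in their
    classes.\<close>
  have key: "fellow e D \<alpha> \<beta>" "morse_with Y N' {0..} \<beta>"
    if r: "related x y" "\<alpha> \<in> x" "\<beta> \<in> y" "morse_with X N {0..} \<alpha>" for x y \<alpha> \<beta>
  proof -
    have xy: "x \<in> morse_boundary X p" "y \<in> morse_boundary Y q" using r(1) by (auto simp: related_def)
    note ab = boundary_ray[OF xy(1) r(2)] boundary_ray[OF xy(2) r(3)]
    obtain D' where "fellow e D' \<alpha> \<beta>" using related_fellow[OF r(1-3)] by blast
    from uf[OF morse_raysD(1,2)[OF ab(1)] r(4) morse_raysD(1,2)[OF ab(2)] this]
    show "fellow e D \<alpha> \<beta>" "morse_with Y N' {0..} \<beta>" by auto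
  qed
  have "y \<in> morse_stratum Y q N'" if r: "related x y" "x \<in> morse_stratum X p N" for x y
  proof -
    obtain \<alpha> where \<alpha>: "\<alpha> \<in> x" "morse_with X N {0..} \<alpha>" using r(2) by (auto simp: morse_stratum_def)
    have y: "y \<in> morse_boundary Y q" using r(1) by (simp add: related_def)
    obtain \<beta> where b: "\<beta> \<in> y" using boundary_nonempty[OF y] by blast
    show ?thesis by (rule morse_stratumI[OF y b key(2)[OF r(1) \<alpha>(1) b \<alpha>(2)]])
  qed
  moreover have "\<exists>y'. related x' y' \<and> stratum_converges Y N' y y'"
    if conv: "stratum_converges X N x x'" and x': "x' \<in> morse_boundary X p" and rel: "\<And>n. related (x n) (y n)" for x y x'
  proof -
    obtain \<alpha> where \<alpha>: "\<And>n. \<alpha> n \<in> x n" "\<And>n. morse_with X N {0..} (\<alpha> n)"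
      and sub: "\<And>r. strict_mono (r :: nat \<Rightarrow> nat) \<Longrightarrow> \<exists>r'. strict_mono (r' :: nat \<Rightarrow> nat) \<and>
        (\<exists>\<beta>\<in>x'. converges_uniformly_on_compacts X (\<alpha> \<circ> r \<circ> r') \<beta>)"
      using conv unfolding stratum_converges_def by blast
    have "y n \<in> morse_boundary Y q" for n using rel[of n] by (simp add: related_def)
    from boundary_nonempty[OF this] obtain \<beta> where \<beta>: "\<And>n. \<beta> n \<in> y n" by metis
    have xyb: "x n \<in> morse_boundary X p" "y n \<in> morse_boundary Y q" for n using rel[of n] by (auto simp: related_def)
    have rays: "\<alpha> n \<in> morse_rays X p" "\<beta> n \<in> morse_rays Y q" for n
      using boundary_ray[OF xyb(1) \<alpha>(1)] boundary_ray[OF xyb(2) \<beta>] .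
    have lim: "\<exists>r'. strict_mono (r' :: nat \<Rightarrow> nat) \<and> (\<exists>\<beta>'. \<beta>' \<in> morse_rays Y q \<and> related x' (asymptotic Y q `` {\<beta>'}) \<and>
        converges_uniformly_on_compacts Y (\<beta> \<circ> r \<circ> r') \<beta>')" if r: "strict_mono (r :: nat \<Rightarrow> nat)" for r
    proof -
      obtain r1 \<alpha>' where r1: "strict_mono r1" "\<alpha>' \<in> x'" "converges_uniformly_on_compacts X (\<alpha> \<circ> r \<circ> r1) \<alpha>'"
        using sub[OF r] by blast
      have \<alpha>': "\<alpha>' \<in> morse_rays X p" by (rule boundary_ray[OF x' r1(2)])
      obtain r2 \<beta>' where r2: "strict_mono r2" "geodesic Y {0..} \<beta>'" "\<beta>' 0 = q"
        "converges_uniformly_on_compacts Y (\<beta> \<circ> r \<circ> r1 \<circ> r2) \<beta>'"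
        using GY.rays_subconverge[of "\<beta> \<circ> r \<circ> r1"] morse_raysD[OF rays(2)] by auto
      have c: "converges_uniformly_on_compacts X (\<alpha> \<circ> r \<circ> r1 \<circ> r2) \<alpha>'"
        by (rule converges_subsequence[OF r1(3) r2(1)])
      have \<beta>m: "\<beta>' t \<in> mspace Y" if "0 \<le> t" for t using geodesicD(1)[OF r2(2), of t t] that by simp
      have "fellow e (D + 4 * k) \<alpha>' \<beta>'"
      proof (rule fellow_limit[OF _ _ _ _ _ _ c r2(4)])
        show "fellow e D ((\<alpha> \<circ> r \<circ> r1 \<circ> r2) n) ((\<beta> \<circ> r \<circ> r1 \<circ> r2) n)" for n
          using key(1)[OF rel \<alpha>(1) \<beta> \<alpha>(2)] by simp
      qed (use morse_raysD[OF rays(1)] morse_raysD[OF rays(2)] morse_rays_mem[OF \<alpha>'] \<beta>m in auto)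
      note f = this
      have "\<beta>' \<in> morse_rays Y q" by (rule related_morse_ray[OF \<alpha>' r2(2,3) f])
      moreover have "related x' (asymptotic Y q `` {\<beta>'})" by (rule relatedI[OF x' r1(2) calculation f])
      moreover have "strict_mono (r1 \<circ> r2)" by (rule strict_mono_o[OF r1(1) r2(1)])
      ultimately show ?thesis using r2(4) by (intro exI[of _ "r1 \<circ> r2"]) (auto simp: o_assoc)
    qed
    \<comment> \<open>The identity subsequence supplies a first limit class; all the others coincide
      with it.\<close>
    have "strict_mono (\<lambda>n::nat. n)" by (simp add: strict_mono_def)
    from lim[OF this] obtain y' where y': "related x' y'" by blast
    have "stratum_converges Y N' y y'"
      unfolding stratum_converges_def
    proof (intro exI[of _ \<beta>] conjI allI impI)
      show "\<beta> n \<in> y n" "morse_with Y N' {0..} (\<beta> n)" for n using \<beta> key(2)[OF rel \<alpha>(1) \<beta> \<alpha>(2)] by auto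
      fix r :: "nat \<Rightarrow> nat" assume "strict_mono r"
      then obtain r' \<beta>' where r': "strict_mono r'" "\<beta>' \<in> morse_rays Y q" "related x' (asymptotic Y q `` {\<beta>'})"
        "converges_uniformly_on_compacts Y (\<beta> \<circ> r \<circ> r') \<beta>'" using lim by blast
      then have "\<beta>' \<in> y'" using related_unique[OF r'(3) y'] boundary_class[OF r'(2)] by blast
      then show "\<exists>r'. strict_mono r' \<and> (\<exists>\<beta>'\<in>y'. converges_uniformly_on_compacts Y (\<beta> \<circ> r \<circ> r') \<beta>')"
        using r' by blast
    qed
    then show ?thesis using y' by blast
  qed
  ultimately show ?thesis using N' by blast
qed

text \<open>Sequences in one stratum of \<open>X\<close> have partners in one stratum of
  \<open>Y\<close>, so closedness there can be applied to the partners of a convergent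
  sequence.\<close>

lemma closed_transfer:
  assumes F: "closedin (morse_boundary_topology Y q) F"
  shows "closedin (morse_boundary_topology X p) {x \<in> morse_boundary X p. \<exists>y\<in>F. related x y}"
    (is "closedin _ ?F")
  unfolding closedin_morse_boundary_topology
proof (intro conjI ballI)
  fix N :: "real \<Rightarrow> real \<Rightarrow> real" assume N: "N \<in> morse_gauges"
  obtain N' where N': "N' \<in> morse_gauges" "\<And>x y. related x y \<Longrightarrow> x \<in> morse_stratum X p N \<Longrightarrow> y \<in> morse_stratum Y q N'"
    "\<And>x y x'. stratum_converges X N x x' \<Longrightarrow> x' \<in> morse_boundary X p \<Longrightarrow> (\<forall>n. related (x n) (y n)) \<Longrightarrow>
      \<exists>y'. related x' y' \<and> stratum_converges Y N' y y'"
    using boundary_transfer[OF N] by metis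
  show "stratum_closed X p N (?F \<inter> morse_stratum X p N)"
    unfolding stratum_closed_def
  proof (intro conjI allI ballI impI)
    fix x x' assume x': "x' \<in> morse_stratum X p N" and x: "range x \<subseteq> ?F \<inter> morse_stratum X p N \<and> stratum_converges X N x x'"
    have x'b: "x' \<in> morse_boundary X p" using x' by (simp add: morse_stratum_def)
    have "\<forall>n. \<exists>y. y \<in> F \<and> related (x n) y" using x by blast
    then obtain y where y: "\<And>n. y n \<in> F" "\<And>n. related (x n) (y n)" by metis
    have xc: "stratum_converges X N x x'" and xs: "x n \<in> morse_stratum X p N" for n using x by auto
    have "\<forall>n. related (x n) (y n)" using y(2) by simp
    from N'(3)[OF xc x'b this] obtain y' where y': "related x' y'" "stratum_converges Y N' y y'" by blast
    have "y n \<in> morse_stratum Y q N'" for n by (rule N'(2)[OF y(2) xs])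
    then have "range y \<subseteq> F \<inter> morse_stratum Y q N'" using y(1) by blast
    moreover have "y' \<in> morse_stratum Y q N'" using N'(2)[OF y'(1) x'] .
    moreover have "stratum_closed Y q N' (F \<inter> morse_stratum Y q N')"
      using F N'(1) unfolding closedin_morse_boundary_topology by blast
    ultimately have "y' \<in> F" using y'(2) unfolding stratum_closed_def by blast
    then show "x' \<in> ?F \<inter> morse_stratum X p N" using x' x'b y'(1) by blast
  qed blast
qed blast

text \<open>Injectivity is uniqueness for the exchanged pair. Continuity and closedness are
  \<open>closed_transfer\<close> for the pair and for the exchanged pair.\<close>

lemma related_map:
  assumes f: "\<And>x. x \<in> morse_boundary X p \<Longrightarrow> related x (f x)"
  shows "morse_preserving X p Y q f" "embedding_map (morse_boundary_topology X p) (morse_boundary_topology Y q) f"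
proof -
  interpret S: coarse_pair Y W q X V p "\<lambda>y x. e x y" k by (rule swap)
  have fY: "f x \<in> morse_boundary Y q" if "x \<in> morse_boundary X p" for x using f[OF that] by (simp add: related_def)
  have graph: "related x y \<longleftrightarrow> x \<in> morse_boundary X p \<and> y = f x" for x y
  proof
    assume r: "related x y"
    then have x: "x \<in> morse_boundary X p" by (simp add: related_def)
    show "x \<in> morse_boundary X p \<and> y = f x" using related_unique[OF r f[OF x]] x by simp
  qed (use f in simp)
  have inj: "inj_on f (morse_boundary X p)"
  proof (rule inj_onI)
    fix x x' assume x: "x \<in> morse_boundary X p" "x' \<in> morse_boundary X p" "f x = f x'"
    have "S.related (f x) x" "S.related (f x) x'" using f[OF x(1)] f[OF x(2)] x(3) by (simp_all add: related_swap)
    then show "x = x'" by (rule S.related_unique)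
  qed
  have strat: "morse_stratum X p N \<subseteq> morse_boundary X p" for N by (auto simp: morse_stratum_def)
  show "morse_preserving X p Y q f"
    unfolding morse_preserving_def
  proof (intro conjI ballI)
    fix N :: "real \<Rightarrow> real \<Rightarrow> real" assume N: "N \<in> morse_gauges"
    obtain N' where "N' \<in> morse_gauges" "\<And>x y. related x y \<Longrightarrow> x \<in> morse_stratum X p N \<Longrightarrow> y \<in> morse_stratum Y q N'"
      using boundary_transfer[OF N] by blast
    then show "\<exists>N'\<in>morse_gauges. inj_on f (morse_stratum X p N) \<and> f ` morse_stratum X p N \<subseteq> morse_stratum Y q N'"
      using inj_on_subset[OF inj strat] f strat by (intro bexI[of _ N']) blast+
  qed (use fY in blast)
  show "embedding_map (morse_boundary_topology X p) (morse_boundary_topology Y q) f"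
  proof (rule injective_closed_imp_embedding_map)
    show "continuous_map (morse_boundary_topology X p) (morse_boundary_topology Y q) f"
      unfolding continuous_map_closedin
    proof (intro conjI allI impI)
      fix F assume F: "closedin (morse_boundary_topology Y q) F"
      have "{x \<in> topspace (morse_boundary_topology X p). f x \<in> F} = {x \<in> morse_boundary X p. \<exists>y\<in>F. related x y}"
        by (auto simp: graph)
      then show "closedin (morse_boundary_topology X p) {x \<in> topspace (morse_boundary_topology X p). f x \<in> F}"
        using closed_transfer[OF F] by simp
    qed (use fY in auto)
    show "closed_map (morse_boundary_topology X p) (morse_boundary_topology Y q) f"
      unfolding closed_map_def
    proof (intro allI impI)
      fix F assume F: "closedin (morse_boundary_topology X p) F"
      have "F \<subseteq> morse_boundary X p" using closedin_subset[OF F] by simp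
      then have "f ` F = {y \<in> morse_boundary Y q. \<exists>x\<in>F. S.related y x}"
        using fY by (auto simp: related_swap graph)
      then show "closedin (morse_boundary_topology Y q) (f ` F)" using S.closed_transfer[OF F] by simp
    qed
    show "inj_on f (topspace (morse_boundary_topology X p))" using inj by simp
  qed
qed

end

section \<open>The boundary map of a map between spaces\<close>

lemma finite_hausdorff_fellow:
  "finite_hausdorff_distance Y ((\<Phi> \<circ> \<alpha>) ` {0..}) (\<beta> ` {0..}) \<longleftrightarrow> (\<exists>D. fellow (\<lambda>x y. mdist Y (\<Phi> x) y) D \<alpha> \<beta>)"
  unfolding finite_hausdorff_distance_def fellow_def
  by (simp only: ball_simps bex_simps comp_apply) (simp add: Ball_def Bex_def)

lemma boundary_map_embedding:
  assumes cp: "coarse_pair X V p Y W q (\<lambda>x y. mdist Y (\<Phi> x) y) k"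
    and \<Phi>: "\<Phi> ` mspace X \<subseteq> mspace Y"
  shows "boundary_map_defined X p Y q \<Phi>" "morse_preserving X p Y q (boundary_map X p Y q \<Phi>)"
    "embedding_map (morse_boundary_topology X p) (morse_boundary_topology Y q) (boundary_map X p Y q \<Phi>)"
proof -
  interpret coarse_pair X V p Y W q "\<lambda>x y. mdist Y (\<Phi> x) y" k by (rule cp)
  \<comment> \<open>\<open>boundary_image\<close> speaks about all representatives of
    \<open>x\<close>, \<open>related\<close> about one; \<open>related_fellow\<close> closes the
    gap.\<close>
  have img: "boundary_image X p Y q \<Phi> x y \<longleftrightarrow> related x y" for x y
  proof
    assume "boundary_image X p Y q \<Phi> x y"
    then have b: "x \<in> morse_boundary X p" "y \<in> morse_boundary Y q"
      and f: "\<And>\<alpha>. \<alpha> \<in> x \<Longrightarrow> \<exists>\<beta>\<in>y. \<exists>D. fellow (\<lambda>x y. mdist Y (\<Phi> x) y) D \<alpha> \<beta>"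
      unfolding boundary_image_def finite_hausdorff_fellow by auto
    then show "related x y" using boundary_nonempty[OF b(1)] unfolding related_def by blast
  next
    assume r: "related x y"
    then have b: "x \<in> morse_boundary X p" "y \<in> morse_boundary Y q" by (auto simp: related_def)
    obtain \<beta> where "\<beta> \<in> y" using boundary_nonempty[OF b(2)] by blast
    then show "boundary_image X p Y q \<Phi> x y"
      unfolding boundary_image_def finite_hausdorff_fellow using b related_fellow[OF r] by blast
  qed
  have tot: "\<exists>y\<in>mspace Y. mdist Y (\<Phi> x) y \<le> k" if "x \<in> mspace X" for x
  proof -
    have "\<Phi> x \<in> mspace Y" using that \<Phi> by blast
    moreover from this have "mdist Y (\<Phi> x) (\<Phi> x) \<le> k" using k1 by (metis mdist_zero zero_le_one order_trans)
    ultimately show ?thesis by blast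
  qed
  have ex1: "\<exists>!y. related x y" if "x \<in> morse_boundary X p" for x
    using related_exists[OF _ that] tot related_unique by blast
  then show "boundary_map_defined X p Y q \<Phi>" by (simp add: boundary_map_defined_def img)
  have rel: "related x (boundary_map X p Y q \<Phi> x)" if "x \<in> morse_boundary X p" for x
    unfolding boundary_map_def img using theI'[OF ex1[OF that]] .
  show "morse_preserving X p Y q (boundary_map X p Y q \<Phi>)" by (rule related_map(1)[OF rel])
  show "embedding_map (morse_boundary_topology X p) (morse_boundary_topology Y q) (boundary_map X p Y q \<Phi>)"
    by (rule related_map(2)[OF rel])
qed

section \<open>Cayley graphs\<close>

lemma (in half_graph) geo_space_realization:
  assumes "\<And>u r. u \<in> verts \<Gamma> \<Longrightarrow> finite {w \<in> verts \<Gamma>. dv u w \<le> r}" "p \<in> verts \<Gamma>"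
  shows "geo_space X (vertex ` verts \<Gamma>) (vertex p)"
proof (rule geo_space.intro)
  show "\<exists>u\<in>vertex ` verts \<Gamma>. mdist X x u \<le> 1" if "x \<in> mspace X" for x
    using near_vertex[of x] that by auto
  show "\<exists>\<gamma>. geodesic X {0..mdist X u w} \<gamma> \<and> \<gamma> 0 = u \<and> \<gamma> (mdist X u w) = w"
    if "u \<in> vertex ` verts \<Gamma>" "w \<in> vertex ` verts \<Gamma>" for u w
    using that vertex_geodesic by auto
  show "\<exists>s y. strict_mono (s :: nat \<Rightarrow> nat) \<and> y \<in> mspace X \<and> (\<lambda>n. mdist X (x (s n)) y) \<longlonglongrightarrow> 0"
    if "\<And>n. x n \<in> mspace X" "\<And>n. mdist X (vertex p) (x n) \<le> r" for x r
    using bounded_seq_convergent[OF assms, of x r] that by simp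
qed (use assms in auto)

locale cayley = group G for G (structure) +
  fixes S
  assumes S: "finite_generating_set G S"
begin

abbreviation \<Gamma> where "\<Gamma> \<equiv> cayley_graph G S"

sublocale K: half_graph \<Gamma>
  by (rule half_graph_cayley_graph[OF is_group S])

lemma verts_cayley [simp]: "verts \<Gamma> = carrier G"
  by (simp add: cayley_graph_def)

lemma S_carrier: "s \<in> S \<Longrightarrow> s \<in> carrier G" and S_finite: "finite S"
  using S by (auto simp: finite_generating_set_def)

lemma elength_cayley [simp]: "elength \<Gamma> e = 1"
  by (simp add: cayley_graph_def)

lemma cayley_edge: "{g, h} \<in> edges \<Gamma> \<Longrightarrow> g \<in> carrier G \<and> h \<in> carrier G \<and> (\<exists>s\<in>S. h = g \<otimes> s \<or> g = h \<otimes> s)"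
proof -
  assume "{g, h} \<in> edges \<Gamma>"
  then obtain a s where "{g, h} = {a, a \<otimes> s}" "a \<in> carrier G" "s \<in> S" by (auto simp: cayley_graph_def)
  then show ?thesis using S_carrier by (auto simp: doubleton_eq_iff)
qed

lemma generator_edge: "g \<in> carrier G \<Longrightarrow> s \<in> S \<Longrightarrow> s \<noteq> \<one> \<Longrightarrow> {g, g \<otimes> s} \<in> edges \<Gamma>"
  by (auto simp: cayley_graph_def)

lemma shift_le:
  assumes "h \<in> carrier G" "x \<in> carrier G" "y \<in> carrier G"
  shows "K.dv (h \<otimes> x) (h \<otimes> y) \<le> K.dv x y"
proof -
  obtain ws where ws: "graph_walk \<Gamma> ws" "hd ws = x" "last ws = y" "walk_length \<Gamma> ws = K.dv x y"
    using K.gdist_walk[of x y] assms by auto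
  have ne: "ws \<noteq> []" and c: "set ws \<subseteq> carrier G" using ws(1) by (auto simp: graph_walk_def)
  have "{h \<otimes> u, h \<otimes> w} \<in> edges \<Gamma>" if e: "{u, w} \<in> edges \<Gamma>" for u w
  proof -
    obtain g s where g: "{u, w} = {g, g \<otimes> s}" "g \<in> carrier G" "s \<in> S" "s \<noteq> \<one>"
      using e by (auto simp: cayley_graph_def)
    have "(\<lambda>z. h \<otimes> z) ` {u, w} = {h \<otimes> g, (h \<otimes> g) \<otimes> s}"
      unfolding g(1) using g assms(1) S_carrier by (simp add: m_assoc)
    moreover have "{h \<otimes> g, (h \<otimes> g) \<otimes> s} \<in> edges \<Gamma>" using g assms(1) by (intro generator_edge) auto
    ultimately show ?thesis by simp
  qed
  then have "successively (\<lambda>u w. {h \<otimes> u, h \<otimes> w} \<in> edges \<Gamma>) ws"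
    using ws(1) by (auto simp: graph_walk_def elim!: successively_mono)
  then have "graph_walk \<Gamma> (map ((\<otimes>) h) ws)"
    using ne c assms(1) by (auto simp: graph_walk_def successively_map)
  moreover have "walk_length \<Gamma> (map ((\<otimes>) h) ws) = walk_length \<Gamma> ws"
    by (induction \<Gamma>\<equiv>\<Gamma> ws rule: walk_length.induct) auto
  ultimately show ?thesis
    using K.gdist_le_walk_length[of "map ((\<otimes>) h) ws"] ws ne by (simp add: hd_map last_map)
qed

lemma dist_shift:
  assumes "h \<in> carrier G" "x \<in> carrier G" "y \<in> carrier G"
  shows "K.dv (h \<otimes> x) (h \<otimes> y) = K.dv x y"
proof -
  have "inv h \<otimes> (h \<otimes> x) = x" "inv h \<otimes> (h \<otimes> y) = y" using assms by (simp_all flip: m_assoc)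
  then show ?thesis using shift_le[OF assms] shift_le[of "inv h" "h \<otimes> x" "h \<otimes> y"] assms by simp
qed

text \<open>Translates between distances and the quotients \<open>inv x \<otimes> y\<close> by which
  the projection is controlled.\<close>

lemma dist_quotient:
  assumes "x \<in> carrier G" "y \<in> carrier G"
  shows "K.dv x y = K.dv \<one> (inv x \<otimes> y)"
  using dist_shift[of "inv x" x y] assms by simp

text \<open>A walk is prolonged by one of finitely many generators or their inverses, so the
  endpoints of walks with a bounded number of vertices are finite in number.\<close>

lemma finite_balls:
  assumes "u \<in> carrier G" shows "finite {w \<in> carrier G. K.dv u w \<le> r}"
proof -
  define B where "B n = {w. \<exists>ws. graph_walk \<Gamma> ws \<and> hd ws = u \<and> last ws = w \<and> length ws \<le> Suc n}" for n
  have "finite (B n)" for n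
  proof (induction n)
    case 0
    have "B 0 \<subseteq> {u}"
    proof
      fix w assume "w \<in> B 0"
      then obtain ws where "graph_walk \<Gamma> ws" "hd ws = u" "last ws = w" "length ws \<le> Suc 0" by (auto simp: B_def)
      then show "w \<in> {u}" by (cases ws) (auto simp: graph_walk_def)
    qed
    then show ?case using finite_subset by blast
  next
    case (Suc n)
    have "B (Suc n) \<subseteq> B n \<union> (\<Union>x\<in>B n. (\<lambda>s. x \<otimes> s) ` S \<union> (\<lambda>s. x \<otimes> inv s) ` S)"
    proof
      fix w assume "w \<in> B (Suc n)"
      then obtain ws where ws: "graph_walk \<Gamma> ws" "hd ws = u" "last ws = w" "length ws \<le> Suc (Suc n)" by (auto simp: B_def)
      show "w \<in> B n \<union> (\<Union>x\<in>B n. (\<lambda>s. x \<otimes> s) ` S \<union> (\<lambda>s. x \<otimes> inv s) ` S)"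
      proof (cases "butlast ws = []")
        case True
        then have "length ws \<le> Suc n" by (cases ws) (auto split: if_splits)
        then show ?thesis using ws by (auto simp: B_def)
      next
        case False
        have "ws \<noteq> []" using ws(1) by (simp add: graph_walk_def)
        then have s: "ws = butlast ws @ [w]" using ws(3) by (metis append_butlast_last_id)
        then have g: "graph_walk \<Gamma> (butlast ws)" "{last (butlast ws), w} \<in> edges \<Gamma>"
          using ws(1) False graph_walk_append[of "butlast ws" "[w]" \<Gamma>] by auto
        let ?x = "last (butlast ws)"
        have "hd (butlast ws) = u" using ws(2) False s by (metis hd_append2)
        then have x: "?x \<in> B n" using g(1) ws(4) by (auto simp: B_def)
        obtain t where t: "t \<in> S" "w = ?x \<otimes> t \<or> ?x = w \<otimes> t" "?x \<in> carrier G" "w \<in> carrier G"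
          using cayley_edge[OF g(2)] by blast
        have "?x = w \<otimes> t \<Longrightarrow> w = ?x \<otimes> inv t" using t S_carrier by (metis inv_solve_right)
        then show ?thesis using t x by blast
      qed
    qed
    then show ?case using Suc S_finite by (auto elim!: finite_subset)
  qed
  moreover have "{w \<in> carrier G. K.dv u w \<le> r} \<subseteq> B (nat \<lceil>r\<rceil>)"
  proof
    fix w assume w: "w \<in> {w \<in> carrier G. K.dv u w \<le> r}"
    obtain ws where ws: "graph_walk \<Gamma> ws" "hd ws = u" "last ws = w" "walk_length \<Gamma> ws = K.dv u w"
      using K.gdist_walk[of u w] assms w by auto
    have "ws \<noteq> [] \<Longrightarrow> real (length ws) = walk_length \<Gamma> ws + 1" for ws
      by (induction \<Gamma>\<equiv>\<Gamma> ws rule: walk_length.induct) auto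
    then have "real (length ws) \<le> r + 1" using ws w by (auto simp: graph_walk_def)
    then have "length ws \<le> Suc (nat \<lceil>r\<rceil>)" by linarith
    then show "w \<in> B (nat \<lceil>r\<rceil>)" using ws by (auto simp: B_def)
  qed
  ultimately show ?thesis using finite_subset by blast
qed

lemma finite_bounded:
  assumes "finite B" "B \<subseteq> carrier G" shows "\<exists>c\<ge>0. \<forall>b\<in>B. K.dv \<one> b \<le> c"
proof -
  have "\<forall>b\<in>B. K.dv \<one> b \<le> (\<Sum>b\<in>B. K.dv \<one> b)" using assms by (auto intro: member_le_sum)
  moreover have "0 \<le> (\<Sum>b\<in>B. K.dv \<one> b)" by (intro sum_nonneg) auto
  ultimately show ?thesis by blast
qed

lemma geo_space_cayley: "geo_space (cayley_space G S) (vertex ` carrier G) (vertex \<one>)"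
  using K.geo_space_realization[of \<one>] finite_balls by simp

text \<open>The target is an arbitrary metric space, because this serves both the projection of
  \<open>G\<close> to \<open>P\<close> and the inclusion of \<open>P\<close> in
  \<open>G\<close>.\<close>

lemma lipschitz_from_generators:
  assumes f: "\<And>g. g \<in> carrier G \<Longrightarrow> f g \<in> mspace m"
    and c: "\<And>g s. g \<in> carrier G \<Longrightarrow> s \<in> S \<Longrightarrow> mdist m (f g) (f (g \<otimes> s)) \<le> c" and c0: "0 \<le> c"
    and xy: "x \<in> carrier G" "y \<in> carrier G"
  shows "mdist m (f x) (f y) \<le> c * K.dv x y"
proof -
  have "mdist m (f (hd ws)) (f (last ws)) \<le> c * walk_length \<Gamma> ws" if "graph_walk \<Gamma> ws" for ws
    using that
  proof (induction \<Gamma>\<equiv>\<Gamma> ws rule: walk_length.induct)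
    case 1
    then show ?case by (simp add: graph_walk_def)
  next
    case (2 x)
    then have "f x \<in> mspace m" using f by (simp add: graph_walk_def)
    then have "mdist m (f x) (f x) = 0" by simp
    then show ?case by simp
  next
    case (3 x y ws)
    then have e: "{x, y} \<in> edges \<Gamma>" "graph_walk \<Gamma> (y # ws)" by (auto simp: graph_walk_def)
    obtain s where s: "s \<in> S" "y = x \<otimes> s \<or> x = y \<otimes> s" "x \<in> carrier G" "y \<in> carrier G" using cayley_edge[OF e(1)] by blast
    have d: "mdist m (f x) (f y) \<le> c" using c s mdist_commute[of m "f x" "f y"] by metis
    have "last (y # ws) \<in> carrier G" using e(2) last_in_set[of "y # ws"] by (auto simp: graph_walk_def)
    then have "mdist m (f x) (f (last (y # ws))) \<le> mdist m (f x) (f y) + mdist m (f y) (f (last (y # ws)))"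
      using f s by (intro mdist_triangle) auto
    moreover have "mdist m (f y) (f (last (y # ws))) \<le> c * walk_length \<Gamma> (y # ws)" using 3 e by simp
    ultimately show ?case using d by (simp add: distrib_left)
  qed
  moreover obtain ws where "graph_walk \<Gamma> ws" "hd ws = x" "last ws = y" "walk_length \<Gamma> ws = K.dv x y"
    using K.gdist_walk[of x y] xy by auto
  ultimately show ?thesis by metis
qed

end

section \<open>Peripheral subgroups are undistorted and strongly quasi-convex\<close>

text \<open>Strong contraction without a metric: \<open>F\<close> is fixed once and for all,
  \<open>R\<close> depends on the step set \<open>B\<close>, and the quotient
  \<open>inv (\<pi> x) \<otimes> x\<close> measures how far \<open>x\<close> is from
  \<open>P\<close>.\<close>

locale coarse_retract = group G for G (structure) +
  fixes P :: "'a set" and \<pi> :: "'a \<Rightarrow> 'a" and F :: "'a set"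
  assumes P: "subgroup P G" and F: "finite F" "F \<subseteq> P" and \<pi>: "\<And>x. x \<in> carrier G \<Longrightarrow> \<pi> x \<in> P"
    and \<pi>_id: "\<And>p. p \<in> P \<Longrightarrow> \<pi> p = p"
    and contract: "finite B \<Longrightarrow> B \<subseteq> carrier G \<Longrightarrow> \<exists>R. finite R \<and> R \<subseteq> carrier G \<and>
      (\<forall>x\<in>carrier G. \<forall>y\<in>carrier G. inv x \<otimes> y \<in> B \<longrightarrow> inv (\<pi> x) \<otimes> \<pi> y \<in> F \<or> inv (\<pi> x) \<otimes> x \<in> R)"
begin

section \<open>Finite generation of the subgroup\<close>

lemma P_carrier: "p \<in> P \<Longrightarrow> p \<in> carrier G" using subgroup.subset[OF P] by blast

lemma \<pi>_carrier: "x \<in> carrier G \<Longrightarrow> \<pi> x \<in> carrier G" using \<pi> P_carrier by blast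

abbreviation H where "H \<equiv> G\<lparr>carrier := P\<rparr>"

lemma group_H: "group H" by (rule subgroup_imp_group[OF P])

lemma inv_mult_flip: "a \<in> carrier G \<Longrightarrow> b \<in> carrier G \<Longrightarrow> inv (inv a \<otimes> b) = inv b \<otimes> a"
  by (simp add: inv_mult_group)

lemma mult_cancel_middle:
  assumes "a \<in> carrier G" "b \<in> carrier G" "c \<in> carrier G"
  shows "(a \<otimes> b) \<otimes> (inv b \<otimes> c) = a \<otimes> c"
proof -
  have "b \<otimes> (inv b \<otimes> c) = c" using assms by (simp flip: m_assoc)
  then show ?thesis using assms by (simp add: m_assoc)
qed

text \<open>If the step of the projection is not in \<open>F\<close>, then \<open>x\<close> is close
  to \<open>p\<close>, its projection, and so is \<open>y\<close>. The contraction is applied again,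
  to the pair \<open>y\<close>, \<open>p\<close>: since \<open>\<pi>\<close> fixes \<open>p\<close>,
  the projection of \<open>y\<close> is close to \<open>p\<close> or to \<open>y\<close>, hence to
  \<open>p\<close> in both cases.\<close>

lemma projection_finite:
  assumes B: "finite B" "B \<subseteq> carrier G"
  shows "\<exists>E. finite E \<and> E \<subseteq> P \<and> (\<forall>x\<in>carrier G. \<forall>y\<in>carrier G. inv x \<otimes> y \<in> B \<longrightarrow> inv (\<pi> x) \<otimes> \<pi> y \<in> E)"
proof -
  obtain R where R: "finite R" "R \<subseteq> carrier G" "\<And>x y. x \<in> carrier G \<Longrightarrow> y \<in> carrier G \<Longrightarrow> inv x \<otimes> y \<in> B \<Longrightarrow>
    inv (\<pi> x) \<otimes> \<pi> y \<in> F \<or> inv (\<pi> x) \<otimes> x \<in> R" using contract[OF B] by metis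
  define R' where "R' = (\<lambda>(r, b). r \<otimes> b) ` (R \<times> B)"
  have R': "finite R'" "R' \<subseteq> carrier G" using R B by (auto simp: R'_def)
  define B2 where "B2 = (\<lambda>r. inv r) ` R'"
  have B2: "finite B2" "B2 \<subseteq> carrier G" using R' by (auto simp: B2_def)
  obtain R2 where R2: "finite R2" "R2 \<subseteq> carrier G" "\<And>x y. x \<in> carrier G \<Longrightarrow> y \<in> carrier G \<Longrightarrow> inv x \<otimes> y \<in> B2 \<Longrightarrow>
    inv (\<pi> x) \<otimes> \<pi> y \<in> F \<or> inv (\<pi> x) \<otimes> x \<in> R2" using contract[OF B2] by metis
  define E where "E = F \<union> (\<lambda>f. inv f) ` F \<union> (\<lambda>(r, s). r \<otimes> inv s) ` (R' \<times> R2)"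
  have "inv (\<pi> x) \<otimes> \<pi> y \<in> E" if xy: "x \<in> carrier G" "y \<in> carrier G" "inv x \<otimes> y \<in> B" for x y
  proof (cases "inv (\<pi> x) \<otimes> \<pi> y \<in> F")
    case False
    then have r: "inv (\<pi> x) \<otimes> x \<in> R" using R(3) xy by blast
    let ?p = "\<pi> x"
    have p: "?p \<in> P" "?p \<in> carrier G" and q: "\<pi> y \<in> carrier G" using \<pi> \<pi>_carrier xy by auto
    have "inv ?p \<otimes> y = (inv ?p \<otimes> x) \<otimes> (inv x \<otimes> y)" using p xy by (simp add: mult_cancel_middle)
    then have ry: "inv ?p \<otimes> y \<in> R'" using r xy by (auto simp: R'_def intro!: image_eqI[of _ _ "(_, _)"])
    then have "inv y \<otimes> ?p \<in> B2" using inv_mult_flip[OF p(2) xy(2)] by (auto simp: B2_def intro!: image_eqI[of _ _ "inv ?p \<otimes> y"])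
    then consider "inv (\<pi> y) \<otimes> ?p \<in> F" | "inv (\<pi> y) \<otimes> y \<in> R2" using R2(3)[OF xy(2) p(2)] \<pi>_id[OF p(1)] by auto
    then show ?thesis
    proof cases
      case 1
      then show ?thesis using inv_mult_flip[OF q p(2)] by (auto simp: E_def intro!: image_eqI[of _ _ "inv (\<pi> y) \<otimes> ?p"])
    next
      case 2
      have "(inv ?p \<otimes> y) \<otimes> inv (inv (\<pi> y) \<otimes> y) = inv ?p \<otimes> \<pi> y"
        unfolding inv_mult_flip[OF q xy(2)] using p q xy by (intro mult_cancel_middle) auto
      then have "inv ?p \<otimes> \<pi> y \<in> (\<lambda>(r, s). r \<otimes> inv s) ` (R' \<times> R2)"
        using ry 2 by (intro image_eqI[of _ _ "(inv ?p \<otimes> y, inv (\<pi> y) \<otimes> y)"]) auto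
      then show ?thesis by (simp add: E_def)
    qed
  qed (simp add: E_def)
  moreover have "inv (\<pi> x) \<otimes> \<pi> y \<in> P" if "x \<in> carrier G" "y \<in> carrier G" for x y
    using \<pi> that subgroup.m_closed[OF P] subgroup.m_inv_closed[OF P] by blast
  moreover have "finite E" using F R' R2 by (simp add: E_def)
  ultimately show ?thesis by (intro exI[of _ "E \<inter> P"]) auto
qed

text \<open>A word in \<open>S\<close> for an element of \<open>P\<close> is projected to a chain in
  \<open>P\<close>. Its successive quotients lie in the finite set \<open>E\<close> or are inverses
  of elements of \<open>E\<close>.\<close>

lemma finitely_generated_H:
  assumes S: "finite_generating_set G S"
  shows "finitely_generated_group H"
proof -
  have SG: "finite S" "S \<subseteq> carrier G" "generate G S = carrier G" using S by (auto simp: finite_generating_set_def)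
  obtain E where E: "finite E" "E \<subseteq> P" "\<And>x y. x \<in> carrier G \<Longrightarrow> y \<in> carrier G \<Longrightarrow> inv x \<otimes> y \<in> S \<Longrightarrow> inv (\<pi> x) \<otimes> \<pi> y \<in> E"
    using projection_finite[OF SG(1,2)] by metis
  have EG: "E \<subseteq> carrier G" using E(2) P_carrier by blast
  have step: "inv (\<pi> x) \<otimes> \<pi> (x \<otimes> s) \<in> E" if "x \<in> carrier G" "s \<in> S" for x s
  proof -
    have "inv x \<otimes> (x \<otimes> s) = s" using that SG(2) by (simp add: subset_iff flip: m_assoc)
    then show ?thesis using E(3)[of x "x \<otimes> s"] that SG(2) by auto
  qed
  have gen: "inv (\<pi> x) \<otimes> \<pi> (x \<otimes> h) \<in> generate G E" if "h \<in> generate G S" "x \<in> carrier G" for h x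
    using that
  proof (induction arbitrary: x)
    case one
    then show ?case using \<pi>_carrier generate.one by simp
  next
    case (incl h)
    then show ?case using step generate.incl by metis
  next
    case (inv h)
    then have h: "h \<in> carrier G" using SG(2) by blast
    let ?y = "x \<otimes> inv h"
    have y: "?y \<in> carrier G" "?y \<otimes> h = x" using h inv by (auto simp: m_assoc)
    have "inv (\<pi> ?y) \<otimes> \<pi> x \<in> E" using step[OF y(1) inv(1)] y(2) by simp
    then have "inv (inv (\<pi> ?y) \<otimes> \<pi> x) \<in> generate G E" by (rule generate.inv)
    then show ?case using inv_mult_flip[OF \<pi>_carrier[OF y(1)] \<pi>_carrier[OF inv(2)]] by simp
  next
    case (eng h k)
    have hk: "h \<in> carrier G" "k \<in> carrier G" using eng generate_in_carrier[OF SG(2)] by auto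
    have xh: "x \<otimes> h \<in> carrier G" using hk eng by simp
    have "(inv (\<pi> x) \<otimes> \<pi> (x \<otimes> h)) \<otimes> (inv (\<pi> (x \<otimes> h)) \<otimes> \<pi> (x \<otimes> h \<otimes> k)) \<in> generate G E"
      by (rule generate.eng[OF eng.IH(1)[OF eng.prems] eng.IH(2)[OF xh]])
    moreover have "(inv (\<pi> x) \<otimes> \<pi> (x \<otimes> h)) \<otimes> (inv (\<pi> (x \<otimes> h)) \<otimes> \<pi> (x \<otimes> h \<otimes> k)) = inv (\<pi> x) \<otimes> \<pi> (x \<otimes> h \<otimes> k)"
      using \<pi>_carrier hk eng.prems xh by (intro mult_cancel_middle) auto
    ultimately show ?case using hk eng.prems by (simp add: m_assoc)
  qed
  have "P \<subseteq> generate G E"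
  proof
    fix p assume p: "p \<in> P"
    have "inv (\<pi> \<one>) \<otimes> \<pi> (\<one> \<otimes> p) \<in> generate G E" using gen[of p \<one>] P_carrier[OF p] SG(3) by simp
    then show "p \<in> generate G E" using \<pi>_id p subgroup.one_closed[OF P] P_carrier[OF p] by simp
  qed
  moreover have "generate G E \<subseteq> P" by (rule generate_subgroup_incl[OF E(2) P])
  moreover have "generate H E = generate G E" using generate_consistent[OF E(2) P] by simp
  ultimately have "finite_generating_set H E" using E by (simp add: finite_generating_set_def)
  then show ?thesis using group_H by (auto simp: finitely_generated_group_def)
qed

end

section \<open>Word metrics: distortion and quasi-convexity\<close>

locale coarse_retract_gens = coarse_retract G P \<pi> F for G (structure) and P \<pi> F +
  fixes S T
  assumes S: "finite_generating_set G S" and T: "finite_generating_set (G\<lparr>carrier := P\<rparr>) T"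
begin

sublocale CG: cayley G S
  by (intro cayley.intro cayley_axioms.intro is_group S)

sublocale CH: cayley H T
  by (intro cayley.intro cayley_axioms.intro group_H T)

abbreviation "dG \<equiv> CG.K.dv"
abbreviation "dP \<equiv> CH.K.dv"

lemma vG [simp]: "x \<in> carrier G \<Longrightarrow> vertex x \<in> points (cayley_graph G S)"
  by (rule CG.K.vertex_points) simp

lemma vP [simp]: "x \<in> P \<Longrightarrow> vertex x \<in> points (cayley_graph H T)"
  by (rule CH.K.vertex_points) simp

lemma triG: "x \<in> carrier G \<Longrightarrow> y \<in> carrier G \<Longrightarrow> z \<in> carrier G \<Longrightarrow> dG x z \<le> dG x y + dG y z"
  by (intro CG.K.M.triangle vG)

lemma dG_commute: "dG x y = dG y x" by (rule CG.K.M.commute)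

lemma projection_lipschitz: "\<exists>c\<ge>0. \<forall>x\<in>carrier G. \<forall>y\<in>carrier G. dP (\<pi> x) (\<pi> y) \<le> c * dG x y"
proof -
  have SG: "finite S" "S \<subseteq> carrier G" using S by (auto simp: finite_generating_set_def)
  obtain E where E: "finite E" "E \<subseteq> P" "\<And>x y. x \<in> carrier G \<Longrightarrow> y \<in> carrier G \<Longrightarrow> inv x \<otimes> y \<in> S \<Longrightarrow> inv (\<pi> x) \<otimes> \<pi> y \<in> E"
    using projection_finite[OF SG] by metis
  obtain c where c: "0 \<le> c" "\<And>b. b \<in> E \<Longrightarrow> dP \<one> b \<le> c" using CH.finite_bounded[OF E(1)] E(2) by auto
  have "mdist (cayley_space H T) (vertex (\<pi> g)) (vertex (\<pi> (g \<otimes> s))) \<le> c" if "g \<in> carrier G" "s \<in> S" for g s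
  proof -
    have gs: "g \<otimes> s \<in> carrier G" "s \<in> carrier G" using that SG by auto
    have "inv g \<otimes> (g \<otimes> s) = s" using that gs by (simp flip: m_assoc)
    then have "inv (\<pi> g) \<otimes> \<pi> (g \<otimes> s) \<in> E" using E(3)[OF that(1) gs(1)] that by simp
    moreover have "inv\<^bsub>H\<^esub> (\<pi> g) = inv (\<pi> g)" using m_inv_consistent[OF P \<pi>[OF that(1)]] .
    then have "dP (\<pi> g) (\<pi> (g \<otimes> s)) = dP \<one> (inv (\<pi> g) \<otimes> \<pi> (g \<otimes> s))"
      using CH.dist_quotient[of "\<pi> g" "\<pi> (g \<otimes> s)"] \<pi> that gs by simp
    ultimately show ?thesis using c(2) by simp
  qed
  then have "mdist (cayley_space H T) (vertex (\<pi> x)) (vertex (\<pi> y)) \<le> c * dG x y" if "x \<in> carrier G" "y \<in> carrier G" for x y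
    using that c(1) \<pi> by (intro CG.lipschitz_from_generators) auto
  then show ?thesis using c(1) by auto
qed

lemma inclusion_lipschitz: "\<exists>c\<ge>0. \<forall>x\<in>P. \<forall>y\<in>P. dG x y \<le> c * dP x y"
proof -
  have TP: "finite T" "T \<subseteq> P" using T by (auto simp: finite_generating_set_def)
  then obtain c where c: "0 \<le> c" "\<And>b. b \<in> T \<Longrightarrow> dG \<one> b \<le> c" using CG.finite_bounded[OF TP(1)] P_carrier by blast
  have "mdist (cayley_space G S) (vertex g) (vertex (g \<otimes> t)) \<le> c" if "g \<in> P" "t \<in> T" for g t
  proof -
    have gt: "g \<in> carrier G" "t \<in> carrier G" using that TP P_carrier by auto
    then have "dG g (g \<otimes> t) = dG \<one> t" using CG.dist_quotient[of g "g \<otimes> t"] by (simp flip: m_assoc)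
    then show ?thesis using c(2)[OF that(2)] by simp
  qed
  then have "mdist (cayley_space G S) (vertex x) (vertex y) \<le> c * dP x y" if "x \<in> P" "y \<in> P" for x y
    using that c(1) P_carrier by (intro CH.lipschitz_from_generators) auto
  then show ?thesis using c(1) by auto
qed

text \<open>The projection fixes \<open>P\<close>, so its Lipschitz bound is a bound of
  \<open>dP\<close> by \<open>dG\<close> on \<open>P\<close>.\<close>

lemma undistorted: "\<exists>c\<ge>1. \<forall>x\<in>P. \<forall>y\<in>P. dG x y \<le> c * dP x y \<and> dP x y \<le> c * dG x y"
proof -
  obtain c where c: "0 \<le> c" "\<And>x y. x \<in> carrier G \<Longrightarrow> y \<in> carrier G \<Longrightarrow> dP (\<pi> x) (\<pi> y) \<le> c * dG x y"
    using projection_lipschitz by blast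
  obtain c' where c': "0 \<le> c'" "\<And>x y. x \<in> P \<Longrightarrow> y \<in> P \<Longrightarrow> dG x y \<le> c' * dP x y" using inclusion_lipschitz by blast
  have m: "a * dG x y \<le> max 1 (max c c') * dG x y" "a * dP x y \<le> max 1 (max c c') * dP x y" if "a \<in> {c, c'}" for a x y
    using that by (auto intro!: mult_right_mono)
  have "dG x y \<le> max 1 (max c c') * dP x y \<and> dP x y \<le> max 1 (max c c') * dG x y" if "x \<in> P" "y \<in> P" for x y
    using c(2)[of x y] c'(2)[OF that] m[of c x y] m[of c' x y] that P_carrier \<pi>_id by fastforce
  then show ?thesis by (intro exI[of _ "max 1 (max c c')"]) auto
qed

text \<open>Away from \<open>P\<close>, a step of length \<open>M\<close> moves the projection by at most a constant that does not
  depend on \<open>M\<close>. For large \<open>M\<close> this contradicts the quasi-geodesic inequality on long excursions.\<close>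

lemma strongly_quasiconvex:
  assumes K: "1 \<le> K" and L: "0 \<le> L" and C: "0 \<le> C"
  shows "\<exists>C'. \<forall>\<sigma> a b. a \<le> b \<and> quasi_geodesic (cayley_space G S) K L {a..b} \<sigma> \<and>
    (\<exists>p\<in>P. mdist (cayley_space G S) (\<sigma> a) (vertex p) \<le> C) \<and> (\<exists>p\<in>P. mdist (cayley_space G S) (\<sigma> b) (vertex p) \<le> C) \<longrightarrow>
    (\<forall>t\<in>{a..b}. \<exists>p\<in>P. mdist (cayley_space G S) (\<sigma> t) (vertex p) \<le> C')"
proof -
  obtain cF0 where cF0: "0 \<le> cF0" "\<And>f. f \<in> F \<Longrightarrow> dG \<one> f \<le> cF0"
    using CG.finite_bounded[OF F(1)] F(2) P_carrier by blast
  \<comment> \<open>The summand 1 makes \<open>cF\<close>, and with it the step length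
    \<open>M\<close>, positive.\<close>
  define cF where "cF = cF0 + 1"
  have cF: "1 \<le> cF" using cF0(1) by (simp add: cF_def)
  have cFF: "dG \<one> f \<le> cF" if "f \<in> F" for f using cF0(2)[OF that] by (simp add: cF_def)
  \<comment> \<open>During a time \<open>M\<close> the lower quasi-geodesic bound grows by
    \<open>M / K = 2 * cF\<close>, twice the motion of the projection.\<close>
  define M where "M = 2 * K * cF"
  have M: "0 < M" using K cF by (simp add: M_def)
  \<comment> \<open>The quotients of group elements within 1 of two points of the quasi-geodesic
    whose parameters differ by at most \<open>M\<close>.\<close>
  define B where "B = {b \<in> carrier G. dG \<one> b \<le> K * M + L + 2}"
  have "finite B" "B \<subseteq> carrier G" unfolding B_def using CG.finite_balls[of \<one>] by auto
  then obtain R where R: "finite R" "R \<subseteq> carrier G" "\<And>x y. x \<in> carrier G \<Longrightarrow> y \<in> carrier G \<Longrightarrow> inv x \<otimes> y \<in> B \<Longrightarrow>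
      inv (\<pi> x) \<otimes> \<pi> y \<in> F \<or> inv (\<pi> x) \<otimes> x \<in> R"
    using contract[of B] by metis
  obtain \<rho>0 where \<rho>0: "0 \<le> \<rho>0" "\<And>r. r \<in> R \<Longrightarrow> dG \<one> r \<le> \<rho>0" using CG.finite_bounded[OF R(1,2)] by blast
  obtain c where c: "0 \<le> c" "\<And>x y. x \<in> carrier G \<Longrightarrow> y \<in> carrier G \<Longrightarrow> dP (\<pi> x) (\<pi> y) \<le> c * dG x y"
    using projection_lipschitz by blast
  obtain c' where c': "0 \<le> c'" "\<And>x y. x \<in> P \<Longrightarrow> y \<in> P \<Longrightarrow> dG x y \<le> c' * dP x y" using inclusion_lipschitz by blast
  \<comment> \<open>Beyond \<open>\<rho>0\<close> the contraction applies. The second entry makes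
    the ends of the quasi-geodesic near: a group element within \<open>C + 1\<close> of
    \<open>P\<close> is within this distance of its projection.\<close>
  define \<rho> where "\<rho> = max \<rho>0 ((1 + c' * c) * (C + 1))"
  have far: "dG (\<pi> x) (\<pi> y) \<le> cF" if "x \<in> carrier G" "y \<in> carrier G" "dG x y \<le> K * M + L + 2" "\<not> dG x (\<pi> x) \<le> \<rho>" for x y
  proof -
    have "inv x \<otimes> y \<in> B" using that CG.dist_quotient[of x y] by (simp add: B_def)
    moreover have "inv (\<pi> x) \<otimes> x \<notin> R"
    proof
      assume "inv (\<pi> x) \<otimes> x \<in> R"
      then have "dG (\<pi> x) x \<le> \<rho>0" using \<rho>0(2) CG.dist_quotient[of "\<pi> x" x] that(1) \<pi>_carrier by simp
      then show False using that(4) dG_commute[of x "\<pi> x"] by (simp add: \<rho>_def)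
    qed
    ultimately show ?thesis
      using R(3) that(1,2) cFF CG.dist_quotient[of "\<pi> x" "\<pi> y"] \<pi>_carrier by auto
  qed
  \<comment> \<open>With \<open>i\<close> and \<open>j\<close> steps to near points on the two sides
    of \<open>t\<close>, one gets \<open>(i + j - 2) * (2 * cF) - L - 2 \<le> 2 * \<rho> + (i + j) *
    cF\<close>. Solving for \<open>(i + j) * cF\<close> gives \<open>Q\<close>.\<close>
  define Q where "Q = 2 * \<rho> + L + 2 + 4 * cF"
  let ?Y = "cayley_space G S"
  show ?thesis
  proof (rule exI[of _ "2 * K * K * Q + L + 1 + \<rho>"], intro allI impI ballI)
    fix \<sigma> a b t
    assume asm: "a \<le> b \<and> quasi_geodesic ?Y K L {a..b} \<sigma> \<and>
      (\<exists>p\<in>P. mdist ?Y (\<sigma> a) (vertex p) \<le> C) \<and> (\<exists>p\<in>P. mdist ?Y (\<sigma> b) (vertex p) \<le> C)" and t: "t \<in> {a..b}"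
    have qg: "quasi_geodesic ?Y K L {a..b} \<sigma>" using asm by blast
    have \<sigma>m: "\<sigma> s \<in> points (cayley_graph G S)" if "s \<in> {a..b}" for s using quasi_geodesicD(1)[OF qg that that] by simp
    have "\<exists>g\<in>carrier G. gdist (cayley_graph G S) (\<sigma> s) (vertex g) \<le> 1" if "s \<in> {a..b}" for s
      using CG.K.near_vertex[OF \<sigma>m[OF that]] by simp
    then obtain g where g: "\<And>s. s \<in> {a..b} \<Longrightarrow> g s \<in> carrier G \<and> gdist (cayley_graph G S) (\<sigma> s) (vertex (g s)) \<le> 1"
      by metis
    have up: "dG (g s) (g s') \<le> K * \<bar>s - s'\<bar> + L + 2" and low: "1 / K * \<bar>s - s'\<bar> - L - 2 \<le> dG (g s) (g s')"
      if s: "s \<in> {a..b}" "s' \<in> {a..b}" for s s'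
    proof -
      note d = quasi_geodesicD(2,3)[OF qg s, unfolded CG.K.mdist_X]
      note tri = CG.K.M.triangle
      have v: "vertex (g s) \<in> points (cayley_graph G S)" "vertex (g s') \<in> points (cayley_graph G S)" using g s by auto
      show "dG (g s) (g s') \<le> K * \<bar>s - s'\<bar> + L + 2"
        using tri[OF v(1) \<sigma>m[OF s(1)] v(2)] tri[OF \<sigma>m[OF s(1)] \<sigma>m[OF s(2)] v(2)] d g[OF s(1)] g[OF s(2)]
          CG.K.M.commute[of "vertex (g s)" "\<sigma> s"] by linarith
      show "1 / K * \<bar>s - s'\<bar> - L - 2 \<le> dG (g s) (g s')"
        using tri[OF \<sigma>m[OF s(1)] v(1) \<sigma>m[OF s(2)]] tri[OF v(1) v(2) \<sigma>m[OF s(2)]] d g[OF s(1)] g[OF s(2)]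
          CG.K.M.commute[of "vertex (g s')" "\<sigma> s'"] by linarith
    qed
    define near where "near s \<longleftrightarrow> dG (g s) (\<pi> (g s)) \<le> \<rho>" for s
    have near_end: "near s" if s: "s \<in> {a..b}" "\<exists>p\<in>P. mdist ?Y (\<sigma> s) (vertex p) \<le> C" for s
    proof -
      obtain p where p: "p \<in> P" "gdist (cayley_graph G S) (\<sigma> s) (vertex p) \<le> C" using s(2) by auto
      have gs: "g s \<in> carrier G" "\<pi> (g s) \<in> carrier G" "p \<in> carrier G" using g s \<pi>_carrier P_carrier p by auto
      have gp: "dG (g s) p \<le> C + 1"
        using CG.K.M.triangle[OF vG[OF gs(1)] \<sigma>m[OF s(1)] vG[OF gs(3)]] p(2) g[OF s(1)]
          CG.K.M.commute[of "vertex (g s)" "\<sigma> s"] by linarith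
      have "dG p (\<pi> (g s)) = dG (\<pi> (g s)) (\<pi> p)" using \<pi>_id[OF p(1)] dG_commute by simp
      also have "\<dots> \<le> c' * dP (\<pi> (g s)) (\<pi> p)" using c'(2) \<pi> gs by simp
      also have "\<dots> \<le> c' * (c * dG (g s) p)" using c(2)[OF gs(1,3)] c'(1) by (rule mult_left_mono)
      also have "\<dots> \<le> c' * (c * (C + 1))" using gp c(1) c'(1) by (intro mult_left_mono)
      finally have "dG (g s) (\<pi> (g s)) \<le> (1 + c' * c) * (C + 1)"
        using triG[OF gs(1,3,2)] gp by (simp add: algebra_simps)
      then show ?thesis by (simp add: near_def \<rho>_def)
    qed
    \<comment> \<open>At the first near index \<open>i\<close>, all earlier steps have started far
      from \<open>P\<close>, so each of them has moved the projection by at most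
      \<open>cF\<close>.\<close>
    have exit: "\<exists>i. near (u i) \<and> dG (\<pi> (g t)) (\<pi> (g (u i))) \<le> real i * cF \<and> (\<forall>l<i. \<not> near (u l))"
      if u: "u 0 = t" "\<And>i. u i \<in> {a..b}" "\<And>i. \<bar>u i - u (Suc i)\<bar> \<le> M" "near (u n)" for u :: "nat \<Rightarrow> real" and n
    proof -
      define i where "i = (LEAST i. near (u i))"
      have i: "near (u i)" "\<And>l. l < i \<Longrightarrow> \<not> near (u l)"
        unfolding i_def using LeastI[of "\<lambda>i. near (u i)" n] u(4) not_less_Least by auto
      have gu: "g (u l) \<in> carrier G" for l using g u(2) by blast
      have "dG (\<pi> (g t)) (\<pi> (g (u l))) \<le> real l * cF" if "l \<le> i" for l
        using that
      proof (induction l)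
        case 0
        then show ?case using u(1) \<pi>_carrier[OF gu[of 0]] by simp
      next
        case (Suc l)
        have "K * \<bar>u l - u (Suc l)\<bar> \<le> K * M" using u(3) K by (intro mult_left_mono) auto
        then have "dG (g (u l)) (g (u (Suc l))) \<le> K * M + L + 2" using up[OF u(2) u(2), of l "Suc l"] by linarith
        moreover have "\<not> near (u l)" using i(2) Suc.prems by simp
        ultimately have "dG (\<pi> (g (u l))) (\<pi> (g (u (Suc l)))) \<le> cF" using far gu by (simp add: near_def)
        moreover have "dG (\<pi> (g t)) (\<pi> (g (u (Suc l)))) \<le> dG (\<pi> (g t)) (\<pi> (g (u l))) + dG (\<pi> (g (u l))) (\<pi> (g (u (Suc l))))"
          using triG \<pi>_carrier gu u(1) by metis
        moreover have "dG (\<pi> (g t)) (\<pi> (g (u l))) \<le> real l * cF" using Suc by simp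
        ultimately show ?case by (simp add: algebra_simps)
      qed
      then show ?thesis using i by blast
    qed
    \<comment> \<open>Two marches from \<open>t\<close> towards \<open>b\<close> and
      \<open>a\<close> with step length \<open>M\<close>, halted at the ends of the
      interval.\<close>
    define u where "u i = min b (t + real i * M)" for i :: nat
    define w where "w i = max a (t - real i * M)" for i :: nat
    have reach: "\<exists>n :: nat. D \<le> real n * M" for D
    proof -
      obtain n :: nat where "D / M \<le> n" using real_arch_simple by blast
      then show ?thesis using M by (auto simp: field_simps)
    qed
    have iM: "0 \<le> real i * M" "real (Suc i) * M = real i * M + M" for i using M by (auto simp: algebra_simps)
    obtain n1 :: nat where "b - t \<le> real n1 * M" using reach by blast
    then have "u n1 = b" by (simp add: u_def)
    then have un: "near (u n1)" using near_end asm by auto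
    have u: "u 0 = t" "\<And>i. u i \<in> {a..b}" "\<And>i. \<bar>u i - u (Suc i)\<bar> \<le> M"
      using t M iM by (auto simp: u_def min_def abs_if simp del: of_nat_Suc intro: order_trans add_increasing2)
    obtain i where i: "near (u i)" "dG (\<pi> (g t)) (\<pi> (g (u i))) \<le> real i * cF" "\<forall>l<i. \<not> near (u l)"
      using exit[OF u un] by blast
    obtain n2 :: nat where "t - a \<le> real n2 * M" using reach by blast
    then have "w n2 = a" by (simp add: w_def)
    then have wn: "near (w n2)" using near_end asm by auto
    have "w i \<in> {a..b}" for i using t iM(1)[of i] by (auto simp: w_def)
    moreover have "\<bar>w i - w (Suc i)\<bar> \<le> M" for i using M iM(2)[of i] by (auto simp: w_def max_def simp del: of_nat_Suc)
    ultimately have w: "w 0 = t" "\<And>i. w i \<in> {a..b}" "\<And>i. \<bar>w i - w (Suc i)\<bar> \<le> M"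
      using t by (auto simp: w_def)
    obtain j where j: "near (w j)" "dG (\<pi> (g t)) (\<pi> (g (w j))) \<le> real j * cF" "\<forall>l<j. \<not> near (w l)"
      using exit[OF w wn] by blast
    \<comment> \<open>The end \<open>b\<close> is near, so the march can reach it only with its last
      step, and no other step is truncated. This explains \<open>real i - 1\<close>.\<close>
    have ui: "(real i - 1) * M \<le> u i - t"
    proof (cases i)
      case (Suc i')
      have "u i' \<noteq> b" using near_end[of b] asm i(3) Suc by force
      then have "t + real i' * M < b" by (auto simp: u_def min_def split: if_splits)
      then show ?thesis using Suc M by (simp add: u_def algebra_simps)
    qed (use u(1) M in simp)
    have wj: "(real j - 1) * M \<le> t - w j"
    proof (cases j)
      case (Suc j')
      have "w j' \<noteq> a" using near_end[of a] asm j(3) Suc by force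
      then have "a < t - real j' * M" by (auto simp: w_def max_def split: if_splits)
      then show ?thesis using Suc M by (simp add: w_def algebra_simps)
    qed (use w(1) M in simp)
    have gc: "g (u i) \<in> carrier G" "g (w j) \<in> carrier G" "g t \<in> carrier G" using g u(2) w(2) t by auto
    have "dG (g (u i)) (g (w j)) \<le> 2 * \<rho> + (real i + real j) * cF"
    proof -
      have "dG (g (u i)) (g (w j)) \<le> dG (g (u i)) (\<pi> (g (u i))) + dG (\<pi> (g (u i))) (g (w j))"
        "dG (\<pi> (g (u i))) (g (w j)) \<le> dG (\<pi> (g (u i))) (\<pi> (g t)) + dG (\<pi> (g t)) (g (w j))"
        "dG (\<pi> (g t)) (g (w j)) \<le> dG (\<pi> (g t)) (\<pi> (g (w j))) + dG (\<pi> (g (w j))) (g (w j))"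
        using gc \<pi>_carrier by (auto intro!: triG)
      then show ?thesis using i(1,2) j(1,2) dG_commute[of "\<pi> (g (u i))" "\<pi> (g t)"] dG_commute[of "\<pi> (g (w j))" "g (w j)"]
        by (simp add: near_def algebra_simps)
    qed
    moreover have "1 / K * \<bar>u i - w j\<bar> - L - 2 \<le> dG (g (u i)) (g (w j))" by (rule low[OF u(2) w(2)])
    moreover have "(real i + real j - 2) * (2 * cF) \<le> 1 / K * \<bar>u i - w j\<bar>"
    proof -
      have "(real i + real j - 2) * M \<le> \<bar>u i - w j\<bar>" using ui wj by (simp add: algebra_simps)
      then have "1 / K * ((real i + real j - 2) * M) \<le> 1 / K * \<bar>u i - w j\<bar>" using K by (intro mult_left_mono) auto
      moreover have "1 / K * ((real i + real j - 2) * M) = (real i + real j - 2) * (2 * cF)" using K by (simp add: M_def)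
      ultimately show ?thesis by simp
    qed
    ultimately have "(real i + real j) * cF \<le> Q" by (simp add: Q_def algebra_simps)
    moreover have "real i * cF \<le> (real i + real j) * cF" using cF by (intro mult_right_mono) auto
    ultimately have iQ: "real i * cF \<le> Q" by linarith
    have "\<bar>t - u i\<bar> \<le> real i * M" using t iM(1)[of i] by (auto simp: u_def)
    then have "K * \<bar>t - u i\<bar> \<le> K * (real i * M)" using K by (intro mult_left_mono) auto
    also have "\<dots> = 2 * K * K * (real i * cF)" by (simp add: M_def)
    also have "\<dots> \<le> 2 * K * K * Q" using iQ K by (intro mult_left_mono) auto
    finally have "mdist ?Y (\<sigma> t) (\<sigma> (u i)) \<le> 2 * K * K * Q + L" using quasi_geodesicD(3)[OF qg t u(2), of i] by linarith
    moreover have m: "\<sigma> t \<in> mspace ?Y" "\<sigma> (u i) \<in> mspace ?Y" "vertex (g (u i)) \<in> mspace ?Y" "vertex (\<pi> (g (u i))) \<in> mspace ?Y"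
      using \<sigma>m[OF t] \<sigma>m[OF u(2)[of i]] vG[OF gc(1)] vG[OF \<pi>_carrier[OF gc(1)]] by simp_all
    moreover have "mdist ?Y (\<sigma> t) (vertex (\<pi> (g (u i)))) \<le> mdist ?Y (\<sigma> t) (\<sigma> (u i)) + mdist ?Y (\<sigma> (u i)) (vertex (\<pi> (g (u i))))"
      "mdist ?Y (\<sigma> (u i)) (vertex (\<pi> (g (u i)))) \<le> mdist ?Y (\<sigma> (u i)) (vertex (g (u i))) + mdist ?Y (vertex (g (u i))) (vertex (\<pi> (g (u i))))"
      by (rule mdist_triangle[OF m(1,2,4)], rule mdist_triangle[OF m(2,3,4)])
    ultimately have "mdist ?Y (\<sigma> t) (vertex (\<pi> (g (u i)))) \<le> 2 * K * K * Q + L + 1 + \<rho>"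
      using g[OF u(2)[of i]] i(1) unfolding near_def CG.K.mdist_X by linarith
    then show "\<exists>p\<in>P. mdist ?Y (\<sigma> t) (vertex p) \<le> 2 * K * K * Q + L + 1 + \<rho>"
      using \<pi>[OF gc(1)] by blast
  qed
qed

text \<open>The two quasi-convexity axioms are of unequal depth. A point \<open>x\<close> over
  \<open>P\<close> always has the partner \<open>\<Phi> x\<close>; the axiom for \<open>G\<close> is
  \<open>strongly_quasiconvex\<close>.\<close>

lemma coarse_pair_inclusion:
  assumes \<Phi>: "cayley_extension H T G S (\<lambda>g. g) \<Phi>"
  shows "\<exists>k. coarse_pair (cayley_space H T) (vertex ` P) (vertex \<one>) (cayley_space G S) (vertex ` carrier G) (vertex \<one>)
    (\<lambda>x y. mdist (cayley_space G S) (\<Phi> x) y) k"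
proof -
  let ?X = "cayley_space H T" and ?Y = "cayley_space G S"
  obtain c where c: "1 \<le> c" "\<And>x y. x \<in> P \<Longrightarrow> y \<in> P \<Longrightarrow> dG x y \<le> c * dP x y" "\<And>x y. x \<in> P \<Longrightarrow> y \<in> P \<Longrightarrow> dP x y \<le> c * dG x y"
    using undistorted by blast
  have \<Phi>Y: "\<Phi> x \<in> mspace ?Y" if "x \<in> mspace ?X" for x using \<Phi> that unfolding cayley_extension_def by blast
  have \<Phi>v: "\<Phi> (vertex h) = vertex h" if "h \<in> P" for h using \<Phi> that by (simp add: cayley_extension_def)
  have \<Phi>e: "mdist ?Y (\<Phi> x) (\<Phi> y) = \<bar>x u - y u\<bar> * mdist ?Y (vertex u) (vertex w)"
    if "{u, w} \<in> edges (cayley_graph H T)" "x \<in> cell {u, w}" "y \<in> cell {u, w}" for u w x y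
    using \<Phi> that unfolding cayley_extension_def by blast
  \<comment> \<open>A point of an edge is within 1 of an endpoint. Its image is within
    \<open>c\<close> of that vertex, because \<open>\<Phi>\<close> has constant speed along the edge
    and the images of the ends are at most \<open>c\<close> apart.\<close>
  have near: "\<exists>h\<in>P. mdist ?X x (vertex h) \<le> 1 \<and> mdist ?Y (\<Phi> x) (vertex h) \<le> c" if x: "x \<in> mspace ?X" for x
  proof (cases "x \<in> vertex ` P")
    case True
    then obtain h where h: "h \<in> P" "x = vertex h" by blast
    then have "mdist ?X x (vertex h) = 0" "mdist ?Y (\<Phi> x) (vertex h) = 0" using \<Phi>v P_carrier by auto
    then show ?thesis using h(1) c(1) by (intro bexI[of _ h]) auto
  next
    case False
    have "x \<in> points (cayley_graph H T)" using x by simp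
    then obtain f where f: "f \<in> edges (cayley_graph H T)" "x \<in> cell f"
      using False unfolding points_def by auto
    then obtain u w where uw: "f = {u, w}" using CH.K.edge_card by (meson card_2_iff)
    have uP: "u \<in> P" "w \<in> P" using CH.K.edge_verts[OF f(1)] uw by auto
    have vu: "vertex u \<in> cell f" using uw by (simp add: vertex_in_cell)
    have "0 \<le> x u" "x u \<le> 1" using f(2) uw sum_nonneg_leq_bound[of f x 1 u] by (auto simp: cell_def)
    then have b: "\<bar>x u - vertex u u\<bar> \<le> 1" by (simp add: CH.K.vertex_apply)
    have "mdist ?X x (vertex u) \<le> 1" using CH.K.gdist_same_cell[OF f vu, of u] uw b by simp
    moreover have "dP u w \<le> 1" using CH.K.gdist_edge[of u w] f(1) uw by simp
    then have "c * dP u w \<le> c * 1" using c(1) by (intro mult_left_mono) auto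
    then have "dG u w \<le> c" using c(2)[OF uP] by linarith
    then have "\<bar>x u - vertex u u\<bar> * dG u w \<le> 1 * c" using b by (intro mult_mono) auto
    then have "mdist ?Y (\<Phi> x) (vertex u) \<le> c"
      using \<Phi>e[of u w x "vertex u"] f vu uw \<Phi>v[OF uP(1)] by simp
    ultimately show ?thesis using uP(1) by blast
  qed
  \<comment> \<open>Dominates the factor \<open>c\<close> and the additive errors
    \<open>2 * c + c * 2\<close> and \<open>2 + c * (2 * c)\<close> of the two estimates in
    \<open>lip\<close>.\<close>
  define k where "k = c * (2 * c) + 2 * c + 2"
  have "c * 1 \<le> c * c" using c(1) by (intro mult_left_mono) auto
  then have ck: "c \<le> k" "1 \<le> k" "2 * c + c * 2 \<le> k" "2 + c * (2 * c) \<le> k"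
    unfolding k_def using c(1) by linarith+
  have lip: "mdist ?Y (\<Phi> x) (\<Phi> x') \<le> k * mdist ?X x x' + k" "mdist ?X x x' \<le> k * mdist ?Y (\<Phi> x) (\<Phi> x') + k"
    if x: "x \<in> mspace ?X" "x' \<in> mspace ?X" for x x'
  proof -
    obtain h h' where h: "h \<in> P" "mdist ?X x (vertex h) \<le> 1" "mdist ?Y (\<Phi> x) (vertex h) \<le> c"
      and h': "h' \<in> P" "mdist ?X x' (vertex h') \<le> 1" "mdist ?Y (\<Phi> x') (vertex h') \<le> c"
      using near[OF x(1)] near[OF x(2)] by blast
    note s = h(2,3) h'(2,3)
    note hG = P_carrier[OF h(1)] P_carrier[OF h'(1)]
    let ?a = "mdist ?X x x'" and ?b = "mdist ?Y (\<Phi> x) (\<Phi> x')"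
    have vX: "vertex h \<in> mspace ?X" "vertex h' \<in> mspace ?X" and vY: "vertex h \<in> mspace ?Y" "vertex h' \<in> mspace ?Y"
      using h(1) h'(1) hG by auto
    have 1: "?b \<le> mdist ?Y (vertex h) (vertex h') + 2 * c"
      using mdist_triangle[OF \<Phi>Y[OF x(1)] vY(1) \<Phi>Y[OF x(2)]] mdist_triangle[OF vY(1,2) \<Phi>Y[OF x(2)]] s
        mdist_commute[of ?Y "vertex h'" "\<Phi> x'"] by linarith
    have 2: "mdist ?Y (vertex h) (vertex h') \<le> ?b + 2 * c"
      using mdist_triangle[OF vY(1) \<Phi>Y[OF x(1)] vY(2)] mdist_triangle[OF \<Phi>Y[OF x(1)] \<Phi>Y[OF x(2)] vY(2)] s
        mdist_commute[of ?Y "\<Phi> x" "vertex h"] by linarith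
    have 3: "?a \<le> mdist ?X (vertex h) (vertex h') + 2"
      using mdist_triangle[OF x(1) vX(1) x(2)] mdist_triangle[OF vX(1,2) x(2)] s
        mdist_commute[of ?X "vertex h'" x'] by linarith
    have 4: "mdist ?X (vertex h) (vertex h') \<le> ?a + 2"
      using mdist_triangle[OF vX(1) x(1) vX(2)] mdist_triangle[OF x(1,2) vX(2)] s
        mdist_commute[of ?X x "vertex h"] by linarith
    have 5: "mdist ?Y (vertex h) (vertex h') \<le> c * mdist ?X (vertex h) (vertex h')"
      "mdist ?X (vertex h) (vertex h') \<le> c * mdist ?Y (vertex h) (vertex h')" using c(2,3)[OF h(1) h'(1)] by auto
    have "c * mdist ?X (vertex h) (vertex h') \<le> c * (?a + 2)" using 4 c(1) by (intro mult_left_mono) auto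
    then have "?b \<le> c * ?a + (2 * c + c * 2)" using 1 5 by (simp add: algebra_simps)
    moreover have "c * ?a \<le> k * ?a" "c * ?b \<le> k * ?b" using ck(1) by (auto intro!: mult_right_mono)
    ultimately show "?b \<le> k * ?a + k" using ck(3) by linarith
    have "c * mdist ?Y (vertex h) (vertex h') \<le> c * (?b + 2 * c)" using 2 c(1) by (intro mult_left_mono) auto
    then have "?a \<le> c * ?b + (2 + c * (2 * c))" using 3 5 by (simp add: algebra_simps)
    then show "?a \<le> k * ?b + k" using ck(4) \<open>c * ?b \<le> k * ?b\<close> by linarith
  qed
  have kk: "z \<le> k * z" if "0 \<le> z" for z using mult_right_mono[OF ck(2) that] by simp
  have \<Phi>0: "mdist ?Y (\<Phi> x) (\<Phi> x) = 0" if "x \<in> mspace ?X" for x using \<Phi>Y[OF that] by simp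
  have "coarse_pair ?X (vertex ` P) (vertex \<one>) ?Y (vertex ` carrier G) (vertex \<one>) (\<lambda>x y. mdist ?Y (\<Phi> x) y) k"
  proof (intro coarse_pair.intro coarse_pair_axioms.intro)
    show "geo_space ?X (vertex ` P) (vertex \<one>)" using CH.geo_space_cayley by simp
    show "geo_space ?Y (vertex ` carrier G) (vertex \<one>)" by (rule CG.geo_space_cayley)
    show "1 \<le> k" by (rule ck(2))
    show "mdist ?Y (\<Phi> x) y' \<le> mdist ?Y (\<Phi> x) y + k * mdist ?Y y y' + k"
      if "x \<in> mspace ?X" "y \<in> mspace ?Y" "y' \<in> mspace ?Y" for x y y'
      using mdist_triangle[OF \<Phi>Y[OF that(1)] that(2,3)] kk[of "mdist ?Y y y'"] ck(2) mdist_nonneg[of ?Y y y'] by linarith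
    show "mdist ?Y (\<Phi> x') y \<le> mdist ?Y (\<Phi> x) y + k * mdist ?X x x' + k"
      if "x \<in> mspace ?X" "x' \<in> mspace ?X" "y \<in> mspace ?Y" for x x' y
      using mdist_triangle[OF \<Phi>Y[OF that(2)] \<Phi>Y[OF that(1)] that(3)] lip(1)[OF that(1,2)]
        mdist_commute[of ?Y "\<Phi> x'" "\<Phi> x"] by linarith
    show "mdist ?Y y y' \<le> k * mdist ?X x x' + k * mdist ?Y (\<Phi> x) y + k * mdist ?Y (\<Phi> x') y' + k"
      if "x \<in> mspace ?X" "x' \<in> mspace ?X" "y \<in> mspace ?Y" "y' \<in> mspace ?Y" for x x' y y'
      using mdist_triangle[OF that(3) \<Phi>Y[OF that(1)] that(4)] mdist_triangle[OF \<Phi>Y[OF that(1)] \<Phi>Y[OF that(2)] that(4)]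
        lip(1)[OF that(1,2)] mdist_commute[of ?Y y "\<Phi> x"] kk[of "mdist ?Y (\<Phi> x) y"] kk[of "mdist ?Y (\<Phi> x') y'"]
        mdist_nonneg[of ?Y "\<Phi> x" y] mdist_nonneg[of ?Y "\<Phi> x'" y'] by linarith
    show "mdist ?X x x' \<le> k * mdist ?Y y y' + k * mdist ?Y (\<Phi> x) y + k * mdist ?Y (\<Phi> x') y' + k"
      if "x \<in> mspace ?X" "x' \<in> mspace ?X" "y \<in> mspace ?Y" "y' \<in> mspace ?Y" for x x' y y'
    proof -
      have "mdist ?Y (\<Phi> x) (\<Phi> x') \<le> mdist ?Y y y' + mdist ?Y (\<Phi> x) y + mdist ?Y (\<Phi> x') y'"
        using mdist_triangle[OF \<Phi>Y[OF that(1)] that(3) \<Phi>Y[OF that(2)]] mdist_triangle[OF that(3,4) \<Phi>Y[OF that(2)]]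
          mdist_commute[of ?Y y' "\<Phi> x'"] by linarith
      then have "k * mdist ?Y (\<Phi> x) (\<Phi> x') \<le> k * (mdist ?Y y y' + mdist ?Y (\<Phi> x) y + mdist ?Y (\<Phi> x') y')"
        using ck(2) by (intro mult_left_mono) auto
      then show ?thesis using lip(2)[OF that(1,2)] by (simp add: algebra_simps)
    qed
    have "\<one> \<in> P" by (rule subgroup.one_closed[OF P])
    then show "mdist ?Y (\<Phi> (vertex \<one>)) (vertex \<one>) \<le> k" using \<Phi>v ck(2) by simp
    show "(\<forall>x\<in>mspace ?X. \<exists>y\<in>mspace ?Y. mdist ?Y (\<Phi> x) y \<le> k) \<or> (\<forall>y\<in>mspace ?Y. \<exists>x\<in>mspace ?X. mdist ?Y (\<Phi> x) y \<le> k)"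
    proof (intro disjI1 ballI)
      fix x assume x: "x \<in> mspace ?X"
      show "\<exists>y\<in>mspace ?Y. mdist ?Y (\<Phi> x) y \<le> k"
        by (rule bexI[OF _ \<Phi>Y[OF x]]) (use \<Phi>0[OF x] ck(2) in linarith)
    qed
  next
    fix K L C :: real assume KLC: "1 \<le> K" "0 \<le> L" "0 \<le> C"
    show "\<exists>C'. \<forall>\<sigma> a b. a \<le> b \<and> quasi_geodesic ?X K L {a..b} \<sigma> \<and>
      (\<exists>y\<in>mspace ?Y. mdist ?Y (\<Phi> (\<sigma> a)) y \<le> C) \<and> (\<exists>y\<in>mspace ?Y. mdist ?Y (\<Phi> (\<sigma> b)) y \<le> C) \<longrightarrow>
      (\<forall>t\<in>{a..b}. \<exists>y\<in>mspace ?Y. mdist ?Y (\<Phi> (\<sigma> t)) y \<le> C')"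
    proof (rule exI[of _ 0], intro allI impI ballI)
      fix \<sigma> a b t assume "a \<le> b \<and> quasi_geodesic ?X K L {a..b} \<sigma> \<and>
        (\<exists>y\<in>mspace ?Y. mdist ?Y (\<Phi> (\<sigma> a)) y \<le> C) \<and> (\<exists>y\<in>mspace ?Y. mdist ?Y (\<Phi> (\<sigma> b)) y \<le> C)" "t \<in> {a..b}"
      then have m: "\<sigma> t \<in> mspace ?X" using quasi_geodesicD(1) by blast
      show "\<exists>y\<in>mspace ?Y. mdist ?Y (\<Phi> (\<sigma> t)) y \<le> 0"
        by (rule bexI[OF _ \<Phi>Y[OF m]]) (use \<Phi>0[OF m] in linarith)
    qed
    \<comment> \<open>\<open>strongly_quasiconvex\<close> measures distances from elements of
      \<open>P\<close>; passing from the partner \<open>x\<close> to a nearby vertex costs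
      \<open>c\<close>.\<close>
    have "0 \<le> C + c" using KLC c(1) by simp
    from strongly_quasiconvex[OF KLC(1,2) this] obtain C' where C': "\<And>\<sigma> a b t. a \<le> b \<Longrightarrow> quasi_geodesic ?Y K L {a..b} \<sigma> \<Longrightarrow>
      \<exists>p\<in>P. mdist ?Y (\<sigma> a) (vertex p) \<le> C + c \<Longrightarrow> \<exists>p\<in>P. mdist ?Y (\<sigma> b) (vertex p) \<le> C + c \<Longrightarrow> t \<in> {a..b} \<Longrightarrow>
      \<exists>p\<in>P. mdist ?Y (\<sigma> t) (vertex p) \<le> C'" by metis
    show "\<exists>C'. \<forall>\<sigma> a b. a \<le> b \<and> quasi_geodesic ?Y K L {a..b} \<sigma> \<and>
      (\<exists>x\<in>mspace ?X. mdist ?Y (\<Phi> x) (\<sigma> a) \<le> C) \<and> (\<exists>x\<in>mspace ?X. mdist ?Y (\<Phi> x) (\<sigma> b) \<le> C) \<longrightarrow>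
      (\<forall>t\<in>{a..b}. \<exists>x\<in>mspace ?X. mdist ?Y (\<Phi> x) (\<sigma> t) \<le> C')"
    proof (rule exI[of _ C'], intro allI impI ballI)
      fix \<sigma> a b t assume asm: "a \<le> b \<and> quasi_geodesic ?Y K L {a..b} \<sigma> \<and>
        (\<exists>x\<in>mspace ?X. mdist ?Y (\<Phi> x) (\<sigma> a) \<le> C) \<and> (\<exists>x\<in>mspace ?X. mdist ?Y (\<Phi> x) (\<sigma> b) \<le> C)" and t: "t \<in> {a..b}"
      have qg: "quasi_geodesic ?Y K L {a..b} \<sigma>" using asm by blast
      have end_near: "\<exists>p\<in>P. mdist ?Y (\<sigma> s) (vertex p) \<le> C + c"
        if s: "s \<in> {a..b}" and ex: "\<exists>x\<in>mspace ?X. mdist ?Y (\<Phi> x) (\<sigma> s) \<le> C" for s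
      proof -
        obtain x where x: "x \<in> mspace ?X" "mdist ?Y (\<Phi> x) (\<sigma> s) \<le> C" using ex by blast
        obtain h where h: "h \<in> P" "mdist ?Y (\<Phi> x) (vertex h) \<le> c" using near[OF x(1)] by blast
        have sm: "\<sigma> s \<in> mspace ?Y" by (rule quasi_geodesicD(1)[OF qg s s])
        have hm: "vertex h \<in> mspace ?Y" using P_carrier[OF h(1)] by simp
        have "mdist ?Y (\<sigma> s) (vertex h) \<le> C + c"
          using mdist_triangle[OF sm \<Phi>Y[OF x(1)] hm] x(2) h(2) mdist_commute[of ?Y "\<sigma> s" "\<Phi> x"] by linarith
        then show ?thesis using h(1) by blast
      qed
      obtain p where p: "p \<in> P" "mdist ?Y (\<sigma> t) (vertex p) \<le> C'"
        using C'[OF _ qg end_near end_near t] asm by auto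
      have "vertex p \<in> mspace ?X" using p(1) by simp
      moreover have "mdist ?Y (\<Phi> (vertex p)) (\<sigma> t) \<le> C'" using p(2) \<Phi>v[OF p(1)] mdist_commute[of ?Y "\<sigma> t" "vertex p"] by simp
      ultimately show "\<exists>x\<in>mspace ?X. mdist ?Y (\<Phi> x) (\<sigma> t) \<le> C'" by blast
    qed
  qed
  then show ?thesis by blast
qed

end

theorem theorem1p4:
  fixes G :: "('a, 'b) monoid_scheme" and \<P> :: "'a set set" and P :: "'a set"
  assumes "relatively_hyperbolic G \<P>"
    and "P \<in> \<P>"
  shows "induces_morse_preserving_map (G\<lparr>carrier := P\<rparr>) G (\<lambda>g. g) \<and>
    (\<forall>T S \<Phi>. finite_generating_set (G\<lparr>carrier := P\<rparr>) T \<and> finite_generating_set G S \<and>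
       cayley_extension (G\<lparr>carrier := P\<rparr>) T G S (\<lambda>g. g) \<Phi> \<longrightarrow>
       embedding_map (group_boundary_topology (G\<lparr>carrier := P\<rparr>) T) (group_boundary_topology G S)
         (group_boundary_map (G\<lparr>carrier := P\<rparr>) T G S \<Phi>))"
proof -
  let ?H = "G\<lparr>carrier := P\<rparr>"
  obtain S0 where G: "group G" and sub: "subgroup P G" and S0: "finite_generating_set G S0"
    using assms unfolding relatively_hyperbolic_def by blast
  \<comment> \<open>Obtained before \<open>T\<close> and \<open>S\<close>: one projection serves all
    generating sets.\<close>
  obtain \<pi> F where proj: "finite F" "F \<subseteq> P" "\<pi> \<in> carrier G \<rightarrow> P" "\<forall>p\<in>P. \<pi> p = p"
    "\<And>B. finite B \<and> B \<subseteq> carrier G \<Longrightarrow> \<exists>R. finite R \<and> R \<subseteq> carrier G \<and> (\<forall>x\<in>carrier G. \<forall>y\<in>carrier G.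
      inv\<^bsub>G\<^esub> x \<otimes>\<^bsub>G\<^esub> y \<in> B \<longrightarrow> inv\<^bsub>G\<^esub> (\<pi> x) \<otimes>\<^bsub>G\<^esub> \<pi> y \<in> F \<or> inv\<^bsub>G\<^esub> (\<pi> x) \<otimes>\<^bsub>G\<^esub> x \<in> R)"
    using peripheral_projection[OF assms] by metis
  have cr: "coarse_retract G P \<pi> F"
    using G sub proj by (intro coarse_retract.intro coarse_retract_axioms.intro) auto
  have gens: "coarse_retract_gens G P \<pi> F S T" if "finite_generating_set ?H T" "finite_generating_set G S" for S T
    using cr that by (intro coarse_retract_gens.intro coarse_retract_gens_axioms.intro)
  have main: "boundary_map_defined (cayley_space ?H T) (vertex \<one>\<^bsub>?H\<^esub>) (cayley_space G S) (vertex \<one>\<^bsub>G\<^esub>) \<Phi> \<and>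
      morse_preserving (cayley_space ?H T) (vertex \<one>\<^bsub>?H\<^esub>) (cayley_space G S) (vertex \<one>\<^bsub>G\<^esub>)
          (group_boundary_map ?H T G S \<Phi>) \<and>
      embedding_map (group_boundary_topology ?H T) (group_boundary_topology G S) (group_boundary_map ?H T G S \<Phi>)"
    if asm: "finite_generating_set ?H T \<and> finite_generating_set G S \<and> cayley_extension ?H T G S (\<lambda>g. g) \<Phi>" for T S \<Phi>
  proof -
    have \<Phi>: "\<Phi> ` mspace (cayley_space ?H T) \<subseteq> mspace (cayley_space G S)"
      using asm unfolding cayley_extension_def by blast
    obtain k where "coarse_pair (cayley_space ?H T) (vertex ` P) (vertex \<one>\<^bsub>G\<^esub>) (cayley_space G S) (vertex ` carrier G) (vertex \<one>\<^bsub>G\<^esub>)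
      (\<lambda>x y. mdist (cayley_space G S) (\<Phi> x) y) k"
      using coarse_retract_gens.coarse_pair_inclusion[OF gens] asm by blast
    from boundary_map_embedding[OF this \<Phi>] show ?thesis by simp
  qed
  have "group_qi_embedding ?H G (\<lambda>g. g)"
    unfolding group_qi_embedding_def
  proof (intro conjI allI impI)
    show "(\<lambda>g. g) ` carrier ?H \<subseteq> carrier G" using subgroup.subset[OF sub] by simp
    fix T S assume "finite_generating_set ?H T \<and> finite_generating_set G S"
    then interpret coarse_retract_gens G P \<pi> F S T using gens by blast
    obtain c where c: "1 \<le> c" "\<And>x y. x \<in> P \<Longrightarrow> y \<in> P \<Longrightarrow> dG x y \<le> c * dP x y \<and> dP x y \<le> c * dG x y"
      using undistorted by blast
    have "1 / c * dP x y \<le> dG x y" if "x \<in> P" "y \<in> P" for x y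
      using c(2)[OF that] c(1) by (simp add: field_simps)
    then show "\<exists>K\<ge>1. \<exists>L\<ge>0. \<forall>g\<in>carrier ?H. \<forall>h\<in>carrier ?H.
       1 / K * mdist (cayley_space ?H T) (vertex g) (vertex h) - L \<le> mdist (cayley_space G S) (vertex g) (vertex h) \<and>
       mdist (cayley_space G S) (vertex g) (vertex h) \<le> K * mdist (cayley_space ?H T) (vertex g) (vertex h) + L"
      using c by (intro exI[of _ c] conjI exI[of _ 0]) auto
  qed
  moreover have "finitely_generated_group ?H" by (rule coarse_retract.finitely_generated_H[OF cr S0])
  moreover have "finitely_generated_group G" using G S0 by (auto simp: finitely_generated_group_def)
  ultimately show ?thesis using main unfolding induces_morse_preserving_map_def by blast
qed

end
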